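(* Let $1\le p<\infty$, $0<q<\infty$, and let $s,t$ be real numbers. Let $\mu$ be a positive Borel measure on $\mathbb{B}_n$. Then the embedding operator $i:B_p(\mathbb{B}_n)\to T^q_{s,t}(\mathbb{B}_n,\mu)$ is bounded if and only if $$\|\mu\|_{s,t,p,q}:=\sup_{a\in\mathbb{B}_n}\frac{\mu(D(a,R))}{(1-|a|^2)^s\left(\log\frac{2}{1-|a|^2}\right)^{t-q+\frac qp}}<\infty$$ for some (or any) $R>0$. Furthermore, $$\|i\|^q_{B_p(\mathbb{B}_n)\to T^q_{s,t}(\mathbb{B}_n,\mu)}\asymp\|\mu\|_{s,t,p,q}.$$
   Context: $\mathbb{B}_n$ is the open unit ball of $\mathbb{C}^n$ ($n\ge1$), $H(\mathbb{B}_n)$ the space of holomorphic functions on $\mathbb{B}_n$, $dv$ normalized volume measure, $d\tau(z)=(1-|z|^2)^{-n-1}dv(z)$. Besov space: for $0<p<\infty$, $B_p(\mathbb{B}_n)$ is the space of $f\in H(\mathbb{B}_n)$ such that $(1-|z|^2)^N\frac{\partial^m f}{\partial z^m}(z)\in L^p(\mathbb{B}_n,d\tau)$ for all multi-indices $m$ with $|m|=N$, for some positive integer $N>n/p$ (equivalently, for every such $N$). With such an $N$ fixed, the norm is $$\|f\|_{B_p}=\sum_{|m|\le N-1}\left|\frac{\partial^m f}{\partial z^m}(0)\right|+\sum_{|m|=N}\left(\int_{\mathbb{B}_n}\left|(1-|z|^2)^N\frac{\partial^m f}{\partial z^m}(z)\right|^p d\tau(z)\right)^{1/p}.$$ Bergman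 metric balls: $D(a,R)=\{w\in\mathbb{B}_n:\beta(a,w)<R\}$, where $\beta(z,w)=\frac12\log\frac{1+|\varphi_z(w)|}{1-|\varphi_z(w)|}$ and $\varphi_z$ is the involutive automorphism of $\mathbb{B}_n$ interchanging $0$ and $z$. Logarithmic tent space: for $0<q<\infty$, real $s,t$, and a fixed $R>0$, $T^q_{s,t}(\mathbb{B}_n,\mu)=T^q_{s,t,R}(\mathbb{B}_n,\mu)$ is the set of $\mu$-measurable functions $f$ on $\mathbb{B}_n$ with $$\|f\|^q_{T^q_{s,t,R}(\mathbb{B}_n,\mu)}=\sup_{a\in\mathbb{B}_n}\frac{\int_{D(a,R)}|f(z)|^q\,d\mu(z)}{(1-|a|^2)^s\left(\log\frac{2}{1-|a|}\right)^t}<\infty;$$ the space does not depend on $R$. The operator $i$ is the inclusion $f\mapsto f$; it is bounded if it maps the source into the target with $\|f\|_{T^q_{s,t}(\mathbb{B}_n,\mu)}\le C\|f\|_{B_p}$, and $\|i\|$ is the smallest such $C$. "For some (or any) $R>0$" means the equivalence holds with either quantifier. $A\asymp B$ means $C^{-1}B\le A\le CB$ with a constant $C>0$ independent of $\mu$ (it may depend on the parameters and on $R$). *)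

theory Defs
  imports "HOL-Analysis.Analysis"
begin

abbreviation unit_ball :: "(complex ^ 'n) set" where
  "unit_ball \<equiv> ball 0 1"

text \<open>
  Functions on the unit ball are total functions on \<open>\<complex>\<^sup>n\<close> (with \<open>n = CARD('n)\<close>); the notions below
  only depend on their values inside the ball.
\<close>

definition holomorphic_on_ball :: "(complex ^ 'n \<Rightarrow> complex) \<Rightarrow> bool" where
  "holomorphic_on_ball f \<longleftrightarrow>
     (\<forall>z\<in>unit_ball. \<exists>D. (f has_derivative D) (at z) \<and> (\<forall>c v. D (c *s v) = c * D v))"

definition partial_deriv :: "'n \<Rightarrow> (complex ^ 'n \<Rightarrow> complex) \<Rightarrow> complex ^ 'n \<Rightarrow> complex" where
  "partial_deriv j f z = deriv (\<lambda>w. f (\<chi> i. if i = j then w else z $ i)) (z $ j)"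

text \<open>
  A multi-index is a function \<open>m :: 'n \<Rightarrow> nat\<close> of order \<open>sum m UNIV\<close>. The partial derivatives are taken
  in the order of an arbitrary enumeration of the coordinates, which is immaterial for
  holomorphic functions because mixed partial derivatives commute.
\<close>

definition coordinate_list :: "'n::finite list" where
  "coordinate_list = (SOME js. distinct js \<and> set js = UNIV)"

definition multi_deriv :: "('n::finite \<Rightarrow> nat) \<Rightarrow> (complex ^ 'n \<Rightarrow> complex) \<Rightarrow> complex ^ 'n \<Rightarrow> complex" where
  "multi_deriv m f = foldr (\<lambda>j. partial_deriv j ^^ m j) coordinate_list f"

definition ball_volume :: "(complex ^ 'n) measure" where
  "ball_volume =
     scale_measure (1 / emeasure lborel (unit_ball :: (complex ^ 'n) set)) (restrict_space lborel unit_ball)"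

definition invariant_measure :: "(complex ^ 'n) measure" where
  "invariant_measure =
     density ball_volume (\<lambda>z. ennreal ((1 - (norm z)\<^sup>2) powr (- real CARD('n) - 1)))"

text \<open>Real powers of extended nonnegative reals, intended for a positive exponent.\<close>

definition ennreal_powr :: "ennreal \<Rightarrow> real \<Rightarrow> ennreal" where
  "ennreal_powr x a = (if x = top then top else ennreal (enn2real x powr a))"

definition Lp_norm :: "real \<Rightarrow> 'a measure \<Rightarrow> ('a \<Rightarrow> complex) \<Rightarrow> ennreal" where
  "Lp_norm p M g = ennreal_powr (\<integral>\<^sup>+ x. ennreal (cmod (g x) powr p) \<partial>M) (1 / p)"

definition Lp_space :: "real \<Rightarrow> 'a measure \<Rightarrow> ('a \<Rightarrow> complex) set" where
  "Lp_space p M = {g \<in> borel_measurable M. Lp_norm p M g < top}"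

definition besov_deriv :: "nat \<Rightarrow> ('n::finite \<Rightarrow> nat) \<Rightarrow> (complex ^ 'n \<Rightarrow> complex) \<Rightarrow> complex ^ 'n \<Rightarrow> complex" where
  "besov_deriv N m f z = of_real ((1 - (norm z)\<^sup>2) ^ N) * multi_deriv m f z"

definition besov_space :: "real \<Rightarrow> (complex ^ 'n \<Rightarrow> complex) set" where
  "besov_space p =
     {f. holomorphic_on_ball f \<and>
         (\<exists>N. 0 < N \<and> real CARD('n) / p < real N \<and>
              (\<forall>m. sum m UNIV = N \<longrightarrow> besov_deriv N m f \<in> Lp_space p invariant_measure))}"

definition besov_norm :: "nat \<Rightarrow> real \<Rightarrow> (complex ^ 'n \<Rightarrow> complex) \<Rightarrow> ennreal" where
  "besov_norm N p f =
     (\<Sum>m | sum m UNIV \<le> N - 1. ennreal (cmod (multi_deriv m f 0))) +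
     (\<Sum>m | sum m UNIV = N. Lp_norm p invariant_measure (besov_deriv N m f))"

definition hermitian :: "complex ^ 'n \<Rightarrow> complex ^ 'n \<Rightarrow> complex" where
  "hermitian z w = (\<Sum>i\<in>UNIV. z $ i * cnj (w $ i))"

text \<open>
  The involutive automorphism of the ball interchanging \<open>0\<close> and \<open>a\<close>. Here \<open>ball_proj a\<close> is the
  orthogonal projection onto the complex line through \<open>a\<close>; for \<open>a = 0\<close> it is \<open>0\<close>, since
  \<open>x / 0 = 0\<close>, so that \<open>ball_involution 0 w = - w\<close>.
\<close>

definition ball_proj :: "complex ^ 'n \<Rightarrow> complex ^ 'n \<Rightarrow> complex ^ 'n" where
  "ball_proj a w = (hermitian w a / hermitian a a) *s a"

definition ball_involution :: "complex ^ 'n \<Rightarrow> complex ^ 'n \<Rightarrow> complex ^ 'n" where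
  "ball_involution a w =
     (1 / (1 - hermitian w a)) *s
       (a - ball_proj a w - sqrt (1 - (norm a)\<^sup>2) *\<^sub>R (w - ball_proj a w))"

definition bergman_metric :: "complex ^ 'n \<Rightarrow> complex ^ 'n \<Rightarrow> real" where
  "bergman_metric z w =
     1 / 2 * ln ((1 + norm (ball_involution z w)) / (1 - norm (ball_involution z w)))"

definition bergman_ball :: "complex ^ 'n \<Rightarrow> real \<Rightarrow> (complex ^ 'n) set" where
  "bergman_ball a R = {w \<in> unit_ball. bergman_metric a w < R}"

definition borel_measures_on_ball :: "(complex ^ 'n) measure set" where
  "borel_measures_on_ball = {\<mu>. sets \<mu> = sets (restrict_space borel unit_ball)}"

definition tent_norm ::
    "real \<Rightarrow> real \<Rightarrow> real \<Rightarrow> real \<Rightarrow> (complex ^ 'n) measure \<Rightarrow> (complex ^ 'n \<Rightarrow> complex) \<Rightarrow> ennreal" where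
  "tent_norm q s t R \<mu> f =
     ennreal_powr
       (SUP a\<in>unit_ball.
          (\<integral>\<^sup>+ z\<in>bergman_ball a R. ennreal (cmod (f z) powr q) \<partial>\<mu>) /
          ennreal ((1 - (norm a)\<^sup>2) powr s * ln (2 / (1 - norm a)) powr t))
       (1 / q)"

definition tent_space ::
    "real \<Rightarrow> real \<Rightarrow> real \<Rightarrow> real \<Rightarrow> (complex ^ 'n) measure \<Rightarrow> (complex ^ 'n \<Rightarrow> complex) set" where
  "tent_space q s t R \<mu> = {f \<in> borel_measurable \<mu>. tent_norm q s t R \<mu> f < top}"

text \<open>
  \<open>embedding_bound N p q s t R \<mu> C\<close>: the inclusion maps \<open>B\<^sub>p\<close> into the tent space with constant \<open>C\<close>,
  the Besov norm being the one built from derivatives of order \<open>N\<close>.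
\<close>

definition embedding_bound ::
    "nat \<Rightarrow> real \<Rightarrow> real \<Rightarrow> real \<Rightarrow> real \<Rightarrow> real \<Rightarrow> (complex ^ 'n) measure \<Rightarrow> real \<Rightarrow> bool" where
  "embedding_bound N p q s t R \<mu> C \<longleftrightarrow>
     0 \<le> C \<and>
     (\<forall>f\<in>besov_space p. f \<in> tent_space q s t R \<mu> \<and>
        tent_norm q s t R \<mu> f \<le> ennreal C * besov_norm N p f)"

definition embedding_bounded ::
    "nat \<Rightarrow> real \<Rightarrow> real \<Rightarrow> real \<Rightarrow> real \<Rightarrow> real \<Rightarrow> (complex ^ 'n) measure \<Rightarrow> bool" where
  "embedding_bounded N p q s t R \<mu> \<longleftrightarrow> (\<exists>C. embedding_bound N p q s t R \<mu> C)"

text \<open>The operator norm; it is \<open>\<top>\<close> if the embedding is unbounded.\<close>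

definition embedding_norm ::
    "nat \<Rightarrow> real \<Rightarrow> real \<Rightarrow> real \<Rightarrow> real \<Rightarrow> real \<Rightarrow> (complex ^ 'n) measure \<Rightarrow> ennreal" where
  "embedding_norm N p q s t R \<mu> = Inf {ennreal C | C. embedding_bound N p q s t R \<mu> C}"

definition carleson_norm ::
    "real \<Rightarrow> real \<Rightarrow> real \<Rightarrow> real \<Rightarrow> real \<Rightarrow> (complex ^ 'n) measure \<Rightarrow> ennreal" where
  "carleson_norm s t p q R \<mu> =
     (SUP a\<in>unit_ball.
        emeasure \<mu> (bergman_ball a R) /
        ennreal ((1 - (norm a)\<^sup>2) powr s * ln (2 / (1 - (norm a)\<^sup>2)) powr (t - q + q / p)))"

end

theory Submission
  imports Defs "HOL-Complex_Analysis.Cauchy_Integral_Formula"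
begin

text \<open>
  Write \<open>L(z) = log (2 / (1 - |z|\<^sup>2))\<close>. Sufficiency rests on the growth estimate
  \<open>|f(z)| \<le> C \<parallel>f\<parallel> L(z)\<^bsup>1 - 1/p\<^esup>\<close> for \<open>f \<in> B\<^sub>p\<close>. By Taylor's formula on the segment from \<open>0\<close> to \<open>z\<close>
  it reduces to bounding \<open>\<integral> (1 - t)\<^bsup>N-1\<^esup> |g(tz)| dt\<close> for \<open>g = \<partial>\<^sup>m f\<close>, \<open>|m| = N\<close>. The mean value
  inequality on the nonisotropic ball around \<open>w\<close> (radius \<open>1 - |w|\<close> in the complex direction of \<open>w\<close> and
  \<open>(1 - |w|)\<^bsup>1/2\<^esup>\<close> orthogonally to it, hence of bounded invariant volume) together with
  \<open>x \<le> \<lambda>\<^bsup>p-1\<^esup> x\<^sup>p + 1/\<lambda>\<close> gives \<open>(1 - |w|)\<^sup>N |g(w)| \<le> C (\<lambda>\<^bsup>p-1\<^esup> \<Psi> + 1/\<lambda>)\<close>, where \<open>\<Psi>\<close> is the part of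
  the Besov integral over the spherical shell at \<open>w\<close>. The shells met by the segment have bounded overlap
  with respect to \<open>dt / (1 - t|z|)\<close>, whose total mass is comparable to \<open>L(z)\<close>; choose
  \<open>\<lambda> = L(z)\<^bsup>1/p\<^esup> / \<parallel>f\<parallel>\<close>.

  Necessity follows by testing with \<open>log (4 / (1 - \<langle>z, a\<rangle>))\<close>, which is at least \<open>c L(a)\<close> on \<open>D(a, r)\<close>
  and has Besov norm at most \<open>C L(a)\<^bsup>1/p\<^esup>\<close> by the critical case of the Forelli--Rudin estimate.
  Different radii are compared by covering \<open>D(a, r)\<close> with the images under the involution \<open>\<phi>\<^sub>a\<close> of
  finitely many balls covering \<open>D(0, r)\<close>.
\<close>

section \<open>Hermitian products and the geometry of Bergman balls\<close>

text \<open>Both directions lead to the exponent \<open>t - q + q / p\<close>. The growth estimate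
  contributes the power q (1 - 1/p) of \<open>L\<close> to an integral over D(a, r); the test
  function has size \<open>L\<close> there and norm L^(1/p), which costs the same power.

  The obstacle in the growth estimate is the critical index. Bounding (1 - |w|)^N |g(w)| by the full
  norm would give \<open>L\<close> to the power 1. The gain 1/p appears because points of the
  segment draw on almost disjoint shells, which is Hoelder's inequality for dt / (1 - t|z|). The
  parameter \<lambda> linearises Hoelder: all estimates stay additive and p = 1 is treated like the
  other exponents. Shells are used in place of the balls inside them because they depend on |w|
  alone, so that counting overlaps is a question about intervals.

  Holomorphy is given as real differentiability with a complex linear derivative. That partial
  derivatives are again holomorphic, and commute, is obtained from uniform limits of difference
  quotients; Cauchy's estimates are applied only on complex lines.\<close>

lemma hermitian_add_left: "hermitian (x + y) z = hermitian x z + hermitian y z"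
  by (simp add: hermitian_def distrib_right sum.distrib)

lemma hermitian_add_right: "hermitian z (x + y) = hermitian z x + hermitian z y"
  by (simp add: hermitian_def distrib_left sum.distrib)

lemma hermitian_diff_left: "hermitian (x - y) z = hermitian x z - hermitian y z"
  by (simp add: hermitian_def left_diff_distrib sum_subtractf)

lemma hermitian_diff_right: "hermitian z (x - y) = hermitian z x - hermitian z y"
  by (simp add: hermitian_def right_diff_distrib sum_subtractf)

lemma hermitian_cmult_left: "hermitian (c *s x) y = c * hermitian x y"
  by (simp add: hermitian_def sum_distrib_left mult.assoc)

lemma hermitian_cmult_right: "hermitian x (c *s y) = cnj c * hermitian x y"
  by (simp add: hermitian_def sum_distrib_left mult_ac)

lemma scaleR_eq_cmult: "r *\<^sub>R (x :: complex ^ 'n) = of_real r *s x"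
  unfolding vec_eq_iff vector_scaleR_component vector_smult_component by (simp add: scaleR_conv_of_real)

lemma hermitian_scaleR_left: "hermitian (r *\<^sub>R x) y = of_real r * hermitian x y"
  by (simp add: scaleR_eq_cmult hermitian_cmult_left)

lemma hermitian_scaleR_right: "hermitian x (r *\<^sub>R y) = of_real r * hermitian x y"
  by (simp add: scaleR_eq_cmult hermitian_cmult_right)

lemma hermitian_zero [simp]: "hermitian 0 x = 0" "hermitian x 0 = 0"
  by (simp_all add: hermitian_def)

lemmas hermitian_simps = hermitian_add_left hermitian_add_right hermitian_diff_left
  hermitian_diff_right hermitian_cmult_left hermitian_cmult_right hermitian_scaleR_left
  hermitian_scaleR_right

lemma cnj_hermitian: "cnj (hermitian x y) = hermitian y x"
  by (simp add: hermitian_def mult.commute)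

lemma hermitian_self: "hermitian x x = of_real ((norm x)\<^sup>2)"
proof -
  have "hermitian x x = (\<Sum>i\<in>UNIV. of_real ((cmod (x $ i))\<^sup>2))"
    unfolding hermitian_def by (rule sum.cong) (simp_all add: complex_norm_square[symmetric])
  also have "\<dots> = of_real (\<Sum>i\<in>UNIV. (cmod (x $ i))\<^sup>2)" by simp
  also have "(\<Sum>i\<in>UNIV. (cmod (x $ i))\<^sup>2) = (norm x)\<^sup>2"
    by (simp add: norm_vec_def L2_set_def sum_nonneg)
  finally show ?thesis .
qed

lemma norm_cmult: "norm (c *s (x :: complex ^ 'n)) = cmod c * norm x"
proof -
  have "complex_of_real ((norm (c *s x))\<^sup>2) = of_real ((cmod c * norm x)\<^sup>2)"
    unfolding hermitian_self[symmetric] hermitian_simps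
    by (simp add: hermitian_self power_mult_distrib complex_norm_square mult_ac flip: of_real_power)
  hence "(norm (c *s x))\<^sup>2 = (cmod c * norm x)\<^sup>2" using of_real_eq_iff by blast
  thus ?thesis by (simp add: power2_eq_iff_nonneg)
qed

lemma Re_hermitian: "Re (hermitian x y) = x \<bullet> y"
  by (simp add: hermitian_def inner_vec_def inner_complex_def)

text \<open>Multiplying \<open>x\<close> by the conjugate of the Hermitian product makes that
  product real, so the real Cauchy-Schwarz inequality applies.\<close>

lemma cmod_hermitian_le: "cmod (hermitian x y) \<le> norm x * norm y"
proof (cases "hermitian x y = 0")
  case False
  let ?h = "hermitian x y"
  have "(cmod ?h)\<^sup>2 = Re (hermitian (cnj ?h *s x) y)"
    by (simp add: hermitian_simps complex_norm_square[symmetric] mult.commute[of "cnj _"] flip: of_real_power)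
  also have "\<dots> \<le> norm (cnj ?h *s x) * norm y"
    unfolding Re_hermitian by (rule norm_cauchy_schwarz)
  also have "\<dots> = cmod ?h * (norm x * norm y)" by (simp add: norm_cmult)
  finally show ?thesis using False by (simp add: power2_eq_square)
qed auto

lemma norm_sq_eq_Re_hermitian: "(norm x)\<^sup>2 = Re (hermitian x x)"
  by (simp add: hermitian_self)

lemma continuous_on_hermitian [continuous_intros]:
  "continuous_on S f \<Longrightarrow> continuous_on S g \<Longrightarrow> continuous_on S (\<lambda>x. hermitian (f x) (g x))"
  unfolding hermitian_def by (intro continuous_intros)

lemma cmod_one_minus_hermitian_ge: "cmod (1 - hermitian z w) \<ge> 1 - norm z * norm w"
  using norm_triangle_ineq2[of 1 "hermitian z w"] cmod_hermitian_le[of z w] by simp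

lemma one_minus_hermitian_bounds:
  assumes "norm z < 1" "norm a < 1"
  shows "1 - norm z \<le> cmod (1 - hermitian z a)" "1 - norm a \<le> cmod (1 - hermitian z a)"
    "0 < cmod (1 - hermitian z a)" "cmod (1 - hermitian z a) < 2"
proof -
  have 1: "norm z * norm a \<le> norm z" "norm z * norm a \<le> norm a"
    using assms by (auto simp: mult_left_le mult_left_le_one_le)
  show "1 - norm z \<le> cmod (1 - hermitian z a)" "1 - norm a \<le> cmod (1 - hermitian z a)"
    using 1 cmod_one_minus_hermitian_ge[of z a] by linarith+
  thus "0 < cmod (1 - hermitian z a)" using assms by linarith
  show "cmod (1 - hermitian z a) < 2"
    using norm_triangle_ineq4[of 1 "hermitian z a"] cmod_hermitian_le[of z a] 1 assms by simp
qed

lemma one_minus_sq_bounds: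
  fixes x :: real assumes "0 \<le> x" "x < 1"
  shows "1 - x \<le> 1 - x\<^sup>2" "1 - x\<^sup>2 \<le> 2 * (1 - x)" "0 < 1 - x\<^sup>2" "1 - x\<^sup>2 \<le> 1"
proof -
  have *: "1 - x\<^sup>2 = (1 - x) * (1 + x)" by (simp add: power2_eq_square algebra_simps)
  have "(1 - x) * 1 \<le> (1 - x) * (1 + x)" by (rule mult_left_mono) (use assms in auto)
  moreover have "(1 - x) * (1 + x) \<le> (1 - x) * 2" by (rule mult_left_mono) (use assms in auto)
  ultimately show "1 - x \<le> 1 - x\<^sup>2" "1 - x\<^sup>2 \<le> 2 * (1 - x)" unfolding * by auto
  thus "0 < 1 - x\<^sup>2" "1 - x\<^sup>2 \<le> 1" using assms by auto
qed

section \<open>The involutions of the ball\<close>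

lemma ball_involution_eq:
  assumes "a \<noteq> 0"
  shows "ball_involution a w = (1 / (1 - hermitian w a)) *s
     ((1 - (1 - of_real (sqrt (1 - (norm a)\<^sup>2))) * (hermitian w a / of_real ((norm a)\<^sup>2))) *s a
       - of_real (sqrt (1 - (norm a)\<^sup>2)) *s w)"
  unfolding ball_involution_def ball_proj_def hermitian_self scaleR_eq_cmult
  by (simp add: vec_eq_iff algebra_simps)

text \<open>Up to a scalar, the image is a combination of \<open>a\<close> and \<open>w\<close>,
  whose squared norm is a polynomial in the real and imaginary part of the projection coefficient.
  The terms linear in s cancel, and s^2 = 1 - |a|^2 does the rest.\<close>

lemma norm_ball_involution:
  assumes a: "norm a < 1" and w: "norm w < 1"
  shows "1 - (norm (ball_involution a w))\<^sup>2 =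
    (1 - (norm a)\<^sup>2) * (1 - (norm w)\<^sup>2) / (cmod (1 - hermitian w a))\<^sup>2"
proof (cases "a = 0")
  case True
  have "ball_involution 0 w = - w" by (simp add: ball_involution_def ball_proj_def vec_eq_iff)
  thus ?thesis using True by simp
next
  case False
  define A where "A = (norm a)\<^sup>2"
  \<comment> \<open>The projection of \<open>w\<close> onto the line through \<open>a\<close> is
    \<open>l *s a\<close>.\<close>
  define l where "l = hermitian w a / of_real A"
  define s where "s = sqrt (1 - A)"
  have A: "A \<noteq> 0" "A < 1" using False a by (auto simp: A_def power_less_one_iff)
  have s2: "s\<^sup>2 = 1 - A" using A by (simp add: s_def)
  have h: "hermitian w a = of_real A * l" using A by (simp add: l_def)
  have h': "hermitian a w = of_real A * cnj l" by (simp add: cnj_hermitian[of w a, symmetric] h)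
  define v where "v = (1 - (1 - of_real s) * l) *s a - of_real s *s w"
  have "(norm v)\<^sup>2 = (cmod (1 - of_real A * l))\<^sup>2 - (1 - A) * (1 - (norm w)\<^sup>2)"
  proof -
    obtain x y where l: "l = Complex x y" by (cases l)
    have s4: "s * s = 1 - A" using s2 by (simp add: power2_eq_square)
    have "(norm v)\<^sup>2 = ((1 - (1 - s) * x)\<^sup>2 + ((1 - s) * y)\<^sup>2) * A + s\<^sup>2 * (norm w)\<^sup>2
       - 2 * s * A * (x - (1 - s) * (x\<^sup>2 + y\<^sup>2))"
      unfolding norm_sq_eq_Re_hermitian[of v]
      unfolding v_def hermitian_simps h h'
      unfolding hermitian_self A_def[symmetric]
      by (simp add: l power2_eq_square algebra_simps)
    also have "\<dots> = A - 2 * A * x + A * (x\<^sup>2 + y\<^sup>2) * (1 - s\<^sup>2) + s\<^sup>2 * (norm w)\<^sup>2"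
      by algebra
    also have "\<dots> = (1 - A * x)\<^sup>2 + (A * y)\<^sup>2 - (1 - A) * (1 - (norm w)\<^sup>2)"
      unfolding s2 by algebra
    also have "(1 - A * x)\<^sup>2 + (A * y)\<^sup>2 = (cmod (1 - of_real A * l))\<^sup>2"
      by (simp add: l cmod_power2)
    finally show ?thesis .
  qed
  moreover have "ball_involution a w = (1 / (1 - hermitian w a)) *s v"
    unfolding ball_involution_eq[OF False] v_def l_def s_def A_def by simp
  moreover have "cmod (1 - hermitian w a) \<noteq> 0" using one_minus_hermitian_bounds[OF w a] by auto
  ultimately show ?thesis
    unfolding A_def[symmetric] 
    by (simp add: norm_cmult norm_divide power_divide h field_simps)
qed

lemma norm_ball_involution_less_1:
  assumes "norm a < 1" "norm w < 1"
  shows "norm (ball_involution a w) < 1"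
proof -
  have "0 < 1 - (norm (ball_involution a w))\<^sup>2"
    unfolding norm_ball_involution[OF assms]
    using one_minus_hermitian_bounds[OF assms(2,1)] one_minus_sq_bounds assms
    by (intro divide_pos_pos mult_pos_pos) auto
  thus ?thesis by (simp add: power_less_one_iff abs_square_less_1)
qed

text \<open>The involution is self-adjoint for 1 - <z, w> up to two factors that involve
  \<open>a\<close>. Taking moduli moves it from one argument to the other, so membership of
  \<open>w\<close> in the ball about \<open>ball_involution a c\<close> can be tested at
  \<open>ball_involution a w\<close>.\<close>

lemma hermitian_ball_involution:
  assumes a: "norm a < 1" and w: "norm w < 1" and c: "norm c < 1"
  shows "(1 - hermitian w (ball_involution a c)) * (1 - hermitian a c) =
         (1 - hermitian (ball_involution a w) c) * (1 - hermitian w a)"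
proof (cases "a = 0")
  case True
  have "ball_involution 0 w = - w" for w :: "complex ^ 'a"
    by (simp add: ball_involution_def ball_proj_def vec_eq_iff)
  thus ?thesis using True by (simp add: hermitian_def sum_negf)
next
  case False
  have nz: "1 - hermitian w a \<noteq> 0" "1 - hermitian a c \<noteq> 0"
    using one_minus_hermitian_bounds[OF w a] one_minus_hermitian_bounds[OF a c] by auto
  have nA: "norm a \<noteq> 0" using False by simp
  show ?thesis
    unfolding ball_involution_eq[OF False] hermitian_simps using nz nA
    by (simp add: cnj_hermitian field_simps)
qed

section \<open>Bergman balls as sublevel sets, and finite covers\<close>

definition ball_const :: "real \<Rightarrow> real" where "ball_const R = 1 - (tanh R)\<^sup>2"

lemma ball_const_bounds: assumes "0 < R" shows "0 < ball_const R" "ball_const R < 1"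
  using assms tanh_real_lt_1[of R] by (auto simp: ball_const_def power_less_one_iff abs_square_less_1)

text \<open>Bergman distance R from the origin is Euclidean distance tanh R, because
  \<open>tanh\<close> inverts the logarithmic expression; \<open>ball_const R\<close> is the
  resulting threshold for 1 - x^2.\<close>

lemma artanh_less_iff:
  fixes x R :: real
  assumes "0 \<le> x" "x < 1" "0 < R"
  shows "1 / 2 * ln ((1 + x) / (1 - x)) < R \<longleftrightarrow> ball_const R < 1 - x\<^sup>2"
proof -
  have t: "0 < tanh R" "tanh R < 1" using assms tanh_real_lt_1 by auto
  have "1 / 2 * ln ((1 + tanh R) / (1 - tanh R)) = R"
    using artanh_tanh_real[of R] by (simp add: artanh_def)
  hence "1 / 2 * ln ((1 + x) / (1 - x)) < R \<longleftrightarrow>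
      ln ((1 + x) / (1 - x)) < ln ((1 + tanh R) / (1 - tanh R))" by linarith
  also have "\<dots> \<longleftrightarrow> (1 + x) / (1 - x) < (1 + tanh R) / (1 - tanh R)"
    using t assms by (subst ln_less_cancel_iff) (auto intro!: divide_pos_pos add_pos_pos)
  also have "\<dots> \<longleftrightarrow> x < tanh R" using t assms by (simp add: divide_simps) (simp add: algebra_simps)
  also have "\<dots> \<longleftrightarrow> x\<^sup>2 < (tanh R)\<^sup>2"
    using assms by (auto intro!: power_strict_mono dest: power2_less_imp_less)
  finally show ?thesis by (simp add: ball_const_def)
qed

text \<open>Together with the norm formula for the involution, the threshold becomes a polynomial
  inequality, from which openness and all size comparisons follow.\<close>

lemma bergman_ball_eq:
  assumes a: "norm a < 1" and R: "0 < R"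
  shows "bergman_ball a R = {w \<in> unit_ball.
    ball_const R * (cmod (1 - hermitian w a))\<^sup>2 < (1 - (norm a)\<^sup>2) * (1 - (norm w)\<^sup>2)}"
proof -
  have "bergman_metric a w < R \<longleftrightarrow>
      ball_const R * (cmod (1 - hermitian w a))\<^sup>2 < (1 - (norm a)\<^sup>2) * (1 - (norm w)\<^sup>2)"
    if w: "norm w < 1" for w
    unfolding bergman_metric_def artanh_less_iff[OF norm_ge_zero norm_ball_involution_less_1[OF a w] R]
      norm_ball_involution[OF a w]
    using one_minus_hermitian_bounds[OF w a] by (simp add: less_divide_eq)
  thus ?thesis unfolding bergman_ball_def by auto
qed

lemma open_bergman_ball:
  assumes a: "norm a < 1" and R: "0 < R"
  shows "open (bergman_ball a R)"
  unfolding bergman_ball_eq[OF assms]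
proof -
  have "{w \<in> unit_ball. ball_const R * (cmod (1 - hermitian w a))\<^sup>2 < (1 - (norm a)\<^sup>2) * (1 - (norm w)\<^sup>2)} =
    unit_ball \<inter> {w. ball_const R * (cmod (1 - hermitian w a))\<^sup>2 < (1 - (norm a)\<^sup>2) * (1 - (norm w)\<^sup>2)}"
    by auto
  also have "open \<dots>" by (intro open_Int open_ball open_Collect_less continuous_intros)
  finally show "open {w \<in> unit_ball. ball_const R * (cmod (1 - hermitian w a))\<^sup>2 < (1 - (norm a)\<^sup>2) * (1 - (norm w)\<^sup>2)}" .
qed

lemma centre_in_bergman_ball:
  assumes a: "norm a < 1" and R: "0 < R"
  shows "a \<in> bergman_ball a R"
proof -
  have p: "0 < 1 - (norm a)\<^sup>2" using one_minus_sq_bounds[of "norm a"] a by auto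
  have e: "1 - hermitian a a = of_real (1 - (norm a)\<^sup>2)" by (simp add: hermitian_self)
  have "cmod (1 - hermitian a a) = 1 - (norm a)\<^sup>2" unfolding e norm_of_real using p by simp
  thus ?thesis unfolding bergman_ball_eq[OF assms]
    using a p ball_const_bounds[OF R] by (simp add: power2_eq_square)
qed

text \<open>Both defects 1 - |z|^2 and 1 - |a|^2 are at most twice m = |1 - <z, a>|, while
  membership in the ball bounds a multiple of m^2 by their product. Replacing one defect by 2 m and
  cancelling m bounds m by the other defect.\<close>

lemma bergman_ball_comparison:
  assumes a: "norm a < 1" and R: "0 < R" and z: "z \<in> bergman_ball a R"
  shows "cmod (1 - hermitian z a) \<le> 2 / ball_const R * (1 - (norm a)\<^sup>2)"
    "1 - (norm z)\<^sup>2 \<le> 4 / ball_const R * (1 - (norm a)\<^sup>2)"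
    "1 - (norm a)\<^sup>2 \<le> 4 / ball_const R * (1 - (norm z)\<^sup>2)"
proof -
  let ?d = "ball_const R" and ?h = "cmod (1 - hermitian z a)"
  have d: "0 < ?d" using ball_const_bounds[OF R] by simp
  have z1: "norm z < 1" and m: "?d * ?h\<^sup>2 < (1 - (norm a)\<^sup>2) * (1 - (norm z)\<^sup>2)"
    using z unfolding bergman_ball_eq[OF a R] by auto
  note b = one_minus_hermitian_bounds[OF z1 a]
  note sa = one_minus_sq_bounds[of "norm a"] and sz = one_minus_sq_bounds[of "norm z"]
  have hz: "1 - (norm z)\<^sup>2 \<le> 2 * ?h" and ha: "1 - (norm a)\<^sup>2 \<le> 2 * ?h"
    using b sa sz a z1 by auto
  have "?d * ?h\<^sup>2 \<le> (1 - (norm a)\<^sup>2) * (2 * ?h)"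
    using m mult_left_mono[OF hz, of "1 - (norm a)\<^sup>2"] sa(3) a by (intro order.trans[OF less_imp_le[OF m]]) auto
  hence 1: "?d * ?h \<le> 2 * (1 - (norm a)\<^sup>2)" using b(3) by (simp add: power2_eq_square)
  have "?d * ?h\<^sup>2 \<le> (1 - (norm z)\<^sup>2) * (2 * ?h)"
    using m mult_left_mono[OF ha, of "1 - (norm z)\<^sup>2"] sz(3) z1
    by (intro order.trans[OF less_imp_le[OF m]]) (auto simp: mult.commute)
  hence 2: "?d * ?h \<le> 2 * (1 - (norm z)\<^sup>2)" using b(3) by (simp add: power2_eq_square)
  show "?h \<le> 2 / ?d * (1 - (norm a)\<^sup>2)" using 1 d by (simp add: field_simps)
  have "?d * (1 - (norm z)\<^sup>2) \<le> ?d * (2 * ?h)" using hz d by (intro mult_left_mono) auto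
  thus "1 - (norm z)\<^sup>2 \<le> 4 / ?d * (1 - (norm a)\<^sup>2)" using 1 d by (simp add: field_simps)
  have "?d * (1 - (norm a)\<^sup>2) \<le> ?d * (2 * ?h)" using ha d by (intro mult_left_mono) auto
  thus "1 - (norm a)\<^sup>2 \<le> 4 / ?d * (1 - (norm z)\<^sup>2)" using 2 d by (simp add: field_simps)
qed

text \<open>Compactness of the closed Euclidean ball of radius tanh r yields finitely many centres
  near the origin. They are fixed before \<open>a\<close> is chosen and then moved by the
  involution, so their number is uniform in \<open>a\<close>.\<close>

lemma finite_bergman_cover:
  fixes R r :: real
  assumes R: "0 < R" and r: "0 < r"
  obtains C :: "(complex ^ 'n) set" where "finite C" "C \<subseteq> unit_ball"
    "\<And>a. norm a < 1 \<Longrightarrow> bergman_ball a r \<subseteq> (\<Union>c\<in>C. bergman_ball (ball_involution a c) R)"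
proof -
  define \<rho> where "\<rho> = tanh r"
  have \<rho>: "\<rho> < 1" "0 < \<rho>" using r by (auto simp: \<rho>_def tanh_real_lt_1)
  have "compact (cball (0 :: complex ^ 'n) \<rho>)" by simp
  moreover have "open (bergman_ball c R)" if "c \<in> cball 0 \<rho>" for c :: "complex ^ 'n"
    using that \<rho> by (intro open_bergman_ball R) auto
  moreover have "cball (0 :: complex ^ 'n) \<rho> \<subseteq> (\<Union>c\<in>cball 0 \<rho>. bergman_ball c R)"
  proof
    fix c :: "complex ^ 'n" assume "c \<in> cball 0 \<rho>"
    thus "c \<in> (\<Union>c\<in>cball 0 \<rho>. bergman_ball c R)"
      using centre_in_bergman_ball[OF _ R, of c] \<rho> by (intro UN_I[of c]) auto
  qed
  ultimately obtain C where C: "C \<subseteq> cball (0 :: complex ^ 'n) \<rho>" "finite C"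
     "cball 0 \<rho> \<subseteq> (\<Union>c\<in>C. bergman_ball c R)"
    by (rule compactE_image)
  show thesis
  proof (rule that)
    show "finite C" by fact
    show CB: "C \<subseteq> unit_ball" using C(1) \<rho> by force
    fix a :: "complex ^ 'n" assume a: "norm a < 1"
    show "bergman_ball a r \<subseteq> (\<Union>c\<in>C. bergman_ball (ball_involution a c) R)"
    proof
      fix w assume wa: "w \<in> bergman_ball a r"
      hence w: "norm w < 1" by (simp add: bergman_ball_def)
      let ?w = "ball_involution a w"
      have w'1: "norm ?w < 1" by (rule norm_ball_involution_less_1[OF a w])
      have "ball_const r < 1 - (norm ?w)\<^sup>2"
        using wa artanh_less_iff[OF norm_ge_zero w'1 r] unfolding bergman_ball_def bergman_metric_def by auto
      hence "(norm ?w)\<^sup>2 \<le> \<rho>\<^sup>2" by (simp add: ball_const_def \<rho>_def)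
      hence "norm ?w \<le> \<rho>" using \<rho> by (simp add: power_mono_iff)
      then obtain c where c: "c \<in> C" "?w \<in> bergman_ball c R" using C(3) by auto
      have c1: "norm c < 1" using c(1) CB by auto
      let ?b = "ball_involution a c"
      have b1: "norm ?b < 1" by (rule norm_ball_involution_less_1[OF a c1])
      have ca: "0 < cmod (1 - hermitian c a)" and wa: "0 < cmod (1 - hermitian w a)"
        using one_minus_hermitian_bounds[OF c1 a] one_minus_hermitian_bounds[OF w a] by auto
      have ac: "cmod (1 - hermitian a c) = cmod (1 - hermitian c a)"
        by (metis cnj_hermitian complex_cnj_diff complex_cnj_one complex_mod_cnj)
      have key: "cmod (1 - hermitian w ?b) * cmod (1 - hermitian c a) =
          cmod (1 - hermitian ?w c) * cmod (1 - hermitian w a)"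
        using arg_cong[OF hermitian_ball_involution[OF a w c1], of cmod] by (simp add: norm_mult ac)
      have in_c: "ball_const R * (cmod (1 - hermitian ?w c))\<^sup>2 < (1 - (norm c)\<^sup>2) * (1 - (norm ?w)\<^sup>2)"
        using c(2) unfolding bergman_ball_eq[OF c1 R] by simp
      \<comment> \<open>Multiplying by |1 - <c, a>|^2 brings in the transfer identity; the norm
        formula at \<open>w\<close> and at \<open>c\<close> then supplies the defects.\<close>
      have "ball_const R * (cmod (1 - hermitian w ?b))\<^sup>2 * (cmod (1 - hermitian c a))\<^sup>2 =
          ball_const R * (cmod (1 - hermitian ?w c))\<^sup>2 * (cmod (1 - hermitian w a))\<^sup>2"
        using arg_cong[OF key, of "\<lambda>x. x\<^sup>2"] by (simp add: power_mult_distrib)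
      also have "\<dots> < (1 - (norm c)\<^sup>2) * (1 - (norm ?w)\<^sup>2) * (cmod (1 - hermitian w a))\<^sup>2"
        using in_c wa by (intro mult_strict_right_mono) auto
      also have "\<dots> = (1 - (norm ?b)\<^sup>2) * (1 - (norm w)\<^sup>2) * (cmod (1 - hermitian c a))\<^sup>2"
        unfolding norm_ball_involution[OF a w] norm_ball_involution[OF a c1] using wa ca by simp
      finally have "ball_const R * (cmod (1 - hermitian w ?b))\<^sup>2 < (1 - (norm ?b)\<^sup>2) * (1 - (norm w)\<^sup>2)"
        using ca by simp
      hence "w \<in> bergman_ball ?b R" unfolding bergman_ball_eq[OF b1 R] using w by simp
      thus "w \<in> (\<Union>c\<in>C. bergman_ball (ball_involution a c) R)" using c(1) by blast
    qed
  qed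
qed

section \<open>Linear changes of variables\<close>

lemma nn_integral_lborel_shift:
  fixes f :: "'a::euclidean_space \<Rightarrow> ennreal"
  assumes [measurable]: "f \<in> borel_measurable borel"
  shows "(\<integral>\<^sup>+x. f (c + x) \<partial>lborel) = (\<integral>\<^sup>+x. f x \<partial>lborel)"
proof -
  have "(\<integral>\<^sup>+x. f x \<partial>lborel) = (\<integral>\<^sup>+x. f x \<partial>distr lborel borel ((+) c))"
    by (simp add: lborel_distr_plus)
  also have "\<dots> = (\<integral>\<^sup>+x. f (c + x) \<partial>lborel)" by (subst nn_integral_distr) auto
  finally show ?thesis ..
qed

text \<open>A translation-invariant measure is a multiple of Lebesgue measure, by Fubini applied to
  \<open>1\<^sub>B(x) f(x + U y)\<close>; the unit ball \<open>B\<close> fixes the constant.\<close>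

lemma nn_integral_lborel_isometry:
  fixes U :: "'a::euclidean_space \<Rightarrow> 'a" and f :: "'a \<Rightarrow> ennreal"
  assumes U: "linear U" and iso: "\<And>x. norm (U x) = norm x" and f [measurable]: "f \<in> borel_measurable borel"
  shows "(\<integral>\<^sup>+x. f (U x) \<partial>lborel) = (\<integral>\<^sup>+x. f x \<partial>lborel)"
proof -
  have Um [measurable]: "U \<in> borel_measurable borel"
    using U by (simp add: borel_measurable_continuous_onI linear_continuous_on linear_linear)
  have refl: "(\<integral>\<^sup>+x. g (- x) \<partial>lborel) = (\<integral>\<^sup>+x. g x \<partial>lborel)"
    if [measurable]: "g \<in> borel_measurable borel" for g :: "'a \<Rightarrow> ennreal"
  proof -
    have "(\<integral>\<^sup>+x. g x \<partial>lborel) = (\<integral>\<^sup>+x. g x \<partial>distr lborel borel (\<lambda>x. - x))"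
      by (subst lborel_affine[of "-1" 0]) (auto simp: density_1 one_ennreal_def[symmetric])
    also have "\<dots> = (\<integral>\<^sup>+x. g (- x) \<partial>lborel)" by (subst nn_integral_distr) auto
    finally show ?thesis ..
  qed

  let ?B = "indicator (ball 0 1) :: 'a \<Rightarrow> ennreal"
  have [measurable]: "?B \<in> borel_measurable borel" by (rule borel_measurable_indicator) simp
  have UB: "?B (U y) = ?B y" for y using iso by (simp add: indicator_def)
  have symB: "?B (- y) = ?B y" for y by (simp add: indicator_def)
  have finite: "(\<integral>\<^sup>+x. ?B x \<partial>lborel) \<noteq> top" "(\<integral>\<^sup>+x. ?B x \<partial>lborel) \<noteq> 0"
    using emeasure_lborel_ball_finite[of 0 1] content_ball_pos[of 1 "0::'a"] by (auto simp: measure_def)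
  have "(\<integral>\<^sup>+x. ?B x \<partial>lborel) * (\<integral>\<^sup>+y. f (U y) \<partial>lborel) =
      (\<integral>\<^sup>+x. (\<integral>\<^sup>+y. ?B x * f (U y) \<partial>lborel) \<partial>lborel)"
    by (subst nn_integral_multc[symmetric]) (simp_all add: nn_integral_cmult)
  also have "\<dots> = (\<integral>\<^sup>+x. (\<integral>\<^sup>+y. ?B x * f (x + U y) \<partial>lborel) \<partial>lborel)"
  proof (rule nn_integral_cong)
    fix x :: 'a
    have "surj U" using U iso by (metis linear_injective_imp_surjective linear_injective_0 norm_eq_zero)
    then obtain x' where x': "U x' = x" by (metis surj_def)
    have "(\<integral>\<^sup>+y. ?B x * f (U (x' + y)) \<partial>lborel) = (\<integral>\<^sup>+y. ?B x * f (U y) \<partial>lborel)"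
      by (rule nn_integral_lborel_shift) simp
    thus "(\<integral>\<^sup>+y. ?B x * f (U y) \<partial>lborel) = (\<integral>\<^sup>+y. ?B x * f (x + U y) \<partial>lborel)"
      by (simp add: linear_add[OF U] x')
  qed
  also have "\<dots> = (\<integral>\<^sup>+y. (\<integral>\<^sup>+x. ?B x * f (x + U y) \<partial>lborel) \<partial>lborel)"
    by (rule lborel_pair.Fubini'[symmetric]) simp
  also have "\<dots> = (\<integral>\<^sup>+y. (\<integral>\<^sup>+x. ?B (x - U y) * f x \<partial>lborel) \<partial>lborel)"
  proof (rule nn_integral_cong)
    fix y :: 'a
    show "(\<integral>\<^sup>+x. ?B x * f (x + U y) \<partial>lborel) = (\<integral>\<^sup>+x. ?B (x - U y) * f x \<partial>lborel)"
      using nn_integral_lborel_shift[of "\<lambda>x. ?B (x - U y) * f x" "U y"] by (simp add: add.commute)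
  qed
  also have "\<dots> = (\<integral>\<^sup>+x. (\<integral>\<^sup>+y. ?B (x - U y) * f x \<partial>lborel) \<partial>lborel)"
    by (rule lborel_pair.Fubini') simp
  also have "\<dots> = (\<integral>\<^sup>+x. (\<integral>\<^sup>+y. ?B y \<partial>lborel) * f x \<partial>lborel)"
  proof (rule nn_integral_cong)
    fix x :: 'a
    have "surj U" using U iso by (metis linear_injective_imp_surjective linear_injective_0 norm_eq_zero)
    then obtain x' where x': "U x' = x" by (metis surj_def)
    have "(\<integral>\<^sup>+y. ?B (x - U y) * f x \<partial>lborel) = (\<integral>\<^sup>+y. ?B (U (x' - y)) * f x \<partial>lborel)"
      by (simp add: linear_diff[OF U] x')
    also have "\<dots> = (\<integral>\<^sup>+y. ?B (x' - y) * f x \<partial>lborel)" by (simp only: UB)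
    also have "\<dots> = (\<integral>\<^sup>+y. ?B (x' + y) * f x \<partial>lborel)"
      using refl[of "\<lambda>y. ?B (x' + y) * f x"] by simp
    also have "\<dots> = (\<integral>\<^sup>+y. ?B y * f x \<partial>lborel)" by (rule nn_integral_lborel_shift) simp
    finally show "(\<integral>\<^sup>+y. ?B (x - U y) * f x \<partial>lborel) = (\<integral>\<^sup>+y. ?B y \<partial>lborel) * f x"
      by (simp add: nn_integral_multc)
  qed
  also have "\<dots> = (\<integral>\<^sup>+x. ?B x \<partial>lborel) * (\<integral>\<^sup>+x. f x \<partial>lborel)" by (simp add: nn_integral_cmult)
  finally show ?thesis using finite by (simp add: ennreal_mult_cancel_left)
qed

lemma nn_integral_lborel_scale:
  fixes f :: "'a::euclidean_space \<Rightarrow> ennreal"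
  assumes [measurable]: "f \<in> borel_measurable borel" and c: "c \<noteq> 0"
  shows "(\<integral>\<^sup>+x. f x \<partial>lborel) = ennreal (\<bar>c\<bar> ^ DIM('a)) * (\<integral>\<^sup>+x. f (c *\<^sub>R x) \<partial>lborel)"
  by (subst lborel_affine[OF c, of 0]) (simp add: nn_integral_density nn_integral_distr nn_integral_cmult)

text \<open>For unit \<open>u\<close>, the dilation by \<alpha> on the complex line of
  \<open>u\<close> and by \<beta> on its orthogonal complement; this form avoids the choice of a
  basis.\<close>

definition nonisotropic :: "complex ^ 'n \<Rightarrow> real \<Rightarrow> real \<Rightarrow> complex ^ 'n \<Rightarrow> complex ^ 'n" where
  "nonisotropic u \<alpha> \<beta> x = \<beta> *\<^sub>R x + (of_real (\<alpha> - \<beta>) * hermitian x u) *s u"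

lemma nonisotropic_axis:
  "nonisotropic (axis j 1) \<alpha> \<beta> x = (\<chi> i. (if i = j then \<alpha> else \<beta>) *\<^sub>R (x $ i))"
proof -
  have "hermitian x (axis j 1) = x $ j"
    by (simp add: hermitian_def axis_def if_distrib[of cnj] if_distrib[of "(*) _"] cong: if_cong)
  thus ?thesis
    by (auto simp: nonisotropic_def vec_eq_iff axis_def scaleR_eq_cmult algebra_simps)
       (auto simp: scaleR_conv_of_real)
qed

text \<open>In the real basis the map is diagonal, and every complex coordinate owns two real axes,
  which squares each factor of the determinant.\<close>

lemma nn_integral_nonisotropic_axis:
  fixes f :: "complex ^ 'n \<Rightarrow> ennreal"
  assumes [measurable]: "f \<in> borel_measurable borel" and "0 < \<alpha>" "0 < \<beta>"
  shows "(\<integral>\<^sup>+x. f x \<partial>lborel) = ennreal (\<alpha>\<^sup>2 * (\<beta>\<^sup>2) ^ (CARD('n) - 1)) *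
     (\<integral>\<^sup>+x. f (nonisotropic (axis j 1) \<alpha> \<beta> x) \<partial>lborel)"
proof -
  \<comment> \<open>A basis vector has a single nonzero entry, so \<open>b $ j = 0\<close>
    recognises the vectors that belong to coordinates other than \<open>j\<close>.\<close>
  define c :: "complex ^ 'n \<Rightarrow> real" where "c b = (if b $ j = 0 then \<beta> else \<alpha>)" for b
  let ?c = "\<lambda>i. if i = j then \<alpha> else \<beta>"
  have Basis: "(Basis :: (complex ^ 'n) set) = (\<Union>i. {axis i 1, axis i \<i>})"
    by (auto simp: Basis_vec_def Basis_complex_def)
  have T: "(\<Sum>b\<in>Basis. (c b * (x \<bullet> b)) *\<^sub>R b) = nonisotropic (axis j 1) \<alpha> \<beta> x" for x :: "complex ^ 'n"
  proof -
    have "(\<Sum>b\<in>Basis. (c b * (x \<bullet> b)) *\<^sub>R b) =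
        (\<Sum>i\<in>UNIV. \<Sum>b\<in>{axis i 1, axis i \<i>}. (c b * (x \<bullet> b)) *\<^sub>R b)"
      unfolding Basis by (rule sum.UNION_disjoint) (auto simp: axis_eq_axis)
    also have "\<dots> = (\<Sum>i\<in>UNIV. axis i (?c i *\<^sub>R x $ i))"
    proof (rule sum.cong)
      fix i
      have "(\<Sum>b\<in>{axis i 1, axis i \<i>}. (c b * (x \<bullet> b)) *\<^sub>R b) =
        (c (axis i 1) * Re (x $ i)) *\<^sub>R axis i 1 + (c (axis i \<i>) * Im (x $ i)) *\<^sub>R axis i \<i>"
        by (simp add: axis_eq_axis inner_axis inner_complex_def)
      also have "\<dots> = axis i (?c i *\<^sub>R x $ i)"
        by (auto simp: vec_eq_iff axis_def c_def complex_eq_iff)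
      finally show "(\<Sum>b\<in>{axis i 1, axis i \<i>}. (c b * (x \<bullet> b)) *\<^sub>R b) = axis i (?c i *\<^sub>R x $ i)" .
    qed simp
    also have "\<dots> = (\<chi> i. ?c i *\<^sub>R (x $ i))"
      by (simp add: vec_eq_iff axis_def if_distrib[of "\<lambda>f. f _"] cong: if_cong)
    finally show ?thesis by (simp add: nonisotropic_axis)
  qed
  have prod: "(\<Prod>b\<in>Basis. \<bar>c b\<bar>) = \<alpha>\<^sup>2 * (\<beta>\<^sup>2) ^ (CARD('n) - 1)"
  proof -
    have "(\<Prod>b\<in>Basis. \<bar>c b\<bar>) = (\<Prod>i\<in>UNIV. \<Prod>b\<in>{axis i 1, axis i \<i>}. \<bar>c b\<bar>)"
      unfolding Basis by (rule prod.UNION_disjoint) (auto simp: axis_eq_axis)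
    also have "\<dots> = (\<Prod>i\<in>UNIV. (?c i)\<^sup>2)"
    proof (rule prod.cong)
      fix i
      have "axis i (1 :: complex) \<noteq> axis i \<i>" "c (axis i 1) = ?c i" "c (axis i \<i>) = ?c i"
        by (simp_all add: axis_eq_axis) (simp_all add: c_def axis_def)
      thus "(\<Prod>b\<in>{axis i 1, axis i \<i>}. \<bar>c b\<bar>) = (?c i)\<^sup>2" by (simp add: power2_eq_square)
    qed simp
    also have "\<dots> = \<alpha>\<^sup>2 * (\<Prod>i\<in>UNIV - {j}. (?c i)\<^sup>2)"
      by (subst prod.remove[of _ j]) auto
    also have "(\<Prod>i\<in>UNIV - {j}. (?c i)\<^sup>2) = (\<Prod>i\<in>UNIV - {j}. \<beta>\<^sup>2)" by (rule prod.cong) auto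
    also have "\<dots> = (\<beta>\<^sup>2) ^ (CARD('n) - 1)" by (simp add: card_Diff_singleton)
    finally show ?thesis .
  qed
  have "c b \<noteq> 0" for b using assms by (simp add: c_def)
  hence "(lborel :: (complex ^ 'n) measure) = density (distr lborel borel (nonisotropic (axis j 1) \<alpha> \<beta>))
     (\<lambda>_. (\<Prod>b\<in>Basis. \<bar>c b\<bar>))"
    using lborel_affine_euclidean[of c 0] by (simp add: T)
  note * = this[unfolded prod]
  have [measurable]: "nonisotropic (axis j 1 :: complex ^ 'n) \<alpha> \<beta> \<in> borel_measurable borel"
    unfolding nonisotropic_axis by (intro borel_measurable_continuous_onI continuous_intros)
  show ?thesis
    by (subst *) (simp add: nn_integral_density nn_integral_distr nn_integral_cmult)
qed

text \<open>The complex Householder reflection; for \<open>v = 0\<close> division by zero turns it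
  into the identity.\<close>

definition reflection :: "complex ^ 'n \<Rightarrow> complex ^ 'n \<Rightarrow> complex ^ 'n" where
  "reflection v x = x - (2 * hermitian x v / hermitian v v) *s v"

lemma hermitian_reflection: "hermitian (reflection v x) (reflection v y) = hermitian x y"
proof (cases "v = 0")
  case False
  hence "hermitian v v \<noteq> 0" by (simp add: hermitian_self)
  thus ?thesis unfolding reflection_def hermitian_simps
    by (simp add: cnj_hermitian field_simps)
qed (simp add: reflection_def)

lemma norm_reflection: "norm (reflection v x) = norm x"
proof -
  have "(norm (reflection v x))\<^sup>2 = (norm x)\<^sup>2"
    by (simp add: norm_sq_eq_Re_hermitian hermitian_reflection)
  thus ?thesis by (simp add: power2_eq_iff_nonneg)
qed

lemma linear_reflection: "linear (reflection v)"
  by (rule linearI) (simp_all add: reflection_def hermitian_simps vec_eq_iff scaleR_eq_cmult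
    add_divide_distrib algebra_simps)

text \<open>The reflection along e - w carries the unit vector e to the unit vector w as soon as <e,
  w> is real; the phase \<open>c\<close> arranges this for w = c u.\<close>

lemma reflection_to_axis:
  fixes u :: "complex ^ 'n"
  assumes u: "norm u = 1"
  obtains v c where "cmod c = 1" "reflection v (axis j 1) = c *s u"
proof -
  let ?e = "axis j 1 :: complex ^ 'n"
  have e: "norm ?e = 1" by simp
  obtain c where c: "cmod c = 1" "hermitian ?e (c *s u) = of_real (cmod (hermitian ?e u))"
  proof (cases "hermitian ?e u = 0")
    case True
    thus ?thesis using that[of 1] by simp
  next
    case False
    let ?h = "hermitian ?e u"
    have "hermitian ?e (sgn ?h *s u) = of_real (cmod ?h)"
      using False by (simp add: hermitian_simps sgn_eq complex_norm_square[symmetric] power2_eq_square)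
       (simp add: mult.commute[of "cnj _"] complex_norm_square[symmetric] power2_eq_square)
    thus ?thesis using that[of "sgn ?h"] False by (simp add: norm_sgn)
  qed
  define r where "r = cmod (hermitian ?e u)"
  define w where "w = c *s u"
  have w: "hermitian ?e w = of_real r" "hermitian w ?e = of_real r" "hermitian w w = 1" "hermitian ?e ?e = 1"
    using c u e cnj_hermitian[of ?e w] by (auto simp: w_def r_def hermitian_self norm_cmult)
  have 1: "hermitian ?e (?e - w) = 1 - of_real r"
    unfolding hermitian_simps w by simp
  have 2: "hermitian (?e - w) (?e - w) = 2 * (1 - of_real r)"
    unfolding hermitian_simps w by simp
  have "reflection (?e - w) ?e = w"
  proof (cases "?e - w = 0")
    case False
    hence "hermitian (?e - w) (?e - w) \<noteq> 0" by (simp add: hermitian_self)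
    thus ?thesis unfolding reflection_def 1 unfolding 2 by (simp add: vec_eq_iff)
  qed (simp add: reflection_def)
  thus thesis using c that unfolding w_def by blast
qed

text \<open>The axis case is conjugated by a reflection that carries the axis to a multiple of
  \<open>u\<close>. The phase of that multiple disappears because \<open>u\<close> enters
  \<open>nonisotropic\<close> once linearly and once conjugate-linearly.\<close>

lemma nn_integral_nonisotropic:
  fixes f :: "complex ^ 'n \<Rightarrow> ennreal"
  assumes f [measurable]: "f \<in> borel_measurable borel" and "0 < \<alpha>" "0 < \<beta>" and u: "norm u = 1"
  shows "(\<integral>\<^sup>+x. f x \<partial>lborel) = ennreal (\<alpha>\<^sup>2 * (\<beta>\<^sup>2) ^ (CARD('n) - 1)) *
     (\<integral>\<^sup>+x. f (nonisotropic u \<alpha> \<beta> x) \<partial>lborel)"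
proof -
  let ?j = "undefined :: 'n"
  obtain v c where vc: "cmod c = 1" "reflection v (axis ?j 1) = c *s u"
    using reflection_to_axis[OF u] by blast
  let ?U = "reflection v" and ?T = "nonisotropic (axis ?j 1) \<alpha> \<beta>"
  have cc: "c * cnj c = 1" using vc(1) by (simp add: complex_norm_square[symmetric])
  have U[measurable]: "?U \<in> borel_measurable borel"
    by (simp add: borel_measurable_continuous_onI linear_continuous_on linear_linear linear_reflection)
  have conj: "?U (?T x) = nonisotropic u \<alpha> \<beta> (?U x)" for x
  proof -
    have sm: "?U (d *s y) = d *s ?U y" for d y
      by (simp add: reflection_def hermitian_simps vec_eq_iff algebra_simps)
    have "?U (?T x) = \<beta> *\<^sub>R ?U x + (of_real (\<alpha> - \<beta>) * hermitian x (axis ?j 1)) *s (c *s u)"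
      unfolding nonisotropic_def
      by (simp add: linear_add[OF linear_reflection] linear_scale[OF linear_reflection] sm vc)
    also have "hermitian x (axis ?j 1) = cnj c * hermitian (?U x) u"
      using hermitian_reflection[of v x "axis ?j 1"] by (simp add: vc hermitian_simps)
    finally show ?thesis unfolding nonisotropic_def
      using cc by (simp add: vec_eq_iff mult_ac)
  qed
  have nm[measurable]: "nonisotropic u \<alpha> \<beta> \<in> borel_measurable borel" for u :: "complex ^ 'n"
    unfolding nonisotropic_def hermitian_def vector_scalar_mult_def
    by (intro borel_measurable_continuous_onI continuous_intros)
  have "(\<integral>\<^sup>+x. f x \<partial>lborel) = (\<integral>\<^sup>+x. f (?U x) \<partial>lborel)"
    by (rule nn_integral_lborel_isometry[symmetric]) (auto simp: linear_reflection norm_reflection)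
  also have "\<dots> = ennreal (\<alpha>\<^sup>2 * (\<beta>\<^sup>2) ^ (CARD('n) - 1)) * (\<integral>\<^sup>+x. f (?U (?T x)) \<partial>lborel)"
    using assms by (intro nn_integral_nonisotropic_axis) auto
  also have "(\<integral>\<^sup>+x. f (?U (?T x)) \<partial>lborel) = (\<integral>\<^sup>+x. f (nonisotropic u \<alpha> \<beta> (?U x)) \<partial>lborel)"
    by (simp only: conj)
  also have "\<dots> = (\<integral>\<^sup>+x. f (nonisotropic u \<alpha> \<beta> x) \<partial>lborel)"
    by (rule nn_integral_lborel_isometry) (auto simp: linear_reflection norm_reflection)
  finally show ?thesis .
qed

section \<open>Partial derivatives of holomorphic functions\<close>

lemma cmult_eq_sum_axis: "(v :: complex ^ 'n) = (\<Sum>j\<in>UNIV. v $ j *s axis j 1)"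
  by (simp add: vec_eq_iff axis_def if_distrib[of "\<lambda>x. _ * x"] cong: if_cong)

lemma deriv_cmult_sum_axis:
  fixes D :: "complex ^ 'n \<Rightarrow> complex"
  assumes "linear D" "\<And>c v. D (c *s v) = c * D v"
  shows "D v = (\<Sum>j\<in>UNIV. v $ j * D (axis j 1))"
  by (subst cmult_eq_sum_axis) (simp add: linear_sum[OF assms(1)] assms(2))

lemma bounded_linear_cmult_left: "bounded_linear (\<lambda>u. u *s (v :: complex ^ 'n))"
proof (rule bounded_linear_intro[of _ "norm v"])
  fix r :: real and x :: complex
  show "(r *\<^sub>R x) *s v = r *\<^sub>R (x *s v)" by (simp add: vec_eq_iff)
qed (simp_all add: vec_eq_iff algebra_simps norm_cmult)

lemma has_field_derivative_on_line:
  fixes f :: "complex ^ 'n \<Rightarrow> complex"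
  assumes f: "(f has_derivative D) (at (z + u *s v))" and D: "\<And>c v. D (c *s v) = c * D v"
  shows "((\<lambda>u. f (z + u *s v)) has_field_derivative D v) (at u)"
proof -
  have "((\<lambda>u. z + u *s v) has_derivative (\<lambda>h. h *s v)) (at u)"
    using bounded_linear.has_derivative[OF bounded_linear_cmult_left has_derivative_ident, of v "at u"]
    by (auto intro!: derivative_eq_intros)
  from diff_chain_at[OF this f] have "((\<lambda>u. f (z + u *s v)) has_derivative (\<lambda>h. D (h *s v))) (at u)"
    by (simp add: o_def)
  moreover have "(\<lambda>h. D (h *s v)) = (*) (D v)" by (auto simp: D mult.commute)
  ultimately show ?thesis by (simp add: has_field_derivative_def)
qed

lemma partial_deriv_eq:
  fixes f :: "complex ^ 'n \<Rightarrow> complex"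
  assumes f: "(f has_derivative D) (at z)" and D: "\<And>c v. D (c *s v) = c * D v"
  shows "partial_deriv j f z = D (axis j 1)"
proof -
  let ?z = "z - (z $ j) *s axis j 1"
  have "((\<lambda>w. f (?z + w *s axis j 1)) has_field_derivative D (axis j 1)) (at (z $ j))"
    by (rule has_field_derivative_on_line) (use f D in auto)
  also have "(\<lambda>w. f (?z + w *s axis j 1)) = (\<lambda>w. f (\<chi> i. if i = j then w else z $ i))"
    by (auto simp: fun_eq_iff axis_def vec_eq_iff intro!: arg_cong[of _ _ f])
  finally show ?thesis unfolding partial_deriv_def by (rule DERIV_imp_deriv)
qed

lemma holomorphic_on_ball_has_derivative:
  assumes f: "holomorphic_on_ball f" and z: "norm z < 1"
  shows "(f has_derivative (\<lambda>v. \<Sum>j\<in>UNIV. v $ j * partial_deriv j f z)) (at z)"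
proof -
  obtain D where D: "(f has_derivative D) (at z)" "\<And>c v. D (c *s v) = c * D v"
    using f z unfolding holomorphic_on_ball_def by (metis mem_ball_0)
  have "D = (\<lambda>v. \<Sum>j\<in>UNIV. v $ j * partial_deriv j f z)"
    unfolding partial_deriv_eq[OF D]
    by (rule ext, rule deriv_cmult_sum_axis[OF has_derivative_linear[OF D(1)] D(2)])
  thus ?thesis using D(1) by simp
qed

lemma gradient_cmult:
  "(\<Sum>j\<in>UNIV. (c *s v) $ j * g j) = c * (\<Sum>j\<in>UNIV. v $ j * (g j :: complex))"
  by (simp add: sum_distrib_left mult.assoc)

lemma gradient_axis: "(\<Sum>i\<in>UNIV. axis j 1 $ i * (g i :: complex)) = g (j :: 'n::finite)"
  by (simp add: axis_def if_distrib[of "\<lambda>x. x * _"] cong: if_cong)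

lemma holomorphic_on_ball_imp_continuous_on:
  "holomorphic_on_ball f \<Longrightarrow> continuous_on unit_ball f"
  using holomorphic_on_ball_has_derivative[of f]
  by (intro continuous_at_imp_continuous_on ballI) (auto dest: has_derivative_continuous)

lemma holomorphic_on_line:
  fixes f :: "complex ^ 'n \<Rightarrow> complex"
  assumes f: "holomorphic_on_ball f" and S: "\<And>u. u \<in> S \<Longrightarrow> norm (z + u *s v) < 1"
  shows "(\<lambda>u. f (z + u *s v)) holomorphic_on S"
proof (rule holomorphic_onI)
  fix u assume u: "u \<in> S"
  have "((\<lambda>u. f (z + u *s v)) has_field_derivative (\<Sum>j\<in>UNIV. v $ j * partial_deriv j f (z + u *s v))) (at u)"
    by (rule has_field_derivative_on_line[OF holomorphic_on_ball_has_derivative[OF f S[OF u]] gradient_cmult])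
  thus "(\<lambda>u. f (z + u *s v)) field_differentiable at u within S"
    using field_differentiable_at_within field_differentiable_def by blast
qed

text \<open>Functions are total but identities between derivatives are known only inside the ball;
  its openness allows such an identity to be differentiated again.\<close>

lemma partial_deriv_cong:
  assumes "\<And>z. norm z < 1 \<Longrightarrow> f z = g z" and z: "norm (z :: complex ^ 'n) < 1"
  shows "partial_deriv j f z = partial_deriv j g z"
  unfolding partial_deriv_def
proof (rule deriv_cong_ev)
  let ?h = "\<lambda>w. (\<chi> i. if i = j then w else z $ i) :: complex ^ 'n"
  have h: "?h = (\<lambda>w. (z - (z $ j) *s axis j 1) + w *s axis j 1)"
    by (auto simp: fun_eq_iff axis_def vec_eq_iff)
  have "continuous_on UNIV ?h" unfolding h
    by (intro continuous_on_add continuous_on_const linear_continuous_on[OF bounded_linear_cmult_left])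
  hence "open (?h -` ball 0 1)" by (intro open_vimage open_ball)
  moreover have hz: "?h (z $ j) = z" by (auto simp: vec_eq_iff)
  ultimately have "eventually (\<lambda>w. w \<in> ?h -` ball 0 1) (nhds (z $ j))"
    using z by (intro eventually_nhds_in_open) auto
  thus "eventually (\<lambda>w. f (?h w) = g (?h w)) (nhds (z $ j))"
    by eventually_elim (use assms(1) in auto)
qed simp

section \<open>Difference quotients and holomorphy of partial derivatives\<close>

lemma holomorphic_quadratic_remainder:
  fixes \<phi> :: "complex \<Rightarrow> complex"
  assumes r: "0 < r" and hol: "\<phi> holomorphic_on ball 0 (2 * r)"
    and M: "\<And>u. cmod u < 2 * r \<Longrightarrow> cmod (\<phi> u) \<le> M" and u: "cmod u \<le> r"
  shows "cmod (\<phi> u - \<phi> 0 - deriv \<phi> 0 * u) \<le> 8 * M / r\<^sup>2 * (cmod u)\<^sup>2"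
proof -
  let ?f = "\<lambda>i. (deriv ^^ i) \<phi>"
  have "norm (?f 0 u - (\<Sum>i\<le>1. ?f i 0 * (u - 0) ^ i / fact i)) \<le> (8 * M / r\<^sup>2) * cmod (u - 0) ^ Suc 1 / fact 1"
  proof (rule complex_Taylor[of "cball 0 r"])
    fix i and x :: complex assume x: "x \<in> cball 0 r" and "i \<le> (1 :: nat)"
    have "?f i holomorphic_on ball 0 (2 * r)" using hol by (intro holomorphic_higher_deriv) auto
    hence "(?f i has_field_derivative deriv (?f i) x) (at x)"
      using x r by (intro holomorphic_derivI[of _ "ball 0 (2 * r)"]) auto
    thus "(?f i has_field_derivative ?f (Suc i) x) (at x within cball 0 r)"
      by (simp add: has_field_derivative_at_within)
  next
    fix x :: complex assume x: "x \<in> cball 0 r"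
    have sub: "cball x (r / 2) \<subseteq> ball 0 (2 * r)"
    proof
      fix y assume "y \<in> cball x (r / 2)"
      hence "cmod (y - x) \<le> r / 2" by (simp add: dist_norm norm_minus_commute)
      thus "y \<in> ball 0 (2 * r)" using x r norm_triangle_ineq[of "y - x" x] by simp
    qed
    \<comment> \<open>Cauchy's estimate on circles of radius r/2 gives 2! M / (r/2)^2, which is the
      constant 8 M / r^2.\<close>
    have "cmod ((deriv ^^ 2) \<phi> x) \<le> fact 2 * M / (r / 2) ^ 2"
    proof (rule Cauchy_inequality)
      show "\<phi> holomorphic_on ball x (r / 2)"
        using sub by (intro holomorphic_on_subset[OF hol] order.trans[OF ball_subset_cball])
      show "continuous_on (cball x (r / 2)) \<phi>"
        using sub by (intro holomorphic_on_imp_continuous_on holomorphic_on_subset[OF hol])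
      fix y assume "cmod (x - y) = r / 2"
      hence "y \<in> cball x (r / 2)" by (simp add: dist_norm)
      thus "cmod (\<phi> y) \<le> M" using sub M by auto
    qed (use r in auto)
    thus "cmod (?f (Suc 1) x) \<le> 8 * M / r\<^sup>2"
      by (simp add: power_divide numeral_2_eq_2[symmetric])
  qed (use r u in auto)
  thus ?thesis by (simp add: power2_eq_square algebra_simps)
qed

text \<open>Cauchy's estimate on complex lines turns uniform convergence of the functions into
  uniform convergence of their derivatives on a smaller ball, which is what differentiation of a
  limit requires. Complex linearity survives the limit.\<close>

lemma complex_derivative_limit:
  fixes g :: "nat \<Rightarrow> complex ^ 'n \<Rightarrow> complex"
  assumes r: "0 < r"
    and D: "\<And>k x. x \<in> ball z (2 * r) \<Longrightarrow> (g k has_derivative D k x) (at x)"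
    and Dc: "\<And>k x c v. x \<in> ball z (2 * r) \<Longrightarrow> D k x (c *s v) = c * D k x v"
    and lim: "\<And>k x. x \<in> ball z (2 * r) \<Longrightarrow> cmod (g k x - G x) \<le> \<epsilon> k" and \<epsilon>: "\<epsilon> \<longlonglongrightarrow> 0"
  obtains G' where "(G has_derivative G') (at z)" "\<And>c v. G' (c *s v) = c * G' v"
    "\<And>v. (\<lambda>k. D k z v) \<longlonglongrightarrow> G' v"
proof -
  have eps_nonneg: "0 \<le> \<epsilon> k" for k
    using lim[of z k] r order.trans[OF norm_ge_zero] by auto
  have Cauchy_D: "cmod (D k x v - D l x v) \<le> (\<epsilon> k + \<epsilon> l) / (r / 2) * norm v"
    if x: "x \<in> ball z r" for k l x v
  proof (cases "v = 0")
    case True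
    thus ?thesis using D[of x k] D[of x l] x r 
      by (auto dest!: has_derivative_linear simp: linear_0)
  next
    case False
    \<comment> \<open>On the line through \<open>x\<close> with unit direction \<open>w\<close>, the
      disc of radius r stays in the larger ball. The estimate for \<open>v\<close> follows by
      homogeneity.\<close>
    define w where "w = of_real (1 / norm v) *s v"
    have w: "norm w = 1" using False by (simp add: w_def norm_cmult norm_divide)
    let ?\<phi> = "\<lambda>u. g k (x + u *s w) - g l (x + u *s w)"
    have sub: "x + u *s w \<in> ball z (2 * r)" if "cmod u < r" for u
    proof -
      have "dist z (x + u *s w) \<le> dist z x + norm (u *s w)"
        by (metis add_diff_cancel_left' dist_norm dist_triangle norm_minus_commute)
      thus ?thesis using that x w by (simp add: norm_cmult)
    qed
    have der: "(?\<phi> has_field_derivative D k (x + u *s w) w - D l (x + u *s w) w) (at u)"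
      if "cmod u < r" for u
      by (intro DERIV_diff has_field_derivative_on_line D Dc sub that)
    have hol: "?\<phi> holomorphic_on ball 0 r"
      using der by (intro holomorphic_onI) (auto simp: field_differentiable_def intro: has_field_derivative_at_within)
    have "cmod ((deriv ^^ 1) ?\<phi> 0) \<le> fact 1 * (\<epsilon> k + \<epsilon> l) / (r / 2) ^ 1"
    proof (rule Cauchy_inequality)
      show "?\<phi> holomorphic_on ball 0 (r / 2)" by (rule holomorphic_on_subset[OF hol]) (use r in auto)
      show "continuous_on (cball 0 (r / 2)) ?\<phi>"
        by (intro holomorphic_on_imp_continuous_on holomorphic_on_subset[OF hol]) (use r in auto)
      fix u assume "cmod (0 - u) = r / 2"
      hence m: "x + u *s w \<in> ball z (2 * r)" using r by (intro sub) auto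
      show "cmod (?\<phi> u) \<le> \<epsilon> k + \<epsilon> l"
        using lim[OF m, of k] lim[OF m, of l] norm_triangle_ineq4[of "g k (x + u *s w) - G (x + u *s w)" "g l (x + u *s w) - G (x + u *s w)"]
        by simp
    qed (use r in auto)
    moreover have "deriv ?\<phi> 0 = D k x w - D l x w"
      using DERIV_imp_deriv[OF der[of 0]] r by simp
    ultimately have *: "cmod (D k x w - D l x w) \<le> (\<epsilon> k + \<epsilon> l) / (r / 2)" by simp
    have v: "v = of_real (norm v) *s w" using False by (simp add: w_def vec_eq_iff)
    have x2: "x \<in> ball z (2 * r)" using x r by auto
    have "D k x v - D l x v = of_real (norm v) * (D k x w - D l x w)"
      by (subst v, subst (2) v) (simp add: Dc[OF x2] right_diff_distrib)
    hence "cmod (D k x v - D l x v) = norm v * cmod (D k x w - D l x w)"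
      by (simp add: norm_mult)
    also have "\<dots> \<le> norm v * ((\<epsilon> k + \<epsilon> l) / (r / 2))" using * by (intro mult_left_mono) auto
    finally show ?thesis by (simp add: mult.commute)
  qed
  have conv: "convergent (\<lambda>k. D k x v)" if x: "x \<in> ball z r" for x v
  proof -
    have "Cauchy (\<lambda>k. D k x v)"
    proof (rule metric_CauchyI)
      fix e :: real assume e: "0 < e"
      have "(\<lambda>k. \<epsilon> k / (r / 2) * norm v) \<longlonglongrightarrow> 0 / (r / 2) * norm v"
        by (intro tendsto_intros \<epsilon>) (use r in auto)
      hence "eventually (\<lambda>k. \<epsilon> k / (r / 2) * norm v < e / 2) sequentially"
        using e by (intro order_tendstoD(2)[where y = 0]) auto
      then obtain K where K: "\<And>k. k \<ge> K \<Longrightarrow> \<epsilon> k / (r / 2) * norm v < e / 2"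
        by (auto simp: eventually_sequentially)
      show "\<exists>K. \<forall>k\<ge>K. \<forall>l\<ge>K. dist (D k x v) (D l x v) < e"
      proof (intro exI allI impI)
        fix k l assume "k \<ge> K" "l \<ge> K"
        hence "\<epsilon> k / (r / 2) * norm v + \<epsilon> l / (r / 2) * norm v < e" using K[of k] K[of l] by linarith
        thus "dist (D k x v) (D l x v) < e"
          using Cauchy_D[OF x, of k v l] by (simp add: dist_norm add_divide_distrib distrib_right)
      qed
    qed
    thus ?thesis by (rule Cauchy_convergent)
  qed
  define G' where "G' x v = lim (\<lambda>k. D k x v)" for x v
  have G': "(\<lambda>k. D k x v) \<longlonglongrightarrow> G' x v" if x: "x \<in> ball z r" for x v
    using conv[OF x, of v] by (simp add: G'_def convergent_LIMSEQ_iff)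
  \<comment> \<open>This is \<open>Cauchy_D\<close> with the second index sent to infinity.\<close>
  have est: "cmod (D k x v - G' x v) \<le> \<epsilon> k / (r / 2) * norm v" if x: "x \<in> ball z r" for k x v
  proof (rule tendsto_le[OF sequentially_bot])
    show "(\<lambda>l. (\<epsilon> k + \<epsilon> l) / (r / 2) * norm v) \<longlonglongrightarrow> \<epsilon> k / (r / 2) * norm v"
      using \<epsilon> r by (auto intro!: tendsto_eq_intros)
    show "(\<lambda>l. cmod (D k x v - D l x v)) \<longlonglongrightarrow> cmod (D k x v - G' x v)"
      by (intro tendsto_intros G' x)
    show "\<forall>\<^sub>F l in sequentially. cmod (D k x v - D l x v) \<le> (\<epsilon> k + \<epsilon> l) / (r / 2) * norm v"
      using Cauchy_D[OF x] by simp
  qed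
  have gG: "(\<lambda>k. g k x) \<longlonglongrightarrow> G x" if "x \<in> ball z r" for x
  proof (rule LIM_zero_cancel, rule Lim_null_comparison[OF _ \<epsilon>])
    show "\<forall>\<^sub>F k in sequentially. cmod (g k x - G x) \<le> \<epsilon> k"
      using that r by (intro always_eventually allI lim) simp
  qed
  have "\<exists>h. \<forall>x\<in>ball z r. (\<lambda>k. g k x) \<longlonglongrightarrow> h x \<and> (h has_derivative G' x) (at x within ball z r)"
  proof (rule has_derivative_sequence[where f = g and f' = D])
    show "(g k has_derivative D k x) (at x within ball z r)" if "x \<in> ball z r" for k x
      by (rule has_derivative_at_withinI, rule D) (use that r in simp)
    show z: "z \<in> ball z r" using r by simp
    show "(\<lambda>k. g k z) \<longlonglongrightarrow> G z" by (rule gG[OF z])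
    fix e :: real assume e: "0 < e"
    have "(\<lambda>k. \<epsilon> k / (r / 2)) \<longlonglongrightarrow> 0 / (r / 2)"
      by (intro tendsto_intros \<epsilon>) (use r in auto)
    hence "eventually (\<lambda>k. \<epsilon> k / (r / 2) < e) sequentially"
      using e by (intro order_tendstoD(2)[where y = 0]) auto
    thus "\<forall>\<^sub>F k in sequentially. \<forall>x\<in>ball z r. \<forall>v. cmod (D k x v - G' x v) \<le> e * norm v"
    proof eventually_elim
      case (elim k)
      show ?case
      proof (intro ballI allI)
        fix x v assume "x \<in> ball z r"
        from est[OF this, of k v] show "cmod (D k x v - G' x v) \<le> e * norm v"
          by (rule order.trans[OF _ mult_right_mono[OF less_imp_le[OF elim] norm_ge_zero]])
      qed
    qed
  qed simp
  then obtain h where h: "\<And>x. x \<in> ball z r \<Longrightarrow> (\<lambda>k. g k x) \<longlonglongrightarrow> h x"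
    "\<And>x. x \<in> ball z r \<Longrightarrow> (h has_derivative G' x) (at x within ball z r)" by blast
  have zz: "z \<in> ball z r" using r by simp
  have "(h has_derivative G' z) (at z)" using h(2)[OF zz] unfolding at_within_open[OF zz open_ball] .
  hence "(G has_derivative G' z) (at z)"
  proof (rule has_derivative_transform_within_open[OF _ open_ball zz])
    fix x assume "x \<in> ball z r"
    thus "h x = G x" using LIMSEQ_unique[OF h(1) gG] by blast
  qed
  moreover have "G' z (c *s v) = c * G' z v" for c v
  proof (rule LIMSEQ_unique[OF G'[OF zz]])
    have "(\<lambda>k. c * D k z v) \<longlonglongrightarrow> c * G' z v" by (intro tendsto_intros G' zz)
    thus "(\<lambda>k. D k z (c *s v)) \<longlonglongrightarrow> c * G' z v" using Dc r by simp
  qed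
  ultimately show thesis using that G'[OF zz] by blast
qed

lemma partial_deriv_approx:
  fixes f :: "complex ^ 'n \<Rightarrow> complex"
  assumes f: "holomorphic_on_ball f" and z: "norm z < 1"
  obtains r C where "0 < r" "r \<le> 1" "\<And>x. x \<in> ball z (2 * r) \<Longrightarrow> norm x < 1 - 2 * r"
    "\<And>x u. x \<in> ball z (2 * r) \<Longrightarrow> cmod u \<le> r \<Longrightarrow>
       cmod (f (x + u *s axis j 1) - f x - partial_deriv j f x * u) \<le> C * (cmod u)\<^sup>2"
proof -
  \<comment> \<open>With |z| = 1 - 5 r, points of \<open>ball z (2 * r)\<close> have norm below 1 -
    3 r, and a further move of length below 2 r ends in the closed ball of radius 1 - r, where
    \<open>f\<close> is bounded by compactness.\<close>
  define r where "r = (1 - norm z) / 5"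
  have r: "0 < r" "r \<le> 1" unfolding r_def using z norm_ge_zero[of z] by (auto simp del: norm_ge_zero)
  have x1: "norm x < 1 - 3 * r" if "x \<in> ball z (2 * r)" for x
    using that norm_triangle_sub[of x z] by (simp add: dist_norm norm_minus_commute r_def field_simps)
  have "compact (f ` cball 0 (1 - r))"
    using r by (intro compact_continuous_image continuous_on_subset[OF holomorphic_on_ball_imp_continuous_on[OF f]]) auto
  then obtain M where M: "\<And>x. norm x \<le> 1 - r \<Longrightarrow> cmod (f x) \<le> M"
    by (metis bounded_iff compact_imp_bounded imageI mem_cball_0)
  have "cmod (f (x + u *s axis j 1) - f x - partial_deriv j f x * u) \<le> 8 * M / r\<^sup>2 * (cmod u)\<^sup>2"
    if x: "x \<in> ball z (2 * r)" and u: "cmod u \<le> r" for x u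
  proof -
    let ?\<phi> = "\<lambda>u. f (x + u *s axis j 1)"
    have n: "norm (x + u *s axis j 1) \<le> 1 - r" if "cmod u < 2 * r" for u
      using norm_triangle_ineq[of x "u *s axis j 1"] that x1[OF x] by (simp add: norm_cmult)
    have "cmod (?\<phi> u - ?\<phi> 0 - deriv ?\<phi> 0 * u) \<le> 8 * M / r\<^sup>2 * (cmod u)\<^sup>2"
    proof (rule holomorphic_quadratic_remainder[OF r(1) _ _ u])
      show "?\<phi> holomorphic_on ball 0 (2 * r)"
        by (rule holomorphic_on_line[OF f]) (use n r in fastforce)
    qed (use M n in auto)
    moreover have "(?\<phi> has_field_derivative (\<Sum>i\<in>UNIV. axis j 1 $ i * partial_deriv i f x)) (at 0)"
      by (rule has_field_derivative_on_line[OF _ gradient_cmult])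
         (use holomorphic_on_ball_has_derivative[OF f, of x] x1[OF x] r in simp)
    hence "deriv ?\<phi> 0 = partial_deriv j f x" unfolding gradient_axis by (rule DERIV_imp_deriv)
    ultimately show ?thesis by simp
  qed
  moreover have "norm x < 1 - 2 * r" if "x \<in> ball z (2 * r)" for x using x1[OF that] r by simp
  ultimately show thesis using that r by blast
qed

text \<open>By the quadratic remainder, the quotients k (f(x + e_j / k) - f(x)) converge uniformly
  to the \<open>j\<close>-th partial derivative, so the limit is differentiable. Their
  \<open>i\<close>-th derivatives are difference quotients of \<open>partial_deriv i f\<close>; the
  last conclusion records that limit because it yields the symmetry of second derivatives.\<close>

lemma partial_deriv_second:
  fixes f :: "complex ^ 'n \<Rightarrow> complex"
  assumes f: "holomorphic_on_ball f" and z: "norm z < 1"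
  obtains G' where "(partial_deriv j f has_derivative G') (at z)" "\<And>c v. G' (c *s v) = c * G' v"
    "\<And>i. \<exists>K. (\<lambda>k. of_nat (k + K) * (partial_deriv i f (z + (1 / of_nat (k + K)) *s axis j 1) - partial_deriv i f z))
      \<longlonglongrightarrow> G' (axis i 1)" 
proof -
  obtain r C where r: "0 < r" "r \<le> 1" and rz: "\<And>x. x \<in> ball z (2 * r) \<Longrightarrow> norm x < 1 - 2 * r"
    and C: "\<And>x u. x \<in> ball z (2 * r) \<Longrightarrow> cmod u \<le> r \<Longrightarrow>
       cmod (f (x + u *s axis j 1) - f x - partial_deriv j f x * u) \<le> C * (cmod u)\<^sup>2"
    using partial_deriv_approx[OF f z] by blast
  \<comment> \<open>The shift \<open>K\<close> keeps every step 1 / (k + K) at most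
    \<open>r\<close>, where the remainder estimate is valid.\<close>
  obtain K where K: "1 / r < real K" using reals_Archimedean2 by blast
  define s where "s k = real (k + K)" for k
  have s: "0 < s k" "1 / s k \<le> r" for k
  proof -
    have "0 < 1 / r" using r by simp
    hence "0 < real K" using K by linarith
    thus "0 < s k" by (simp add: s_def)
    have "1 / r \<le> s k" using K by (simp add: s_def)
    thus "1 / s k \<le> r" using \<open>0 < s k\<close> r by (simp add: field_simps)
  qed
  define p where "p k = (of_real (1 / s k) *s axis j 1 :: complex ^ 'n)" for k
  define g where "g k x = of_real (s k) * (f (x + p k) - f x)" for k x
  define D where "D k x v = of_real (s k) * ((\<Sum>i\<in>UNIV. v $ i * partial_deriv i f (x + p k)) -
      (\<Sum>i\<in>UNIV. v $ i * partial_deriv i f x))" for k x v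
  have xp: "norm (x + p k) < 1" if "x \<in> ball z (2 * r)" for x k
  proof -
    have "norm (p k) = 1 / s k" using s[of k] by (simp add: p_def norm_cmult norm_divide)
    thus ?thesis using norm_triangle_ineq[of x "p k"] rz[OF that] s[of k] r by simp
  qed
  have x1: "norm x < 1" if "x \<in> ball z (2 * r)" for x using rz[OF that] r by simp
  obtain G' where G': "(partial_deriv j f has_derivative G') (at z)" "\<And>c v. G' (c *s v) = c * G' v"
    "\<And>v. (\<lambda>k. D k z v) \<longlonglongrightarrow> G' v"
  proof (rule complex_derivative_limit[OF r(1), of z g D "partial_deriv j f" "\<lambda>k. C / s k"])
    fix k x assume x: "x \<in> ball z (2 * r)"
    have "((\<lambda>x. f (x + p k)) has_derivative (\<lambda>v. \<Sum>i\<in>UNIV. v $ i * partial_deriv i f (x + p k))) (at x)"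
      using diff_chain_at[of "\<lambda>x. x + p k" "\<lambda>v. v" x f,
        OF _ holomorphic_on_ball_has_derivative[OF f xp[OF x, of k]]]
      by (simp add: o_def has_derivative_add_const)
    thus "(g k has_derivative D k x) (at x)"
      unfolding g_def D_def
      by (intro has_derivative_mult_right has_derivative_diff holomorphic_on_ball_has_derivative[OF f x1[OF x]])
    have "cmod (g k x - partial_deriv j f x) = s k * cmod (f (x + p k) - f x - partial_deriv j f x * of_real (1 / s k))"
    proof -
      have "g k x - partial_deriv j f x = of_real (s k) * (f (x + p k) - f x - partial_deriv j f x * of_real (1 / s k))"
        using s(1)[of k] by (simp add: g_def algebra_simps)
      thus ?thesis using s(1)[of k] by (simp add: norm_mult)
    qed
    also have "\<dots> \<le> s k * (C * (1 / s k)\<^sup>2)"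
      using C[OF x, of "of_real (1 / s k)"] s[of k] unfolding p_def
      by (intro mult_left_mono) (auto simp: norm_divide)
    also have "\<dots> = C / s k" using s(1)[of k] by (simp add: power2_eq_square)
    finally show "cmod (g k x - partial_deriv j f x) \<le> C / s k" .
  next
    fix k x c v
    show "D k x (c *s v) = c * D k x v" unfolding D_def gradient_cmult by (simp add: algebra_simps)
  next
    show "(\<lambda>k. C / s k) \<longlonglongrightarrow> 0" unfolding s_def
      by (intro LIMSEQ_ignore_initial_segment lim_const_over_n)
  qed blast
  show thesis
  proof (rule that[OF G'(1,2)])
    fix i
    have "(\<lambda>k. D k z (axis i 1)) \<longlonglongrightarrow> G' (axis i 1)" by (rule G'(3))
    thus "\<exists>K. (\<lambda>k. of_nat (k + K) * (partial_deriv i f (z + (1 / of_nat (k + K)) *s axis j 1) - partial_deriv i f z))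
      \<longlonglongrightarrow> G' (axis i 1)"
      unfolding D_def gradient_axis p_def s_def by (intro exI[of _ K]) simp
  qed
qed

lemma holomorphic_partial_deriv:
  fixes f :: "complex ^ 'n \<Rightarrow> complex"
  assumes f: "holomorphic_on_ball f"
  shows "holomorphic_on_ball (partial_deriv j f)"
  unfolding holomorphic_on_ball_def
proof
  fix z :: "complex ^ 'n" assume "z \<in> unit_ball"
  hence "norm z < 1" by simp
  then obtain G' where "(partial_deriv j f has_derivative G') (at z)" "\<And>c v. G' (c *s v) = c * G' v"
    by (rule partial_deriv_second[OF f, where j = j]) (rule that)
  thus "\<exists>D. (partial_deriv j f has_derivative D) (at z) \<and> (\<forall>c v. D (c *s v) = c * D v)" by blast
qed

text \<open>One and the same sequence of difference quotients of \<open>partial_deriv i f\<close> in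
  direction \<open>j\<close> has both sides as its limit.\<close>

lemma partial_deriv_commute:
  fixes f :: "complex ^ 'n \<Rightarrow> complex"
  assumes f: "holomorphic_on_ball f" and z: "norm z < 1"
  shows "partial_deriv i (partial_deriv j f) z = partial_deriv j (partial_deriv i f) z"
proof -
  obtain G' where G': "(partial_deriv j f has_derivative G') (at z)" "\<And>c v. G' (c *s v) = c * G' v"
    "\<And>i. \<exists>K. (\<lambda>k. of_nat (k + K) * (partial_deriv i f (z + (1 / of_nat (k + K)) *s axis j 1) - partial_deriv i f z))
      \<longlonglongrightarrow> G' (axis i 1)"
    by (rule partial_deriv_second[OF f z, of j]) (rule that)
  obtain K where K: "(\<lambda>k. of_nat (k + K) * (partial_deriv i f (z + (1 / of_nat (k + K)) *s axis j 1) - partial_deriv i f z))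
      \<longlonglongrightarrow> G' (axis i 1)" using G'(3) by blast
  let ?\<phi> = "\<lambda>u. partial_deriv i f (z + u *s axis j 1)"
  have "(?\<phi> has_field_derivative (\<Sum>l\<in>UNIV. axis j 1 $ l * partial_deriv l (partial_deriv i f) z)) (at 0)"
    by (rule has_field_derivative_on_line[OF _ gradient_cmult])
       (use holomorphic_on_ball_has_derivative[OF holomorphic_partial_deriv[OF f] z] in simp)
  hence "((\<lambda>h. (?\<phi> (0 + h) - ?\<phi> 0) / h) \<longlongrightarrow> partial_deriv j (partial_deriv i f) z) (at 0)"
    unfolding gradient_axis has_field_derivative_iff DERIV_def by simp
  \<comment> \<open>\<open>K\<close> may be 0, so the index is shifted once more to keep every step
    nonzero.\<close>
  moreover have "filterlim (\<lambda>k. 1 / of_nat (k + Suc K) :: complex) (at 0) sequentially"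
  proof -
    have "(\<lambda>k. 1 / of_nat (k + Suc K) :: complex) \<longlonglongrightarrow> 0"
      by (intro LIMSEQ_ignore_initial_segment lim_const_over_n)
    thus ?thesis by (auto simp: filterlim_at simp del: of_nat_add of_nat_Suc)
  qed
  ultimately have "(\<lambda>k. (?\<phi> (0 + 1 / of_nat (k + Suc K)) - ?\<phi> 0) / (1 / of_nat (k + Suc K)))
     \<longlonglongrightarrow> partial_deriv j (partial_deriv i f) z"
    by (rule filterlim_compose)
  moreover have "(\<lambda>k. (?\<phi> (0 + 1 / of_nat (k + Suc K)) - ?\<phi> 0) / (1 / of_nat (k + Suc K)))
     \<longlonglongrightarrow> G' (axis i 1)"
    using LIMSEQ_Suc[OF K] by (simp add: mult.commute)
  ultimately have "partial_deriv j (partial_deriv i f) z = G' (axis i 1)" by (rule LIMSEQ_unique)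
  thus ?thesis using partial_deriv_eq[OF G'(1,2)] by simp
qed

section \<open>Iterated partial derivatives and multi-indices\<close>

lemma holomorphic_foldr_partial_deriv:
  "holomorphic_on_ball f \<Longrightarrow> holomorphic_on_ball (foldr partial_deriv js f)"
  by (induction js) (auto intro: holomorphic_partial_deriv)

text \<open>Commutation holds only pointwise in the ball, so each exchange is carried under the
  outer derivatives by \<open>partial_deriv_cong\<close>.\<close>

lemma foldr_partial_deriv_move:
  fixes f :: "complex ^ 'n \<Rightarrow> complex"
  assumes f: "holomorphic_on_ball f" and z: "norm z < 1"
  shows "foldr partial_deriv (xs @ i # ys) f z = partial_deriv i (foldr partial_deriv (xs @ ys) f) z"
  using z
proof (induction xs arbitrary: z)
  case (Cons x xs)
  have "foldr partial_deriv ((x # xs) @ i # ys) f z =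
      partial_deriv x (partial_deriv i (foldr partial_deriv (xs @ ys) f)) z"
    using partial_deriv_cong[OF Cons.IH Cons.prems] by simp
  also have "\<dots> = partial_deriv i (partial_deriv x (foldr partial_deriv (xs @ ys) f)) z"
    by (rule partial_deriv_commute[OF holomorphic_foldr_partial_deriv[OF f] Cons.prems])
  finally show ?case by simp
qed simp

lemma foldr_partial_deriv_perm:
  fixes f :: "complex ^ 'n \<Rightarrow> complex"
  assumes f: "holomorphic_on_ball f" and "mset js = mset ks" and z: "norm z < 1"
  shows "foldr partial_deriv js f z = foldr partial_deriv ks f z"
  using assms(2) z
proof (induction js arbitrary: ks z)
  case (Cons j js)
  have "j \<in> set ks" using Cons.prems(1) by (metis list.set_intros(1) set_mset_mset)
  then obtain xs ys where ks: "ks = xs @ j # ys" by (auto simp: in_set_conv_decomp)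
  have "mset js = mset (xs @ ys)" using Cons.prems(1) ks by simp
  hence "partial_deriv j (foldr partial_deriv js f) z = partial_deriv j (foldr partial_deriv (xs @ ys) f) z"
    by (intro partial_deriv_cong Cons.IH Cons.prems(2))
  thus ?case unfolding ks foldr_partial_deriv_move[OF f Cons.prems(2)] by simp
qed simp

lemma coordinate_list: "distinct (coordinate_list :: 'n::finite list)" "set (coordinate_list :: 'n list) = UNIV"
proof -
  have "\<exists>js :: 'n list. distinct js \<and> set js = UNIV" using finite_distinct_list[of "UNIV :: 'n set"] by auto
  hence "distinct (coordinate_list :: 'n list) \<and> set (coordinate_list :: 'n list) = UNIV"
    unfolding coordinate_list_def by (rule someI_ex)
  thus "distinct (coordinate_list :: 'n::finite list)" "set (coordinate_list :: 'n list) = UNIV" by auto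
qed

lemma multi_deriv_eq_foldr:
  "multi_deriv m f = foldr partial_deriv (concat (map (\<lambda>j. replicate (m j) j) coordinate_list)) f"
proof -
  have "foldr (\<lambda>j. partial_deriv j ^^ m j) js f = foldr partial_deriv (concat (map (\<lambda>j. replicate (m j) j) js)) f" for js
  proof (induction js)
    case (Cons j js)
    have "(partial_deriv j ^^ k) g = foldr partial_deriv (replicate k j) g" for k g by (induction k) auto
    thus ?case using Cons by simp
  qed simp
  thus ?thesis by (simp add: multi_deriv_def)
qed

text \<open>Taylor's formula produces words of derivatives, the Besov norm multi-indices. A word is
  a permutation of the one that lists its letter counts in the order of
  \<open>coordinate_list\<close>.\<close>

lemma foldr_partial_deriv_eq_multi_deriv:
  fixes f :: "complex ^ 'n \<Rightarrow> complex"
  assumes f: "holomorphic_on_ball f" and z: "norm z < 1"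
  shows "foldr partial_deriv js f z = multi_deriv (count (mset js)) f z"
  unfolding multi_deriv_eq_foldr
proof (rule foldr_partial_deriv_perm[OF f _ z], rule multiset_eqI)
  fix i :: 'n
  have *: "count (mset (concat (map (\<lambda>j. replicate (m j) j) ks))) i = (if i \<in> set ks then m i else 0)"
    if "distinct ks" for m ks using that by (induction ks) auto
  show "count (mset js) i = count (mset (concat (map (\<lambda>j. replicate (count (mset js) j) j) coordinate_list))) i"
    by (subst *) (simp_all add: coordinate_list)
qed

lemma sum_count_mset: "sum (count (mset js)) UNIV = length (js :: 'n::finite list)"
proof -
  have "sum (count (mset js)) UNIV = sum (count (mset js)) (set_mset (mset js))"
    by (rule sum.mono_neutral_right) (auto simp: count_eq_zero_iff)
  thus ?thesis by (metis size_mset size_multiset_overloaded_eq)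
qed

lemma holomorphic_multi_deriv: "holomorphic_on_ball f \<Longrightarrow> holomorphic_on_ball (multi_deriv m f)"
  unfolding multi_deriv_eq_foldr by (rule holomorphic_foldr_partial_deriv)

section \<open>The mean value inequality on nonisotropic balls\<close>

text \<open>Cauchy's integral formula on the unit circle, parametrised by [0, 1]; r > 1 puts the
  closed disc inside the domain.\<close>

lemma holomorphic_submean_circle:
  fixes \<phi> :: "complex \<Rightarrow> complex"
  assumes hol: "\<phi> holomorphic_on ball 0 r" and r: "1 < r"
  shows "ennreal (cmod (\<phi> 0)) \<le> (\<integral>\<^sup>+t. indicator {0..1} t * ennreal (cmod (\<phi> (exp (2 * of_real pi * \<i> * of_real t)))) \<partial>lborel)"
proof -
  let ?e = "\<lambda>t. exp (2 * of_real pi * \<i> * of_real t) :: complex"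
  have cont: "continuous_on {0..1} (\<lambda>t. \<phi> (?e t))"
    by (rule continuous_on_compose2[OF holomorphic_on_imp_continuous_on[OF hol]])
       (use r in \<open>auto intro!: continuous_intros\<close>)
  have "((\<lambda>u. \<phi> u / (u - 0)) has_contour_integral 2 * of_real pi * \<i> * \<phi> 0) (circlepath 0 1)"
    by (rule Cauchy_integral_circlepath_simple[of _ 0 1])
       (use r in \<open>auto intro!: holomorphic_on_subset[OF hol] holomorphic_on_imp_continuous_on\<close>)
  hence "((\<lambda>t. 2 * of_real pi * \<i> * \<phi> (?e t)) has_integral 2 * of_real pi * \<i> * \<phi> 0) {0..1}"
    unfolding has_contour_integral_def
  proof (rule has_integral_eq[rotated])
    fix t :: real assume "t \<in> {0..1}"
    hence vd: "vector_derivative (circlepath 0 1) (at t within {0..1}) = 2 * pi * \<i> * ?e t"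
      by (subst vector_derivative_circlepath01) auto
    show "\<phi> (circlepath 0 1 t) / (circlepath 0 1 t - 0) * vector_derivative (circlepath 0 1) (at t within {0..1}) =
      2 * of_real pi * \<i> * \<phi> (?e t)"
      unfolding vd by (simp add: circlepath)
  qed
  from has_integral_mult_right[OF this, of "1 / (2 * of_real pi * \<i>)"]
  have *: "((\<lambda>t. \<phi> (?e t)) has_integral \<phi> 0) {0..1}" by simp
  have int: "((\<lambda>t. cmod (\<phi> (?e t))) has_integral integral {0..1} (\<lambda>t. cmod (\<phi> (?e t)))) {0..1}"
    by (intro integrable_integral integrable_continuous_real continuous_intros cont)
  have "cmod (\<phi> 0) \<le> integral {0..1} (\<lambda>t. cmod (\<phi> (?e t)))"
    using integral_norm_bound_integral[of "\<lambda>t. \<phi> (?e t)" "{0..1}" "\<lambda>t. cmod (\<phi> (?e t))"] * int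
    by (auto simp: has_integral_iff)
  also have "ennreal \<dots> = (\<integral>\<^sup>+t. ennreal (indicator {0..1} t * cmod (\<phi> (?e t))) \<partial>lborel)"
  proof (rule nn_integral_has_integral_lborel[symmetric])
    show "(\<lambda>t. indicator {0..1} t * cmod (\<phi> (?e t))) \<in> borel_measurable borel"
      using borel_measurable_continuous_on_indicator[of "{0..1}" "\<lambda>t. cmod (\<phi> (?e t))"]
        continuous_on_norm[OF cont] by simp
    have "((\<lambda>t. if t \<in> {0..1} then cmod (\<phi> (?e t)) else 0) has_integral integral {0..1} (\<lambda>t. cmod (\<phi> (?e t)))) UNIV"
      using int by (simp only: has_integral_restrict_UNIV)
    thus "((\<lambda>t. indicator {0..1} t * cmod (\<phi> (?e t))) has_integral integral {0..1} (\<lambda>t. cmod (\<phi> (?e t)))) UNIV"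
      by (rule has_integral_eq[rotated]) auto
  qed auto
  also have "\<dots> = (\<integral>\<^sup>+t. indicator {0..1} t * ennreal (cmod (\<phi> (?e t))) \<partial>lborel)"
    by (rule nn_integral_cong) (auto split: split_indicator)
  finally show ?thesis by (simp add: ennreal_leI)
qed

text \<open>Values outside the ball are arbitrary, so measurability on the whole space is available
  only after truncation.\<close>

lemma holomorphic_on_ball_measurable:
  assumes "holomorphic_on_ball f"
  shows "(\<lambda>y. indicator unit_ball y * ennreal (cmod (f y))) \<in> borel_measurable borel"
proof -
  have "(\<lambda>y. indicator unit_ball y *\<^sub>R cmod (f y)) \<in> borel_measurable borel"
    by (rule borel_measurable_continuous_on_indicator)
       (auto intro!: continuous_intros holomorphic_on_ball_imp_continuous_on assms)
  hence "(\<lambda>y. ennreal (indicator unit_ball y *\<^sub>R cmod (f y))) \<in> borel_measurable borel" by measurable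
  also have "(\<lambda>y. ennreal (indicator unit_ball y *\<^sub>R cmod (f y))) = (\<lambda>y. indicator unit_ball y * ennreal (cmod (f y)))"
    by (auto simp: fun_eq_iff split: split_indicator)
  finally show ?thesis .
qed

lemma nonisotropic_cmult: "nonisotropic u \<alpha> \<beta> (c *s x) = c *s nonisotropic u \<alpha> \<beta> x"
  by (simp add: nonisotropic_def scaleR_eq_cmult hermitian_simps vec_eq_iff algebra_simps)

lemma continuous_on_cmult [continuous_intros]:
  fixes g :: "'a::topological_space \<Rightarrow> complex ^ 'n"
  shows "continuous_on S f \<Longrightarrow> continuous_on S g \<Longrightarrow> continuous_on S (\<lambda>x. f x *s g x)"
  unfolding vector_scalar_mult_def by (intro continuous_intros)

lemma continuous_on_nonisotropic [continuous_intros]: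
  "continuous_on S f \<Longrightarrow> continuous_on S (\<lambda>x. nonisotropic u \<alpha> \<beta> (f x))"
  unfolding nonisotropic_def by (intro continuous_intros)

lemma nonisotropic_measurable [measurable]: "nonisotropic u \<alpha> \<beta> \<in> borel_measurable borel"
  by (intro borel_measurable_continuous_onI continuous_intros)

text \<open>Averaging the mean value inequality on circles \<open>e\<^sup>i\<^sup>\<theta> x\<close> over all \<open>x\<close> avoids polar coordinates.\<close>

lemma holomorphic_submean_ball:
  fixes g :: "complex ^ 'n \<Rightarrow> complex"
  assumes g: "holomorphic_on_ball g" 
    and T: "\<And>x. norm x < 1 \<Longrightarrow> norm (w + nonisotropic u \<alpha> \<beta> x) < 1"
  shows "ennreal (cmod (g w)) * emeasure lborel (unit_ball :: (complex ^ 'n) set) \<le>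
    (\<integral>\<^sup>+x. indicator unit_ball x * ennreal (cmod (g (w + nonisotropic u \<alpha> \<beta> x))) \<partial>lborel)"
proof -
  let ?T = "nonisotropic u \<alpha> \<beta>" and ?e = "\<lambda>t. exp (2 * of_real pi * \<i> * of_real t) :: complex"
  define G where "G = (\<lambda>y. indicator unit_ball y * ennreal (cmod (g y)))"
  have [measurable]: "G \<in> borel_measurable borel"
    unfolding G_def by (rule holomorphic_on_ball_measurable[OF g])
  let ?H = "\<lambda>x t. indicator {0..1} t * G (w + ?T (?e t *s x))"
  let ?B = "\<lambda>x :: complex ^ 'n. indicator unit_ball x :: ennreal"
  have GT: "?B x * G (w + ?T x) = ?B x * ennreal (cmod (g (w + ?T x)))" for x
    using T by (auto simp: G_def split: split_indicator)
  have "continuous_on UNIV (\<lambda>p :: (complex ^ 'n) \<times> real. w + ?T (?e (snd p) *s fst p))"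
    by (intro continuous_intros)
  hence [measurable]: "(\<lambda>p :: (complex ^ 'n) \<times> real. w + ?T (?e (snd p) *s fst p)) \<in> borel_measurable (lborel \<Otimes>\<^sub>M lborel)"
    by (simp add: lborel_prod borel_measurable_continuous_onI)
  have [measurable]: "unit_ball \<in> sets (borel :: (complex ^ 'n) measure)" by simp
  have e1: "cmod (?e t) = 1" for t by simp
  have "ennreal (cmod (g w)) * emeasure lborel (unit_ball :: (complex ^ 'n) set) =
      (\<integral>\<^sup>+x. ?B x * ennreal (cmod (g w)) \<partial>lborel)"
    by (subst nn_integral_multc) (auto simp: mult.commute intro!: borel_measurable_indicator)
  also have "\<dots> \<le> (\<integral>\<^sup>+x. (\<integral>\<^sup>+t. ?B x * (?H x t) \<partial>lborel) \<partial>lborel)"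
  proof (rule nn_integral_mono)
    fix x :: "complex ^ 'n"
    show "?B x * ennreal (cmod (g w)) \<le> (\<integral>\<^sup>+t. ?B x * (?H x t) \<partial>lborel)"
    proof (cases "norm x < 1")
      case True
      \<comment> \<open>This choice has r > 1 and r |x| < 1, so the closed unit disc of multiples of
        \<open>x\<close> lies in an open disc that stays in the ball.\<close>
      define r where "r = 2 / (1 + norm x)"
      have r: "1 < r" using True by (simp add: r_def field_simps add_pos_nonneg)
      have rx: "norm (c *s x) < 1" if "cmod c < r" for c
      proof -
        have "cmod c * norm x \<le> r * norm x" using that by (intro mult_right_mono) auto
        also have "\<dots> < 1" using True by (simp add: r_def field_simps add_pos_nonneg)
        finally show ?thesis by (simp add: norm_cmult)
      qed
      have "(\<lambda>c. g (w + c *s ?T x)) holomorphic_on ball 0 r"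
        by (rule holomorphic_on_line[OF g]) (use T rx in \<open>auto simp flip: nonisotropic_cmult\<close>)
      from holomorphic_submean_circle[OF this r]
      have "ennreal (cmod (g w)) \<le> (\<integral>\<^sup>+t. indicator {0..1} t * ennreal (cmod (g (w + ?T (?e t *s x)))) \<partial>lborel)"
        by (simp add: nonisotropic_cmult)
      also have "\<dots> = (\<integral>\<^sup>+t. ?H x t \<partial>lborel)"
      proof (rule nn_integral_cong)
        fix t
        have "norm (w + ?T (?e t *s x)) < 1" by (intro T) (use True in \<open>simp add: norm_cmult\<close>)
        thus "indicator {0..1} t * ennreal (cmod (g (w + ?T (?e t *s x)))) = ?H x t"
          by (simp add: G_def)
      qed
      finally show ?thesis using True by simp
    qed simp
  qed
  also have "\<dots> = (\<integral>\<^sup>+t. (\<integral>\<^sup>+x. ?B x * (?H x t) \<partial>lborel) \<partial>lborel)"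
    by (rule lborel_pair.Fubini'[symmetric]) measurable
  \<comment> \<open>Multiplication by a unimodular number is an isometry, so the averaged value is
    the same for every \<open>t\<close> in [0, 1].\<close>
  also have "\<dots> = (\<integral>\<^sup>+t. indicator {0..1} t * (\<integral>\<^sup>+x. ?B x * G (w + ?T x) \<partial>lborel) \<partial>(lborel :: real measure))"
  proof (rule nn_integral_cong)
    fix t :: real
    have lin: "linear ((*s) (?e t) :: complex ^ 'n \<Rightarrow> _)"
      by (rule linearI) (simp_all add: vec_eq_iff algebra_simps)
    have "(\<integral>\<^sup>+x. ?B x * (?H x t) \<partial>lborel) =
        (\<integral>\<^sup>+x. ?B (?e t *s x) * (?H x t) \<partial>lborel)"
      by (rule nn_integral_cong) (auto simp: norm_cmult split: split_indicator)
    also have "\<dots> = (\<integral>\<^sup>+x. ?B x * (indicator {0..1} t * G (w + ?T x)) \<partial>lborel)"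
      by (rule nn_integral_lborel_isometry[OF lin]) (auto simp: norm_cmult)
    also have "\<dots> = indicator {0..1} t * (\<integral>\<^sup>+x. ?B x * G (w + ?T x) \<partial>lborel)"
      by (subst nn_integral_cmult[symmetric]) (auto simp: mult_ac)
    finally show "(\<integral>\<^sup>+x. ?B x * (?H x t) \<partial>lborel) =
        indicator {0..1} t * (\<integral>\<^sup>+x. ?B x * G (w + ?T x) \<partial>lborel)" .
  qed
  also have "\<dots> = (\<integral>\<^sup>+x. ?B x * G (w + ?T x) \<partial>lborel)" by (subst nn_integral_multc) auto
  also have "\<dots> = (\<integral>\<^sup>+x. ?B x * ennreal (cmod (g (w + ?T x))) \<partial>lborel)" by (simp only: GT)
  finally show ?thesis .
qed

section \<open>Position of a nonisotropic ball within a spherical shell\<close>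

lemma norm_sq_unit_decomposition:
  fixes u y :: "complex ^ 'n"
  assumes u: "norm u = 1"
  shows "(norm (a *s u + b *s (y - hermitian y u *s u)))\<^sup>2 =
    (cmod a)\<^sup>2 + (cmod b)\<^sup>2 * ((norm y)\<^sup>2 - (cmod (hermitian y u))\<^sup>2)"
proof -
  define c where "c = hermitian y u"
  define v where "v = y - c *s u"
  have uu: "hermitian u u = 1" using u by (simp add: hermitian_self)
  have vu: "hermitian v u = 0" "hermitian u v = 0"
    using cnj_hermitian[of v u] by (auto simp: v_def hermitian_simps uu c_def)
  have pyth: "(norm (a *s u + b *s v))\<^sup>2 = (cmod a)\<^sup>2 + (cmod b)\<^sup>2 * (norm v)\<^sup>2" for a b
    unfolding norm_sq_eq_Re_hermitian[of "a *s u + b *s v"] unfolding hermitian_simps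
    by (simp add: vu hermitian_self u cmod_power2 algebra_simps) (simp add: power2_eq_square algebra_simps)
  have "y = c *s u + 1 *s v" by (simp add: v_def)
  hence "(norm y)\<^sup>2 = (cmod c)\<^sup>2 + (norm v)\<^sup>2" using pyth[of c 1] by simp
  thus ?thesis using pyth[of a b] by (simp add: v_def c_def)
qed

text \<open>The displacement of length up to sqrt(h)/4 is orthogonal to \<open>w\<close>, so by
  Pythagoras it changes |y|^2 by at most h/16, while the displacement along \<open>u\<close> is at
  most h/4. Both effects are of order \<open>h\<close>, which is the reason for the unequal
  radii.\<close>

lemma nonisotropic_ball_shell:
  fixes w u :: "complex ^ 'n"
  assumes w: "norm w < 1" and u: "norm u = 1" "w = of_real (norm w) *s u" and x: "norm x < 1"
  defines "h \<equiv> 1 - norm w" and "y \<equiv> w + nonisotropic u ((1 - norm w) / 4) (sqrt (1 - norm w) / 4) x"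
  shows "3 / 8 * h \<le> 1 - (norm y)\<^sup>2" "1 - (norm y)\<^sup>2 \<le> 5 / 2 * h"
proof -
  define c where "c = hermitian x u"
  have h: "0 < h" "h \<le> 1" using w by (auto simp: h_def)
  define a where "a = of_real (norm w) + of_real (h / 4) * c"
  have y: "y = a *s u + of_real (sqrt h / 4) *s (x - hermitian x u *s u)"
    unfolding y_def nonisotropic_def c_def[symmetric] h_def[symmetric] a_def
    by (subst u(2)) (simp add: scaleR_eq_cmult vec_eq_iff algebra_simps)
  define V where "V = (norm x)\<^sup>2 - (cmod c)\<^sup>2"
  have V0: "0 \<le> V"
    using power_mono[OF cmod_hermitian_le[of x u] norm_ge_zero, of 2] u(1) by (simp add: V_def c_def)
  hence "(cmod c)\<^sup>2 \<le> (norm x)\<^sup>2" by (simp add: V_def)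
  moreover have "(norm x)\<^sup>2 \<le> 1" using x by (simp add: power_le_one)
  ultimately have lv: "(cmod c)\<^sup>2 \<le> 1" "V \<le> 1"
    unfolding V_def using zero_le_power2[of "cmod c"] by linarith+
  have l: "cmod c \<le> 1" using lv(1) by (simp add: abs_square_le_1)
  have ny: "(norm y)\<^sup>2 = (cmod a)\<^sup>2 + (h / 16) * V"
    unfolding y norm_sq_unit_decomposition[OF u(1)] using h
    by (simp add: norm_divide power_divide real_sqrt_pow2 V_def c_def)
  have nl: "cmod (of_real (h / 4) * c) \<le> h / 4"
    using mult_left_mono[OF l, of "h / 4"] h by (simp add: norm_mult)
  have a1: "cmod a \<le> norm w + h / 4" unfolding a_def
    using norm_triangle_ineq[of "of_real (norm w)" "of_real (h / 4) * c"] nl by simp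
  have a2: "norm w - h / 4 \<le> cmod a" unfolding a_def
    using norm_triangle_ineq2[of "of_real (norm w)" "- (of_real (h / 4) * c)"] nl by simp
  have wh: "norm w = 1 - h" by (simp add: h_def)
  have hh: "h * h \<le> h" using h mult_left_mono[of h 1 h] by simp
  have "(cmod a)\<^sup>2 \<le> (1 - 3 / 4 * h)\<^sup>2" using a1 wh h by (intro power_mono) auto
  also have "\<dots> = 1 - 3 / 2 * h + 9 / 16 * (h * h)" by (simp add: power2_eq_square algebra_simps)
  finally have a3: "(cmod a)\<^sup>2 \<le> 1 - 3 / 2 * h + 9 / 16 * h" using hh by linarith
  have "h / 16 * V \<le> h / 16" using mult_left_mono[OF lv(2), of "h / 16"] h by simp
  thus "3 / 8 * h \<le> 1 - (norm y)\<^sup>2" unfolding ny using a3 h by linarith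
  have "1 - 5 / 2 * h \<le> (cmod a)\<^sup>2"
  \<comment> \<open>If 1 - 5h/4 is negative, squaring is not monotone, but then 1 - 5h/2 is negative
    as well.\<close>
  proof (cases "1 - 5 / 4 * h \<ge> 0")
    case True
    have "(1 - 5 / 4 * h)\<^sup>2 \<le> (cmod a)\<^sup>2" using a2 wh True by (intro power_mono) auto
    moreover have "(1 - 5 / 4 * h)\<^sup>2 = 1 - 5 / 2 * h + (5 / 4 * h)\<^sup>2" by (simp add: power2_eq_square algebra_simps)
    ultimately show ?thesis using zero_le_power2[of "5 / 4 * h"] by linarith
  next
    case False
    thus ?thesis using zero_le_power2[of "cmod a"] h by linarith
  qed
  moreover have "0 \<le> h / 16 * V" using h V0 by simp
  ultimately show "1 - (norm y)\<^sup>2 \<le> 5 / 2 * h" unfolding ny by linarith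
qed

section \<open>Growth of Besov functions\<close>

lemma unit_ball_volume:
  "emeasure lborel (unit_ball :: (complex ^ 'n) set) = ennreal (measure lborel (unit_ball :: (complex ^ 'n) set))"
  "0 < measure lborel (unit_ball :: (complex ^ 'n) set)"
proof -
  show "emeasure lborel (unit_ball :: (complex ^ 'n) set) = ennreal (measure lborel (unit_ball :: (complex ^ 'n) set))"
    by (rule emeasure_eq_ennreal_measure) (use emeasure_lborel_ball_finite[of "0 :: complex ^ 'n" 1] in simp)
  show "0 < measure lborel (unit_ball :: (complex ^ 'n) set)"
    by (rule content_ball_pos) simp
qed

definition invariant_density :: "complex ^ 'n \<Rightarrow> real" where
  "invariant_density z = (1 - (norm z)\<^sup>2) powr (- real CARD('n) - 1)"

lemma invariant_density_measurable [measurable]: "invariant_density \<in> borel_measurable borel"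
  unfolding invariant_density_def by measurable

lemma nn_integral_invariant_measure:
  fixes H :: "complex ^ 'n \<Rightarrow> ennreal"
  assumes H: "(\<lambda>y. indicator unit_ball y * H y) \<in> borel_measurable borel"
  shows "(\<integral>\<^sup>+y. H y \<partial>invariant_measure) = ennreal (1 / measure lborel (unit_ball :: (complex ^ 'n) set)) *
    (\<integral>\<^sup>+y. indicator unit_ball y * H y * ennreal (invariant_density y) \<partial>lborel)"
proof -
  have Hr: "H \<in> borel_measurable (restrict_space lborel unit_ball)"
    using H by (subst borel_measurable_restrict_space_iff_ennreal) (auto simp: mult.commute)
  have dr: "(\<lambda>z. ennreal (invariant_density z)) \<in> borel_measurable (restrict_space lborel unit_ball)"
    by (intro measurable_restrict_space1) measurable
  have meas: "borel_measurable (ball_volume :: (complex ^ 'n) measure) = (borel_measurable (restrict_space lborel unit_ball)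
      :: (complex ^ 'n \<Rightarrow> ennreal) set)"
    unfolding ball_volume_def by (rule measurable_cong_sets) simp_all
  have "(\<integral>\<^sup>+y. H y \<partial>invariant_measure) = (\<integral>\<^sup>+y. ennreal (invariant_density y) * H y \<partial>ball_volume)"
    unfolding invariant_measure_def invariant_density_def[symmetric]
    by (rule nn_integral_density) (simp_all only: meas Hr dr)
  also have "\<dots> = (1 / emeasure lborel (unit_ball :: (complex ^ 'n) set)) *
      (\<integral>\<^sup>+y. ennreal (invariant_density y) * H y \<partial>restrict_space lborel unit_ball)"
    unfolding ball_volume_def by (intro nn_integral_scale_measure borel_measurable_times_ennreal Hr dr)
  also have "1 / emeasure lborel (unit_ball :: (complex ^ 'n) set) = ennreal (1 / measure lborel (unit_ball :: (complex ^ 'n) set))"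
    unfolding unit_ball_volume(1) using unit_ball_volume(2)[where 'n = 'n] by (simp add: divide_ennreal flip: ennreal_1)
  also have "(\<integral>\<^sup>+y. ennreal (invariant_density y) * H y \<partial>restrict_space lborel unit_ball) =
     (\<integral>\<^sup>+y. indicator unit_ball y * H y * ennreal (invariant_density y) \<partial>lborel)"
    by (subst nn_integral_restrict_space) (auto intro!: nn_integral_cong simp: mult_ac)
  finally show ?thesis .
qed

text \<open>If x > 1/lam, then (lam x)^(p-1) is at least 1. The bound is linear in x^p, so it can be
  integrated term by term; choosing \<open>lam\<close> at the end recovers the effect of Hoelder's
  inequality.\<close>

lemma young_parameter:
  fixes x lam p :: real
  assumes "0 \<le> x" "0 < lam" "1 \<le> p"
  shows "x \<le> lam powr (p - 1) * x powr p + 1 / lam"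
proof (cases "x \<le> 1 / lam")
  case True
  moreover have "0 \<le> lam powr (p - 1) * x powr p" by simp
  ultimately show ?thesis by linarith
next
  case False
  have "0 < 1 / lam" using assms by simp
  hence "0 < x" using False by linarith
  hence x: "0 < x" "1 \<le> lam * x" using False assms by (auto simp: field_simps)
  have "x * 1 \<le> x * (lam * x) powr (p - 1)"
    using x assms by (intro mult_left_mono ge_one_powr_ge_zero) auto
  also have "\<dots> = lam powr (p - 1) * (x powr 1 * x powr (p - 1))" using x assms by (simp add: powr_mult)
  also have "x powr 1 * x powr (p - 1) = x powr p" using powr_add[of x 1 "p - 1"] by simp
  finally show ?thesis using assms by (simp add: add_increasing2)
qed

section \<open>Logarithmic integrals in one real variable\<close>

lemma log_weight_ge_ln2:
  assumes "0 \<le> x" "x < 1" shows "ln 2 \<le> ln (2 / (1 - x\<^sup>2 :: real))"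
  using one_minus_sq_bounds[OF assms] by (subst ln_le_cancel_iff) (auto simp: field_simps)

text \<open>Serves to absorb additive constants into a power of the logarithm; as ln 2 < 1, an
  exponent in [0, 1] only increases it.\<close>

lemma ln2_le_log_powr:
  fixes L e :: real
  assumes "ln 2 \<le> L" "0 \<le> e" "e \<le> 1" shows "ln 2 \<le> L powr e"
proof -
  have "ln 2 = (ln 2 :: real) powr 1" by simp
  also have "\<dots> \<le> ln 2 powr e" using assms ln_2_less_1 by (intro powr_mono') auto
  also have "\<dots> \<le> L powr e" using assms by (intro powr_mono2) auto
  finally show ?thesis .
qed

text \<open>The antiderivative carries a factor 1/\<rho>, so for \<rho> < 1/2 the integrand is
  bounded by 2 instead. The constant adds up the two cases.\<close>

lemma nn_integral_inverse_le_log: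
  fixes \<rho> :: real assumes \<rho>: "0 \<le> \<rho>" "\<rho> < 1"
  shows "(\<integral>\<^sup>+t. indicator {0..1} t * ennreal (1 / (1 - t * \<rho>)) \<partial>lborel) \<le> ennreal ((2 + 2 / ln 2) * ln (2 / (1 - \<rho>\<^sup>2)))"
proof -
  let ?L = "ln (2 / (1 - \<rho>\<^sup>2))"
  let ?f = "\<lambda>t. ennreal (1 / (1 - t * \<rho>)) * indicator {0..1} t"
  have L: "ln 2 \<le> ?L" by (rule log_weight_ge_ln2[OF \<rho>])
  have L0: "0 < ?L" using L ln_gt_zero[of "2::real"] by linarith
  have pos: "1 - t * \<rho> > 0" if "t \<in> {0..1}" for t
    using that \<rho> mult_left_le_one_le[of \<rho> t] by auto
  have "(\<integral>\<^sup>+t. indicator {0..1} t * ennreal (1 / (1 - t * \<rho>)) \<partial>lborel) =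
      (\<integral>\<^sup>+t. ?f t \<partial>lborel)" by (simp add: mult.commute)
  also have "\<dots> \<le> ennreal ((2 + 2 / ln 2) * ?L)"
  proof (cases "\<rho> < 1 / 2")
    case True
    have "(\<integral>\<^sup>+t. ?f t \<partial>lborel) \<le>
        (\<integral>\<^sup>+t. ennreal 2 * indicator {0..1} (t :: real) \<partial>lborel)"
    proof (rule nn_integral_mono)
      fix t :: real
      have "1 / (1 - t * \<rho>) \<le> 2" if "t \<in> {0..1}"
        using pos[OF that] that True \<rho> mult_left_le_one_le[of \<rho> t] by (simp add: divide_le_eq)
      thus "?f t \<le> ennreal 2 * indicator {0..1} t"
        by (auto split: split_indicator intro!: ennreal_leI simp del: ennreal_numeral)
    qed
    also have "\<dots> = ennreal 2" by (subst nn_integral_cmult) auto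
    also have "2 = 2 / ln 2 * ln (2 :: real)" by simp
    also have "2 / ln 2 * ln 2 \<le> 2 / ln 2 * ?L" by (rule mult_left_mono[OF L]) simp
    also have "\<dots> \<le> (2 + 2 / ln 2) * ?L" using L0 by (intro mult_right_mono) auto
    finally show ?thesis by (simp add: ennreal_leI)
  next
    case False
    have "(\<integral>\<^sup>+t. ?f t \<partial>lborel) =
        ennreal (- ln (1 - 1 * \<rho>) / \<rho> - - ln (1 - 0 * \<rho>) / \<rho>)"
    proof (rule nn_integral_FTC_Icc)
      fix t :: real assume t: "t \<in> {0..1}"
      show "((\<lambda>t. - ln (1 - t * \<rho>) / \<rho>) has_real_derivative 1 / (1 - t * \<rho>)) (at t)"
        using pos[OF t] False by (auto intro!: derivative_eq_intros simp: field_simps)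
      show "0 \<le> 1 / (1 - t * \<rho>)" using pos[OF t] by simp
    qed (use \<rho> in auto)
    also have "\<dots> = ennreal (ln (1 / (1 - \<rho>)) / \<rho>)" using \<rho> by (simp add: ln_div)
    also have "\<dots> \<le> ennreal (2 * ?L)"
    proof (rule ennreal_leI)
      have "1 - \<rho>\<^sup>2 \<le> 2 * (1 - \<rho>)" "0 < 1 - \<rho>\<^sup>2" using one_minus_sq_bounds[OF \<rho>] by auto
      hence "1 / (1 - \<rho>) \<le> 2 / (1 - \<rho>\<^sup>2)" using \<rho> by (simp add: field_simps)
      hence l: "ln (1 / (1 - \<rho>)) \<le> ?L" using \<rho> \<open>0 < 1 - \<rho>\<^sup>2\<close> by (subst ln_le_cancel_iff) auto
      have "ln (1 / (1 - \<rho>)) / \<rho> \<le> ?L / \<rho>" using l \<rho> by (intro divide_right_mono) auto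
      also have "\<dots> \<le> ?L / (1 / 2)" using False L0 by (intro divide_left_mono) auto
      finally show "ln (1 / (1 - \<rho>)) / \<rho> \<le> 2 * ?L" by simp
    qed
    also have "\<dots> \<le> ennreal ((2 + 2 / ln 2) * ?L)" using L0 by (intro ennreal_leI mult_right_mono) auto
    finally show ?thesis .
  qed
  finally show ?thesis .
qed

text \<open>A point of defect Y lies in the shell of \<open>t\<close> only if 1 - t\<rho> is between
  2Y/5 and 8Y/3. For \<rho> \<ge> 1/2 these \<open>t\<close> fill an interval of length at most 34 Y
  / (15 \<rho>), with integrand at most 5 / (2Y); the product is 17 / (3\<rho>) \<le> 34/3 <
  12.\<close>

lemma nn_integral_shell_multiplicity:
  fixes \<rho> Y :: real assumes \<rho>: "0 \<le> \<rho>" "\<rho> < 1" and Y: "0 < Y"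
  shows "(\<integral>\<^sup>+t. indicator {0..1} t * (indicator {t. 3 / 8 * (1 - t * \<rho>) \<le> Y \<and> Y \<le> 5 / 2 * (1 - t * \<rho>)} t *
     ennreal (1 / (1 - t * \<rho>))) \<partial>lborel) \<le> 12"
    (is "(\<integral>\<^sup>+t. ?f t \<partial>lborel) \<le> 12")
proof (cases "\<rho> < 1 / 2")
  case True
  have "(\<integral>\<^sup>+t. ?f t \<partial>lborel) \<le> (\<integral>\<^sup>+t. ennreal 2 * indicator {0..1} (t :: real) \<partial>lborel)"
  proof (rule nn_integral_mono)
    fix t :: real
    have "1 / (1 - t * \<rho>) \<le> 2" if "t \<in> {0..1}"
      using that True \<rho> mult_left_le_one_le[of \<rho> t] by (simp add: divide_le_eq)
    thus "?f t \<le> ennreal 2 * indicator {0..1} t"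
      by (auto split: split_indicator intro!: ennreal_leI simp del: ennreal_numeral)
  qed
  also have "\<dots> = ennreal 2" by (subst nn_integral_cmult) auto
  also have "\<dots> \<le> 12" by simp
  finally show ?thesis .
next
  case False
  let ?I = "{(1 - 8 / 3 * Y) / \<rho>..(1 - 2 / 5 * Y) / \<rho>}"
  have "(\<integral>\<^sup>+t. ?f t \<partial>lborel) \<le> (\<integral>\<^sup>+t. ennreal (5 / 2 / Y) * indicator ?I t \<partial>lborel)"
  proof (rule nn_integral_mono)
    fix t :: real
    have "1 / (1 - t * \<rho>) \<le> 5 / 2 / Y \<and> t \<in> ?I"
      if t: "3 / 8 * (1 - t * \<rho>) \<le> Y" "Y \<le> 5 / 2 * (1 - t * \<rho>)"
    proof
      have "0 < 1 - t * \<rho>" using less_le_trans[OF Y t(2)] by simp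
      thus "1 / (1 - t * \<rho>) \<le> 5 / 2 / Y" using t Y by (simp add: field_simps)
      show "t \<in> ?I" using t Y False by (simp add: field_simps)
    qed
    thus "?f t \<le> ennreal (5 / 2 / Y) * indicator ?I t"
      by (auto split: split_indicator intro!: ennreal_leI)
  qed
  also have "\<dots> = ennreal (5 / 2 / Y) * ennreal ((1 - 2 / 5 * Y) / \<rho> - (1 - 8 / 3 * Y) / \<rho>)"
    using False Y by (subst nn_integral_cmult) (auto simp: divide_right_mono)
  also have "\<dots> = ennreal (5 / 2 / Y * ((1 - 2 / 5 * Y) / \<rho> - (1 - 8 / 3 * Y) / \<rho>))"
    using Y by (subst ennreal_mult'[symmetric]) auto
  also have "5 / 2 / Y * ((1 - 2 / 5 * Y) / \<rho> - (1 - 8 / 3 * Y) / \<rho>) = 17 / 3 / \<rho>"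
    using Y False by (simp add: field_simps)
  also have "\<dots> \<le> 12" using False by (simp add: field_simps)
  finally show ?thesis by (simp add: ennreal_leI)
qed

text \<open>The p-th power of a Besov seminorm restricted to \<open>S\<close>, against Lebesgue
  measure; the normalising volume of the ball is left out and returns in
  \<open>shell_mass_le\<close>.\<close>

definition shell_mass :: "real \<Rightarrow> nat \<Rightarrow> (complex ^ 'n \<Rightarrow> complex) \<Rightarrow> (complex ^ 'n) set \<Rightarrow> ennreal" where
  "shell_mass p N g S = (\<integral>\<^sup>+y. indicator S y * (indicator unit_ball y *
      ennreal (((1 - (norm y)\<^sup>2) ^ N * cmod (g y)) powr p * invariant_density y)) \<partial>lborel)"

lemma weighted_power_measurable:
  fixes g :: "complex ^ 'n \<Rightarrow> complex"
  assumes g: "holomorphic_on_ball g" and \<delta> [measurable]: "\<delta> \<in> borel_measurable borel"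
  shows "(\<lambda>y. indicator unit_ball y * ennreal (((1 - (norm y)\<^sup>2) ^ N * cmod (g y)) powr p * \<delta> y))
     \<in> borel_measurable borel"
proof -
  have [measurable]: "(\<lambda>y. indicator unit_ball y *\<^sub>R cmod (g y)) \<in> borel_measurable borel"
    by (rule borel_measurable_continuous_on_indicator)
       (auto intro!: continuous_intros holomorphic_on_ball_imp_continuous_on g)
  have [measurable]: "unit_ball \<in> sets (borel :: (complex ^ 'n) measure)" by simp
  have "(\<lambda>y. indicator unit_ball y * ennreal (((1 - (norm y)\<^sup>2) ^ N * (indicator unit_ball y *\<^sub>R cmod (g y))) powr p * \<delta> y))
     \<in> borel_measurable borel" by measurable
  also have "(\<lambda>y. indicator unit_ball y * ennreal (((1 - (norm y)\<^sup>2) ^ N * (indicator unit_ball y *\<^sub>R cmod (g y))) powr p * \<delta> y)) =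
     (\<lambda>y. indicator unit_ball y * ennreal (((1 - (norm y)\<^sup>2) ^ N * cmod (g y)) powr p * \<delta> y))"
    by (auto simp: fun_eq_iff split: split_indicator)
  finally show ?thesis .
qed

text \<open>The constants come from \<open>nonisotropic_ball_shell\<close>: (8/3)^N trades
  \<open>h\<close> for the defect under the integral, (5/2)^(n+1) does so in the invariant density,
  and 16^n / h^(n+1) is the inverse Jacobian for the radii h/4 and sqrt(h)/4. Its power of
  \<open>h\<close> cancels against the density.\<close>

lemma pointwise_estimate:
  fixes g :: "complex ^ 'n \<Rightarrow> complex"
  assumes g: "holomorphic_on_ball g" and w: "norm w < 1" and p: "1 \<le> p" and lam: "0 < lam"
  defines "h \<equiv> 1 - norm w" and "v \<equiv> measure lborel (unit_ball :: (complex ^ 'n) set)"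
  shows "ennreal (h ^ N * cmod (g w)) \<le>
    ennreal ((8 / 3) ^ N * (16 ^ CARD('n) * (5 / 2) ^ (CARD('n) + 1)) / v * lam powr (p - 1)) *
       shell_mass p N g {y. 3 / 8 * h \<le> 1 - (norm y)\<^sup>2 \<and> 1 - (norm y)\<^sup>2 \<le> 5 / 2 * h} +
    ennreal ((8 / 3) ^ N / lam)"
proof -
  let ?n = "CARD('n)"
  let ?S = "{y :: complex ^ 'n. 3 / 8 * h \<le> 1 - (norm y)\<^sup>2 \<and> 1 - (norm y)\<^sup>2 \<le> 5 / 2 * h}"
  define X where "X y = (1 - (norm y)\<^sup>2) ^ N * cmod (g y)" for y :: "complex ^ 'n"
  have h: "0 < h" "h \<le> 1" using w by (auto simp: h_def)
  let ?C = "16 ^ ?n * (5 / 2) ^ (?n + 1) :: real"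
  have v: "0 < v" and em: "emeasure lborel (unit_ball :: (complex ^ 'n) set) = ennreal v"
    unfolding v_def by (rule unit_ball_volume)+
  obtain u :: "complex ^ 'n" where u: "norm u = 1" "w = of_real (norm w) *s u"
  proof (cases "w = 0")
    case True
    thus ?thesis using that[of "axis undefined 1"] by simp
  next
    case False
    thus ?thesis using that[of "of_real (1 / norm w) *s w"]
      by (simp add: norm_cmult norm_divide vec_eq_iff)
  qed
  let ?a = "h / 4" and ?b = "sqrt h / 4"
  let ?T = "nonisotropic u ?a ?b"
  have shell: "w + ?T x \<in> ?S" if "norm x < 1" for x
    using nonisotropic_ball_shell[OF w u that] unfolding h_def by auto
  have inball: "norm y < 1" if "y \<in> ?S" for y
  proof -
    have "0 < 1 - (norm y)\<^sup>2" using that h by auto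
    thus ?thesis by (simp add: abs_square_less_1)
  qed
  let ?B = "\<lambda>x :: complex ^ 'n. indicator unit_ball x :: ennreal"
  have Sm [measurable]: "?S \<in> sets borel"
    by (intro borel_measurable_pred_less borel_closed closed_Collect_conj closed_Collect_le continuous_intros)
  have Bm [measurable]: "unit_ball \<in> sets (borel :: (complex ^ 'n) measure)" by simp
  \<comment> \<open>\<open>F\<close> is cut off to the shell, which contains the nonisotropic ball.
    The enlarged region depends on |w| alone, so a later integration along a ray meets a
    one-dimensional condition.\<close>
  define F where "F y = indicator ?S y * (?B y * ennreal (X y powr p))" for y
  let ?J = "\<integral>\<^sup>+x. F (w + ?T x) \<partial>lborel" and ?m = "shell_mass p N g ?S"
  have [measurable]: "(\<lambda>y. ?B y * ennreal (X y powr p)) \<in> borel_measurable borel"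
    using weighted_power_measurable[OF g, of "\<lambda>_. 1" N p] by (simp add: X_def)
  have Fm [measurable]: "F \<in> borel_measurable borel" unfolding F_def by measurable
  have FT: "?B x * ennreal (X (w + ?T x) powr p) = ?B x * F (w + ?T x)" for x
    using shell[of x] inball[of "w + ?T x"] by (auto simp: F_def split: split_indicator)
  have "(\<integral>\<^sup>+y. F y \<partial>lborel) = (\<integral>\<^sup>+y. F (w + y) \<partial>lborel)"
    by (rule nn_integral_lborel_shift[symmetric]) measurable
  also have "\<dots> = ennreal (?a\<^sup>2 * (?b\<^sup>2) ^ (?n - 1)) * ?J"
    by (rule nn_integral_nonisotropic) (use h u in auto)
  also have "?a\<^sup>2 * (?b\<^sup>2) ^ (?n - 1) = h ^ (?n + 1) / 16 ^ ?n"
  proof -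
    obtain m where m: "?n = Suc m" using zero_less_card_finite[where 'a = 'n] gr0_conv_Suc by blast
    show ?thesis using h unfolding m by (simp add: power_divide power2_eq_square)
  qed
  finally have cov: "(\<integral>\<^sup>+y. F y \<partial>lborel) = ennreal (h ^ (?n + 1) / 16 ^ ?n) * ?J" .
  have "(\<integral>\<^sup>+y. F y \<partial>lborel) \<le> (\<integral>\<^sup>+y. ennreal ((5 / 2 * h) ^ (?n + 1)) *
      (indicator ?S y * (?B y * ennreal (X y powr p * invariant_density y))) \<partial>lborel)"
  proof (rule nn_integral_mono)
    fix y :: "complex ^ 'n"
    show "F y \<le> ennreal ((5 / 2 * h) ^ (?n + 1)) * (indicator ?S y * (?B y * ennreal (X y powr p * invariant_density y)))"
    proof (cases "y \<in> ?S")
      case True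
      let ?Y = "1 - (norm y)\<^sup>2"
      have Y: "0 < ?Y" "?Y \<le> 5 / 2 * h" using True h by auto
      \<comment> \<open>The invariant density is the defect to the power -(n + 1), so the product is
        1.\<close>
      have "?Y ^ (?n + 1) * invariant_density y = ?Y powr real (?n + 1) * ?Y powr (- real ?n - 1)"
        unfolding invariant_density_def using Y by (subst powr_realpow) auto
      also have "\<dots> = 1" using Y by (simp flip: powr_add)
      finally have "1 = ?Y ^ (?n + 1) * invariant_density y" ..
      also have "\<dots> \<le> (5 / 2 * h) ^ (?n + 1) * invariant_density y"
        using Y by (intro mult_right_mono power_mono) (auto simp: invariant_density_def)
      finally have "X y powr p * 1 \<le> X y powr p * ((5 / 2 * h) ^ (?n + 1) * invariant_density y)"
        by (intro mult_left_mono) auto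
      hence "ennreal (X y powr p) \<le> ennreal ((5 / 2 * h) ^ (?n + 1) * (X y powr p * invariant_density y))"
        by (intro ennreal_leI) (simp add: mult_ac)
      also have "\<dots> = ennreal ((5 / 2 * h) ^ (?n + 1)) * ennreal (X y powr p * invariant_density y)"
        using h by (intro ennreal_mult) (auto simp: invariant_density_def)
      finally show ?thesis using True inball[OF True] by (simp add: F_def)
    qed (simp add: F_def)
  qed
  also have "\<dots> = ennreal ((5 / 2 * h) ^ (?n + 1)) * ?m"
    unfolding shell_mass_def X_def
    by (rule nn_integral_cmult) (use weighted_power_measurable[OF g, of invariant_density N p] in measurable)
  finally have "ennreal (h ^ (?n + 1) / 16 ^ ?n) * ?J \<le>
     ennreal ((5 / 2 * h) ^ (?n + 1)) * ?m" unfolding cov .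
  hence "ennreal (16 ^ ?n / h ^ (?n + 1)) * (ennreal (h ^ (?n + 1) / 16 ^ ?n) * ?J) \<le>
     ennreal (16 ^ ?n / h ^ (?n + 1)) * (ennreal ((5 / 2 * h) ^ (?n + 1)) * ?m)"
    by (rule mult_left_mono) simp
  also have "\<dots> = ennreal (16 ^ ?n / h ^ (?n + 1) * (5 / 2 * h) ^ (?n + 1)) * ?m"
    using h by (subst ennreal_mult) (auto simp: mult.assoc)
  also have "16 ^ ?n / h ^ (?n + 1) * (5 / 2 * h) ^ (?n + 1) = ?C"
    using h by (simp add: power_mult_distrib power_divide)
  also have "ennreal (16 ^ ?n / h ^ (?n + 1)) * (ennreal (h ^ (?n + 1) / 16 ^ ?n) * ?J) =
     ?J"
    using h by (subst mult.assoc[symmetric], subst ennreal_mult[symmetric]) auto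
  finally have Fint: "?J \<le> ennreal (?C) * ?m" .
  have "ennreal (cmod (g w)) * emeasure lborel (unit_ball :: (complex ^ 'n) set) \<le>
      (\<integral>\<^sup>+x. ?B x * ennreal (cmod (g (w + ?T x))) \<partial>lborel)"
    by (rule holomorphic_submean_ball[OF g]) (use shell inball in blast)
  also have "\<dots> \<le> (\<integral>\<^sup>+x. ennreal ((8 / (3 * h)) ^ N) * (ennreal (lam powr (p - 1)) * F (w + ?T x) + ennreal (1 / lam) * ?B x) \<partial>lborel)"
  proof (rule nn_integral_mono)
    fix x :: "complex ^ 'n"
    show "?B x * ennreal (cmod (g (w + ?T x))) \<le>
      ennreal ((8 / (3 * h)) ^ N) * (ennreal (lam powr (p - 1)) * F (w + ?T x) + ennreal (1 / lam) * ?B x)"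
    proof (cases "norm x < 1")
      case True
      let ?y = "w + ?T x"
      have y: "3 / 8 * h \<le> 1 - (norm ?y)\<^sup>2" using shell[OF True] by simp
      have "1 \<le> (8 / (3 * h) * (1 - (norm ?y)\<^sup>2)) ^ N"
        using y h by (intro one_le_power) (simp add: field_simps)
      hence "cmod (g ?y) * 1 \<le> cmod (g ?y) * (8 / (3 * h) * (1 - (norm ?y)\<^sup>2)) ^ N"
        by (intro mult_left_mono) auto
      also have "\<dots> = (8 / (3 * h)) ^ N * X ?y" unfolding X_def power_mult_distrib[of "8 / (3 * h)"] by (simp only: mult_ac)
      also have "\<dots> \<le> (8 / (3 * h)) ^ N * (lam powr (p - 1) * X ?y powr p + 1 / lam)"
      proof (intro mult_left_mono young_parameter lam p)
        show "0 \<le> X ?y" unfolding X_def using y h by (intro mult_nonneg_nonneg zero_le_power) auto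
        show "0 \<le> (8 / (3 * h)) ^ N" using h by simp
      qed
      finally have "ennreal (cmod (g ?y)) \<le> ennreal ((8 / (3 * h)) ^ N * (lam powr (p - 1) * X ?y powr p + 1 / lam))"
        by (simp add: ennreal_leI)
      also have "\<dots> = ennreal ((8 / (3 * h)) ^ N) * (ennreal (lam powr (p - 1)) * ennreal (X ?y powr p) + ennreal (1 / lam))"
        using h lam by (simp add: ennreal_mult ennreal_plus)
      finally show ?thesis using True shell[OF True] inball[OF shell[OF True]] by (simp add: F_def)
    qed simp
  qed
  also have "\<dots> = ennreal ((8 / (3 * h)) ^ N) * (ennreal (lam powr (p - 1)) * ?J + ennreal (1 / lam) * ennreal v)"
    by (simp add: nn_integral_cmult nn_integral_add em)
  also have "\<dots> \<le> ennreal ((8 / (3 * h)) ^ N) * (ennreal (lam powr (p - 1)) * 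
      (ennreal (?C) * ?m) + ennreal (1 / lam) * ennreal v)"
    by (intro mult_left_mono add_right_mono Fint) auto
  finally have fin: "ennreal (cmod (g w)) * ennreal v \<le> \<dots>" unfolding em .
  define A where "A = h ^ N / v"
  define B where "B = (8 / (3 * h)) ^ N"
  define C where "C = lam powr (p - 1)"
  define D :: real where "D = ?C"
  have nn: "0 \<le> A" "0 \<le> B" "0 \<le> C" "0 \<le> D" using h v by (auto simp: A_def B_def C_def D_def)
  obtain L where L: "0 \<le> L" "L = 1 / lam" using lam by auto
  have ring: "a * (b * (c * (d * M) + e * f)) = (a * b * c * d) * M + a * b * e * f" for a b c d e f M :: ennreal
    by (simp add: algebra_simps)
  have "ennreal A * (ennreal (cmod (g w)) * ennreal v) \<le> ennreal A * (ennreal B * (ennreal C * 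
      (ennreal D * ?m) + ennreal (1 / lam) * ennreal v))"
    using fin unfolding A_def B_def C_def D_def by (rule mult_left_mono) simp
  also have "ennreal A * (ennreal (cmod (g w)) * ennreal v) = ennreal (A * (cmod (g w) * v))"
    using nn v by (simp add: ennreal_mult)
  also have "A * (cmod (g w) * v) = h ^ N * cmod (g w)" using v by (simp add: A_def)
  also have "ennreal A * (ennreal B * (ennreal C * (ennreal D * ?m) + ennreal (1 / lam) * ennreal v)) =
      ennreal (A * B * C * D) * ?m + ennreal (A * B * (1 / lam) * v)"
    unfolding ring using nn v L(1) unfolding L(2)[symmetric] by (simp add: ennreal_mult)
  also have "A * B * C * D = (8 / 3) ^ N * (?C) / v * lam powr (p - 1)"
    using h by (simp add: A_def B_def C_def D_def power_divide power_mult_distrib mult_ac)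
  also have "A * B * (1 / lam) * v = (8 / 3) ^ N / lam"
    using h v by (simp add: A_def B_def power_divide power_mult_distrib)
  finally show ?thesis .
qed

lemma indicator_weighted_power:
  "indicator unit_ball y * ennreal (cmod (of_real ((1 - (norm y)\<^sup>2) ^ N) * g y) powr p) =
    indicator unit_ball y * ennreal (((1 - (norm y)\<^sup>2) ^ N * cmod (g y)) powr p * 1)"
proof -
  have "0 \<le> 1 - (norm y)\<^sup>2" if "norm y < 1" using one_minus_sq_bounds(3)[of "norm y"] that by simp
  thus ?thesis unfolding norm_mult norm_of_real by (auto split: split_indicator)
qed

text \<open>Finiteness of the integral is settled first, because only then does
  \<open>ennreal_powr\<close> reduce to a real power that can be undone.\<close>

lemma shell_mass_le:
  fixes g :: "complex ^ 'n \<Rightarrow> complex"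
  assumes g: "holomorphic_on_ball g" and p: "0 < p" and E: "0 \<le> E" 
    and le: "Lp_norm p invariant_measure (\<lambda>z. of_real ((1 - (norm z)\<^sup>2) ^ N) * g z) \<le> ennreal E"
  shows "shell_mass p N g UNIV \<le> ennreal (measure lborel (unit_ball :: (complex ^ 'n) set) * E powr p)"
proof -
  let ?v = "measure lborel (unit_ball :: (complex ^ 'n) set)"
  let ?I = "\<integral>\<^sup>+x. ennreal (cmod (of_real ((1 - (norm x)\<^sup>2) ^ N) * g x) powr p) \<partial>invariant_measure"
  let ?u = "\<lambda>y. ennreal (cmod (of_real ((1 - (norm y)\<^sup>2) ^ N) * g y) powr p)"
  have v: "0 < ?v" by (rule unit_ball_volume)
  note eq = indicator_weighted_power[of _ N g p]
  have "?I = ennreal (1 / ?v) * (\<integral>\<^sup>+y. indicator unit_ball y *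
      ?u y * ennreal (invariant_density y) \<partial>lborel)"
    by (rule nn_integral_invariant_measure, unfold eq, rule weighted_power_measurable[OF g]) simp
  also have "(\<integral>\<^sup>+y. indicator unit_ball y * ?u y *
      ennreal (invariant_density y) \<partial>lborel) = shell_mass p N g UNIV"
    unfolding shell_mass_def eq
    by (rule nn_integral_cong) (simp add: ennreal_mult invariant_density_def mult.assoc)
  finally have "?I = ennreal (1 / ?v) * shell_mass p N g UNIV" .
  hence *: "shell_mass p N g UNIV = ennreal ?v * ?I"
    using v by (simp only: mult.assoc[symmetric] ennreal_mult'[symmetric]) simp
  have "?I \<noteq> top" using le unfolding Lp_norm_def ennreal_powr_def by (auto simp: top_unique split: if_splits)
  hence I: "ennreal (enn2real ?I) = ?I" by (intro ennreal_enn2real) (simp only: less_top)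
  have "enn2real ?I powr (1 / p) \<le> E"
    using le E \<open>?I \<noteq> top\<close> unfolding Lp_norm_def ennreal_powr_def by simp
  hence "(enn2real ?I powr (1 / p)) powr p \<le> E powr p" using p by (intro powr_mono2) auto
  hence "enn2real ?I \<le> E powr p" using p by (simp add: powr_powr)
  hence "ennreal (enn2real ?I) \<le> ennreal (E powr p)" by (rule ennreal_leI)
  hence "?I \<le> ennreal (E powr p)" unfolding I .
  hence "ennreal ?v * ?I \<le> ennreal ?v * ennreal (E powr p)" by (rule mult_left_mono) simp
  thus ?thesis unfolding * using v by (simp only: ennreal_mult'[symmetric])
qed

text \<open>With h(t) = 1 - t|z|, the Taylor weight (1 - t)^(N-1) is at most h(t)^(N-1). This leaves
  h(t)^N |g(tz)| for the pointwise estimate and the measure dt / h(t), whose mass is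
  logarithmic.\<close>

lemma radial_integral_bound:
  fixes g :: "complex ^ 'n \<Rightarrow> complex"
  assumes g: "holomorphic_on_ball g" and z: "norm z < 1" and p: "1 \<le> p" and lam: "0 < lam" and N: "0 < N"
  defines "A \<equiv> (8 / 3) ^ N * (16 ^ CARD('n) * (5 / 2) ^ (CARD('n) + 1)) / measure lborel (unit_ball :: (complex ^ 'n) set)"
  shows "(\<integral>\<^sup>+t. indicator {0..1} t * ennreal ((1 - t) ^ (N - 1) * cmod (g (t *\<^sub>R z))) \<partial>lborel) \<le>
    ennreal (A * lam powr (p - 1)) * (12 * shell_mass p N g UNIV) +
    ennreal ((8 / 3) ^ N / lam) * ennreal ((2 + 2 / ln 2) * ln (2 / (1 - (norm z)\<^sup>2)))"
proof -
  let ?r = "norm z"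
  let ?h = "\<lambda>t. 1 - t * ?r"
  let ?S = "\<lambda>t. {y :: complex ^ 'n. 3 / 8 * ?h t \<le> 1 - (norm y)\<^sup>2 \<and> 1 - (norm y)\<^sup>2 \<le> 5 / 2 * ?h t}"
  let ?I = "indicator {0..1} :: real \<Rightarrow> ennreal"
  define W where "W = (\<lambda>y. indicator unit_ball y *
      ennreal (((1 - (norm y)\<^sup>2) ^ N * cmod (g y)) powr p * invariant_density y))"
  have [measurable]: "W \<in> borel_measurable borel"
    unfolding W_def by (rule weighted_power_measurable[OF g]) measurable
  have A: "0 \<le> A" unfolding A_def by simp
  let ?Q = "\<lambda>t. ennreal (1 / ?h t) * (\<integral>\<^sup>+y. indicator (?S t) y * W y \<partial>lborel)"
  have h: "0 < ?h t" "1 - t \<le> ?h t" "norm (t *\<^sub>R z) < 1" "1 - norm (t *\<^sub>R z) = ?h t" if "t \<in> {0..1}" for t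
  proof -
    have "t * ?r \<le> ?r" "t * ?r \<le> t" using that z by (auto simp: mult_left_le_one_le mult_left_le)
    thus "0 < ?h t" "1 - t \<le> ?h t" using z by linarith+
    thus "norm (t *\<^sub>R z) < 1" "1 - norm (t *\<^sub>R z) = ?h t" using that by auto
  qed
  have "(\<integral>\<^sup>+t. ?I t * ennreal ((1 - t) ^ (N - 1) * cmod (g (t *\<^sub>R z))) \<partial>lborel) \<le>
    (\<integral>\<^sup>+t. ennreal (A * lam powr (p - 1)) * (?I t * (?Q t)) +
      ennreal ((8 / 3) ^ N / lam) * (?I t * ennreal (1 / ?h t)) \<partial>lborel)"
  proof (rule nn_integral_mono)
    fix t :: real
    show "?I t * ennreal ((1 - t) ^ (N - 1) * cmod (g (t *\<^sub>R z))) \<le>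
      ennreal (A * lam powr (p - 1)) * (?I t * (?Q t)) +
      ennreal ((8 / 3) ^ N / lam) * (?I t * ennreal (1 / ?h t))"
    proof (cases "t \<in> {0..1}")
      case True
      note ht = h[OF True]
      have "(1 - t) ^ (N - 1) * cmod (g (t *\<^sub>R z)) \<le> ?h t ^ (N - 1) * cmod (g (t *\<^sub>R z))"
        using ht True by (intro mult_right_mono power_mono) auto
      also have "?h t ^ (N - 1) = 1 / ?h t * ?h t ^ N"
        using ht(1) N by (cases N) auto
      finally have "ennreal ((1 - t) ^ (N - 1) * cmod (g (t *\<^sub>R z))) \<le>
          ennreal (1 / ?h t * (?h t ^ N * cmod (g (t *\<^sub>R z))))" by (intro ennreal_leI) (simp add: mult.assoc)
      also have "\<dots> = ennreal (1 / ?h t) * ennreal (?h t ^ N * cmod (g (t *\<^sub>R z)))"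
        using ht(1) by (intro ennreal_mult) auto
      also have "\<dots> \<le> ennreal (1 / ?h t) * (ennreal (A * lam powr (p - 1)) * shell_mass p N g (?S t) + ennreal ((8 / 3) ^ N / lam))"
        using pointwise_estimate[OF g ht(3) p lam, of N] unfolding ht(4) A_def
        by (intro mult_left_mono) auto
      finally show ?thesis using True by (simp add: shell_mass_def W_def algebra_simps)
    qed simp
  qed
  also have "\<dots> = ennreal (A * lam powr (p - 1)) * (\<integral>\<^sup>+t. ?I t * (?Q t) \<partial>lborel) +
      ennreal ((8 / 3) ^ N / lam) * (\<integral>\<^sup>+t. ?I t * ennreal (1 / ?h t) \<partial>lborel)"
  proof -
    have "{p. fst p \<in> ?S (snd p)} = {p :: (complex ^ 'n) \<times> real. 3 / 8 * ?h (snd p) \<le> 1 - (norm (fst p))\<^sup>2} \<inter>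
        {p. 1 - (norm (fst p))\<^sup>2 \<le> 5 / 2 * ?h (snd p)}" by auto
    also have "closed \<dots>" by (intro closed_Int closed_Collect_le continuous_intros)
    finally have cl: "closed {p. fst p \<in> ?S (snd p)}" .
    have "(\<lambda>t. \<integral>\<^sup>+y. indicator (?S t) y * W y \<partial>lborel) \<in> borel_measurable borel"
      by measurable
    thus ?thesis by (subst nn_integral_add) (simp_all add: nn_integral_cmult)
  qed
  finally have main: "(\<integral>\<^sup>+t. ?I t * ennreal ((1 - t) ^ (N - 1) * cmod (g (t *\<^sub>R z))) \<partial>lborel) \<le> \<dots>" .
  have "(\<integral>\<^sup>+t. ?I t * (?Q t) \<partial>lborel) =
      (\<integral>\<^sup>+t. (\<integral>\<^sup>+y. ?I t * (ennreal (1 / ?h t) * (indicator (?S t) y * W y)) \<partial>lborel) \<partial>lborel)"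
    by (simp add: nn_integral_cmult)
  also have "\<dots> = (\<integral>\<^sup>+y. (\<integral>\<^sup>+t. ?I t * (ennreal (1 / ?h t) * (indicator (?S t) y * W y)) \<partial>lborel) \<partial>lborel)"
    by (rule lborel_pair.Fubini'[symmetric]) measurable
  \<comment> \<open>After the exchange, the inner integral for fixed \<open>y\<close> measures the
    set of shells that contain \<open>y\<close>, which is the bounded overlap.\<close>
  also have "\<dots> \<le> (\<integral>\<^sup>+y. 12 * W y \<partial>lborel)"
  proof (rule nn_integral_mono)
    fix y :: "complex ^ 'n"
    let ?Y = "1 - (norm y)\<^sup>2"
    have "(\<integral>\<^sup>+t. ?I t * (ennreal (1 / ?h t) * (indicator (?S t) y * W y)) \<partial>lborel) =
        (\<integral>\<^sup>+t. ?I t * (indicator {t. 3 / 8 * (1 - t * ?r) \<le> ?Y \<and> ?Y \<le> 5 / 2 * (1 - t * ?r)} t * ennreal (1 / ?h t)) * W y \<partial>lborel)"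
      by (rule nn_integral_cong) (auto split: split_indicator)
    also have "\<dots> = (\<integral>\<^sup>+t. ?I t * (indicator {t. 3 / 8 * (1 - t * ?r) \<le> ?Y \<and> ?Y \<le> 5 / 2 * (1 - t * ?r)} t * ennreal (1 / ?h t)) \<partial>lborel) * W y"
      by (rule nn_integral_multc) measurable
    also have "\<dots> \<le> 12 * W y"
    proof (cases "norm y < 1")
      case True
      hence "0 < ?Y" using one_minus_sq_bounds(3)[of "norm y"] by simp
      thus ?thesis by (intro mult_right_mono nn_integral_shell_multiplicity) (use z in auto)
    qed (simp add: W_def)
    finally show "(\<integral>\<^sup>+t. ?I t * (ennreal (1 / ?h t) * (indicator (?S t) y * W y)) \<partial>lborel) \<le> 12 * W y" .
  qed
  also have "\<dots> = 12 * (\<integral>\<^sup>+y. W y \<partial>lborel)" by (rule nn_integral_cmult) measurable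
  also have "(\<integral>\<^sup>+y. W y \<partial>lborel) = shell_mass p N g UNIV" by (simp add: shell_mass_def W_def)
  finally have X: "(\<integral>\<^sup>+t. ?I t * (?Q t) \<partial>lborel)
      \<le> 12 * shell_mass p N g UNIV" .
  have Y: "(\<integral>\<^sup>+t. ?I t * ennreal (1 / ?h t) \<partial>lborel) \<le> ennreal ((2 + 2 / ln 2) * ln (2 / (1 - (norm z)\<^sup>2)))"
    by (rule nn_integral_inverse_le_log) (use z in auto)
  show ?thesis by (rule order.trans[OF main]) (intro add_mono mult_left_mono X Y zero_le)
qed

section \<open>Words of derivatives and Taylor's formula on a ray\<close>

lemma finite_multi_index_le: "finite {m :: 'n::finite \<Rightarrow> nat. sum m UNIV \<le> k}"
proof (rule finite_subset)
  show "{m :: 'n \<Rightarrow> nat. sum m UNIV \<le> k} \<subseteq> PiE UNIV (\<lambda>_. {..k})"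
  proof
    fix m :: "'n \<Rightarrow> nat" assume m: "m \<in> {m. sum m UNIV \<le> k}"
    have "m j \<le> sum m UNIV" for j by (rule member_le_sum) auto
    thus "m \<in> PiE UNIV (\<lambda>_. {..k})" using m by (auto intro: order.trans)
  qed
  show "finite (PiE (UNIV :: 'n set) (\<lambda>_. {..k}))" by (rule finite_PiE) auto
qed

lemma finite_multi_index: "finite {m :: 'n::finite \<Rightarrow> nat. sum m UNIV = k}"
  by (rule finite_subset[OF _ finite_multi_index_le[of k]]) auto

lemma besov_norm_le_imp:
  fixes f :: "complex ^ 'n \<Rightarrow> complex"
  assumes "besov_norm N p f \<le> E"
  shows "sum m UNIV \<le> N - 1 \<Longrightarrow> ennreal (cmod (multi_deriv m f 0)) \<le> E"
    "sum m UNIV = N \<Longrightarrow> Lp_norm p invariant_measure (besov_deriv N m f) \<le> E"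
proof -
  assume "sum m UNIV \<le> N - 1"
  hence "ennreal (cmod (multi_deriv m f 0)) \<le> (\<Sum>m | sum m UNIV \<le> N - 1. ennreal (cmod (multi_deriv m f 0)))"
    by (intro member_le_sum finite_multi_index_le) auto
  also have "\<dots> \<le> besov_norm N p f" unfolding besov_norm_def by simp
  finally show "ennreal (cmod (multi_deriv m f 0)) \<le> E" using assms by simp
next
  assume "sum m UNIV = N"
  hence "Lp_norm p invariant_measure (besov_deriv N m f) \<le> (\<Sum>m | sum m UNIV = N. Lp_norm p invariant_measure (besov_deriv N m f))"
    by (intro member_le_sum[of _ _ "\<lambda>m. Lp_norm p invariant_measure (besov_deriv N m f)"] finite_multi_index) auto
  also have "\<dots> \<le> besov_norm N p f" unfolding besov_norm_def by simp
  finally show "Lp_norm p invariant_measure (besov_deriv N m f) \<le> E" using assms by simp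
qed

text \<open>Ordered words rather than multi-indices: repeated differentiation along a ray produces
  every word with coefficient 1, so no multinomial coefficients appear.\<close>

definition words :: "nat \<Rightarrow> 'n::finite list set" where "words k = {js. length js = k}"

lemma words_0: "words 0 = {[]}"
  by (auto simp: words_def)

lemma words_Suc: "words (Suc k) = (\<Union>j\<in>UNIV. (#) j ` words k)"
  by (auto simp: words_def length_Suc_conv)

lemma finite_words: "finite (words k)"
  by (induction k) (auto simp: words_0 words_Suc)

lemma sum_words_Suc: "(\<Sum>js\<in>words (Suc k). F js) = (\<Sum>js\<in>words k. \<Sum>j\<in>UNIV. F (j # js))"
proof -
  have "(\<Sum>js\<in>words (Suc k). F js) = (\<Sum>j\<in>UNIV. \<Sum>js\<in>(#) j ` words k. F js)"
    unfolding words_Suc by (rule sum.UNION_disjoint) (auto simp: finite_words)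
  also have "\<dots> = (\<Sum>j\<in>UNIV. \<Sum>js\<in>words k. F (j # js))"
    by (simp add: sum.reindex)
  also have "\<dots> = (\<Sum>js\<in>words k. \<Sum>j\<in>UNIV. F (j # js))" by (rule sum.swap)
  finally show ?thesis .
qed

lemma has_vector_derivative_on_ray:
  fixes g :: "complex ^ 'n \<Rightarrow> complex"
  assumes g: "holomorphic_on_ball g" and z: "norm (t *\<^sub>R z) < 1"
  shows "((\<lambda>t. g (t *\<^sub>R z)) has_vector_derivative (\<Sum>j\<in>UNIV. z $ j * partial_deriv j g (t *\<^sub>R z))) (at t within S)"
proof -
  have "((\<lambda>t. t *\<^sub>R z) has_derivative (\<lambda>s. s *\<^sub>R z)) (at t within S)"
    by (auto intro!: derivative_eq_intros)
  from has_derivative_compose[OF this holomorphic_on_ball_has_derivative[OF g z]]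
  have "((\<lambda>t. g (t *\<^sub>R z)) has_derivative (\<lambda>s. \<Sum>j\<in>UNIV. (s *\<^sub>R z) $ j * partial_deriv j g (t *\<^sub>R z))) (at t within S)" .
  thus ?thesis unfolding has_vector_derivative_def by (simp add: scaleR_sum_right)
qed

text \<open>The \<open>k\<close>-th derivative of t -> f(t z), as given by the chain rule.\<close>

definition ray_deriv :: "complex ^ 'n \<Rightarrow> (complex ^ 'n \<Rightarrow> complex) \<Rightarrow> nat \<Rightarrow> real \<Rightarrow> complex" where
  "ray_deriv z f k t = (\<Sum>js\<in>words k. prod_list (map (($) z) js) * foldr partial_deriv js f (t *\<^sub>R z))"

lemma ray_deriv_has_vector_derivative:
  fixes f :: "complex ^ 'n \<Rightarrow> complex"
  assumes f: "holomorphic_on_ball f" and z: "norm (t *\<^sub>R z) < 1"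
  shows "(ray_deriv z f k has_vector_derivative ray_deriv z f (Suc k) t) (at t within S)"
proof -
  have "((\<lambda>t. \<Sum>js\<in>words k. prod_list (map (($) z) js) * foldr partial_deriv js f (t *\<^sub>R z)) has_vector_derivative
     (\<Sum>js\<in>words k. prod_list (map (($) z) js) * (\<Sum>j\<in>UNIV. z $ j * partial_deriv j (foldr partial_deriv js f) (t *\<^sub>R z)))) (at t within S)"
    by (intro has_vector_derivative_sum has_vector_derivative_mult_right has_vector_derivative_on_ray
        holomorphic_foldr_partial_deriv f z)
  also have "(\<Sum>js\<in>words k. prod_list (map (($) z) js) * (\<Sum>j\<in>UNIV. z $ j * partial_deriv j (foldr partial_deriv js f) (t *\<^sub>R z))) =
     ray_deriv z f (Suc k) t"
    unfolding ray_deriv_def sum_words_Suc by (simp add: sum_distrib_left mult_ac)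
  finally show ?thesis by (simp add: ray_deriv_def[abs_def])
qed

lemma norm_prod_list_le_1:
  assumes "norm (z :: complex ^ 'n) \<le> 1" shows "cmod (prod_list (map (($) z) js)) \<le> 1"
proof (induction js)
  case (Cons j js)
  have "cmod (z $ j) \<le> 1" by (rule order.trans[OF Finite_Cartesian_Product.norm_nth_le assms])
  hence "cmod (z $ j) * cmod (prod_list (map (($) z) js)) \<le> 1 * 1" by (rule mult_mono[OF _ Cons]) auto
  thus ?case by (simp add: norm_mult)
qed simp

text \<open>Taylor's formula with integral remainder at t = 1. Factorials are at least 1 and
  coordinates of \<open>z\<close> at most 1 in modulus, so both are dropped.\<close>

lemma taylor_ray_bound:
  fixes f :: "complex ^ 'n \<Rightarrow> complex"
  assumes f: "holomorphic_on_ball f" and z: "norm z < 1" and N: "0 < N"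
  shows "ennreal (cmod (f z)) \<le> (\<Sum>i<N. \<Sum>js\<in>words i. ennreal (cmod (foldr partial_deriv js f 0))) +
    (\<Sum>js\<in>words N. \<integral>\<^sup>+t. indicator {0..1} t * ennreal ((1 - t) ^ (N - 1) * cmod (foldr partial_deriv js f (t *\<^sub>R z))) \<partial>lborel)"
proof -
  let ?D = "ray_deriv z f"
  let ?G = "\<lambda>js t. (1 - t) ^ (N - 1) * cmod (foldr partial_deriv js f (t *\<^sub>R z))"
  let ?F = "\<lambda>js t. cmod (foldr partial_deriv js f (t *\<^sub>R z))"
    and ?low = "\<lambda>i. \<Sum>js\<in>words i. cmod (foldr partial_deriv js f 0)" and ?int = "\<lambda>js. integral {0..1} (?G js)"
  have tz: "norm (t *\<^sub>R z) < 1" if "t \<in> {0..1}" for t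
    using that z mult_left_le_one_le[of "norm z" t] by auto
  have "((\<lambda>x. ((1 - x) ^ (N - 1) / fact (N - 1)) *\<^sub>R ?D N x) has_integral
      ?D 0 1 - (\<Sum>i<N. ((1 - 0) ^ i / fact i) *\<^sub>R ?D i 0)) {0..1}"
  proof (rule Taylor_has_integral[where Df = ?D and f = "?D 0", OF N])
    fix m and t :: real assume "m < N" "0 \<le> t" "t \<le> 1"
    thus "(?D m has_vector_derivative ?D (Suc m) t) (at t within {0..1})"
      by (intro ray_deriv_has_vector_derivative f tz) auto
  qed auto
  moreover have "?D 0 1 = f z" by (simp add: ray_deriv_def words_0)
  ultimately have I: "((\<lambda>x. ((1 - x) ^ (N - 1) / fact (N - 1)) *\<^sub>R ?D N x) has_integral
      f z - (\<Sum>i<N. (1 / fact i) *\<^sub>R ?D i 0)) {0..1}" by simp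
  have cont: "continuous_on {0..1} (?G js)" for js
  proof -
    have "continuous_on {0..1} (\<lambda>t. foldr partial_deriv js f (t *\<^sub>R z))"
      by (rule continuous_on_compose2[OF holomorphic_on_ball_imp_continuous_on[OF holomorphic_foldr_partial_deriv[OF f]]])
         (use tz in \<open>auto intro!: continuous_intros\<close>)
    thus ?thesis by (intro continuous_intros)
  qed
  have Dle: "cmod (?D k t) \<le> (\<Sum>js\<in>words k. ?F js t)" for k t
    unfolding ray_deriv_def
  proof (rule sum_norm_le)
    fix js
    show "cmod (prod_list (map (($) z) js) * foldr partial_deriv js f (t *\<^sub>R z)) \<le> ?F js t"
      unfolding norm_mult using norm_prod_list_le_1[of z js] z by (intro mult_left_le_one_le) auto
  qed
  have "cmod (f z - (\<Sum>i<N. (1 / fact i) *\<^sub>R ?D i 0)) \<le> integral {0..1} (\<lambda>t. \<Sum>js\<in>words N. ?G js t)"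
  proof -
    have "norm (integral {0..1} (\<lambda>x. ((1 - x) ^ (N - 1) / fact (N - 1)) *\<^sub>R ?D N x)) \<le> integral {0..1} (\<lambda>t. \<Sum>js\<in>words N. ?G js t)"
    proof (rule integral_norm_bound_integral)
      show "(\<lambda>x. ((1 - x) ^ (N - 1) / fact (N - 1)) *\<^sub>R ?D N x) integrable_on {0..1}" using I by blast
      show "(\<lambda>t. \<Sum>js\<in>words N. ?G js t) integrable_on {0..1}"
        by (intro integrable_continuous_real continuous_on_sum cont)
      fix t :: real assume t: "t \<in> {0..1}"
      have "norm (((1 - t) ^ (N - 1) / fact (N - 1)) *\<^sub>R ?D N t) = (1 - t) ^ (N - 1) / fact (N - 1) * cmod (?D N t)"
        using t by simp
      also have "\<dots> \<le> (1 - t) ^ (N - 1) / 1 * cmod (?D N t)"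
        using t by (intro mult_right_mono divide_left_mono) (auto simp: fact_ge_1)
      also have "\<dots> \<le> (1 - t) ^ (N - 1) / 1 * (\<Sum>js\<in>words N. ?F js t)"
        using t by (intro mult_left_mono Dle) auto
      finally show "norm (((1 - t) ^ (N - 1) / fact (N - 1)) *\<^sub>R ?D N t) \<le> (\<Sum>js\<in>words N. ?G js t)"
        by (simp add: sum_distrib_left)
    qed
    thus ?thesis using I by (simp add: integral_unique)
  qed
  also have "integral {0..1} (\<lambda>t. \<Sum>js\<in>words N. ?G js t) = (\<Sum>js\<in>words N. ?int js)"
    by (intro integral_sum finite_words integrable_continuous_real cont)
  finally have "cmod (f z) \<le> cmod (\<Sum>i<N. (1 / fact i) *\<^sub>R ?D i 0) + (\<Sum>js\<in>words N. ?int js)"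
    using norm_triangle_sub[of "f z" "\<Sum>i<N. (1 / fact i) *\<^sub>R ?D i 0"] by linarith
  also have "cmod (\<Sum>i<N. (1 / fact i) *\<^sub>R ?D i 0) \<le> (\<Sum>i<N. ?low i)"
  proof (rule sum_norm_le)
    fix i
    have "cmod ((1 / fact i) *\<^sub>R ?D i 0) \<le> 1 * cmod (?D i 0)"
      unfolding norm_scaleR by (intro mult_right_mono) (auto simp: fact_ge_1)
    thus "cmod ((1 / fact i) *\<^sub>R ?D i 0) \<le> ?low i"
      using Dle[of i 0] by simp
  qed
  finally have "ennreal (cmod (f z)) \<le> ennreal ((\<Sum>i<N. ?low i) + (\<Sum>js\<in>words N. ?int js))"
    by (intro ennreal_leI) simp
  also have "\<dots> = (\<Sum>i<N. \<Sum>js\<in>words i. ennreal (cmod (foldr partial_deriv js f 0))) + (\<Sum>js\<in>words N. ennreal (?int js))"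
  proof -
    have nonneg: "0 \<le> ?int js" for js
      by (rule integral_nonneg[OF integrable_continuous_real[OF cont]]) auto
    hence "0 \<le> (\<Sum>js\<in>words N. ?int js)" by (rule sum_nonneg)
    moreover have "0 \<le> (\<Sum>i<N. ?low i)"
      by (intro sum_nonneg norm_ge_zero)
    ultimately have "ennreal ((\<Sum>i<N. ?low i) + (\<Sum>js\<in>words N. ?int js)) =
      ennreal (\<Sum>i<N. ?low i) + ennreal (\<Sum>js\<in>words N. ?int js)"
      by (rule ennreal_plus[rotated])
    also have "ennreal (\<Sum>js\<in>words N. ?int js) = (\<Sum>js\<in>words N. ennreal (?int js))"
      by (rule sum_ennreal[symmetric]) (rule nonneg)
    also have "ennreal (\<Sum>i<N. ?low i) =
      (\<Sum>i<N. ennreal (?low i))"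
      by (rule sum_ennreal[symmetric]) (intro sum_nonneg norm_ge_zero)
    also have "\<dots> = (\<Sum>i<N. \<Sum>js\<in>words i. ennreal (cmod (foldr partial_deriv js f 0)))"
      by (intro sum.cong refl sum_ennreal[symmetric] norm_ge_zero)
    finally show ?thesis .
  qed
  also have "(\<Sum>js\<in>words N. ennreal (?int js)) =
      (\<Sum>js\<in>words N. \<integral>\<^sup>+t. indicator {0..1} t * ennreal (?G js t) \<partial>lborel)"
  proof (rule sum.cong)
    fix js
    have "(\<integral>\<^sup>+t. indicator {0..1} t * ennreal (?G js t) \<partial>lborel) = (\<integral>\<^sup>+t. ennreal (indicator {0..1} t * ?G js t) \<partial>lborel)"
      by (rule nn_integral_cong) (auto split: split_indicator)
    also have "\<dots> = ennreal (?int js)"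
    proof (rule nn_integral_has_integral_lborel)
      show "(\<lambda>t. indicator {0..1} t * ?G js t) \<in> borel_measurable borel"
        using borel_measurable_continuous_on_indicator[OF _ cont[of js]] by simp
      have "(?G js has_integral ?int js) {0..1}"
        by (intro integrable_integral integrable_continuous_real cont)
      hence "((\<lambda>t. if t \<in> {0..1} then ?G js t else 0) has_integral ?int js) UNIV"
        by (simp only: has_integral_restrict_UNIV)
      thus "((\<lambda>t. indicator {0..1} t * ?G js t) has_integral ?int js) UNIV"
        by (rule has_integral_eq[rotated]) auto
    qed (auto split: split_indicator)
    finally show "ennreal (?int js) = (\<integral>\<^sup>+t. indicator {0..1} t * ennreal (?G js t) \<partial>lborel)" ..
  qed simp
  finally show ?thesis .
qed

text \<open>\<open>E\<close> is an upper bound for the norm instead of the norm itself, and positive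
  because the balancing parameter divides by it.\<close>

lemma besov_growth:
  fixes p :: real and N :: nat
  assumes p: "1 \<le> p" and N: "0 < N"
  obtains C where "0 < C" "\<And>f :: complex ^ 'n \<Rightarrow> complex. \<And>E z. holomorphic_on_ball f \<Longrightarrow> 0 < E \<Longrightarrow>
    besov_norm N p f \<le> ennreal E \<Longrightarrow> norm z < 1 \<Longrightarrow> cmod (f z) \<le> C * E * ln (2 / (1 - (norm z)\<^sup>2)) powr (1 - 1 / p)"
proof -
  let ?v = "measure lborel (unit_ball :: (complex ^ 'n) set)"
  define A where "A = (8 / 3) ^ N * (16 ^ CARD('n) * (5 / 2) ^ (CARD('n) + 1)) / ?v"
  define K where "K = real (\<Sum>i<N. card (words i :: 'n list set))"
  define M where "M = real (card (words N :: 'n list set))"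
  \<comment> \<open>\<open>K / ln 2\<close> absorbs the derivatives at 0, one for each word shorter
    than \<open>N\<close>; the last term collects the words of length \<open>N\<close>; the 1 keeps
    \<open>C\<close> positive.\<close>
  define C where "C = 1 + K / ln 2 + M * (A * (12 * ?v) + (8 / 3) ^ N * (2 + 2 / ln 2))"
  have v: "0 < ?v" by (rule unit_ball_volume)
  have nn: "0 \<le> A" "0 \<le> K" "0 \<le> M" using v by (auto simp: A_def K_def M_def intro!: sum_nonneg)
  have "0 < C" unfolding C_def using nn v by (intro add_pos_nonneg) auto
  moreover have "cmod (f z) \<le> C * E * ln (2 / (1 - (norm z)\<^sup>2)) powr (1 - 1 / p)"
    if f: "holomorphic_on_ball f" and E: "0 < E" and le: "besov_norm N p f \<le> ennreal E" and z: "norm z < 1"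
    for f :: "complex ^ 'n \<Rightarrow> complex" and E z
  proof -
    define L where "L = ln (2 / (1 - (norm z)\<^sup>2))"
    define P where "P = L powr (1 - 1 / p)"
    \<comment> \<open>This value makes both terms of the radial estimate constant multiples of
      \<open>E * P\<close>, as \<open>lam1\<close> and \<open>lam2\<close> show.\<close>
    define lam where "lam = L powr (1 / p) / E"
    have L2: "ln 2 \<le> L" unfolding L_def by (rule log_weight_ge_ln2) (use z in auto)
    hence L: "0 < L" using ln_gt_zero[of "2 :: real"] by linarith
    have lam: "0 < lam" using L E by (simp add: lam_def)
    have P: "ln 2 \<le> P" unfolding P_def using L2 p by (intro ln2_le_log_powr) (auto simp: field_simps)
    have lam1: "lam powr (p - 1) * E powr p = E * P"
    proof -
      have "lam powr (p - 1) * E powr p = L powr (1 / p * (p - 1)) * (E powr p / E powr (p - 1))"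
        unfolding lam_def using L E by (simp add: powr_divide powr_powr)
      also have "E powr p / E powr (p - 1) = E" using E by (simp flip: powr_diff)
      also have "1 / p * (p - 1) = 1 - 1 / p" using p by (simp add: field_simps)
      finally show ?thesis by (simp add: P_def)
    qed
    have lam2: "L / lam = E * P"
    proof -
      have "L / lam = E * (L powr 1 / L powr (1 / p))" using L E by (simp add: lam_def)
      also have "L powr 1 / L powr (1 / p) = P" unfolding P_def by (rule powr_diff[symmetric])
      finally show ?thesis .
    qed
    have low: "ennreal (cmod (foldr partial_deriv js f 0)) \<le> ennreal E" if "length js < N" for js
    proof -
      have "foldr partial_deriv js f 0 = multi_deriv (count (mset js)) f 0"
        by (rule foldr_partial_deriv_eq_multi_deriv[OF f]) simp
      thus ?thesis using besov_norm_le_imp(1)[OF le, of "count (mset js)"] that sum_count_mset[of js] by simp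
    qed
    have high: "(\<integral>\<^sup>+t. indicator {0..1} t * ennreal ((1 - t) ^ (N - 1) * cmod (foldr partial_deriv js f (t *\<^sub>R z))) \<partial>lborel)
       \<le> ennreal ((A * (12 * ?v) + (8 / 3) ^ N * (2 + 2 / ln 2)) * (E * P))" if js: "length js = N" for js
    proof -
      define m where "m = count (mset js)"
      have m: "sum m UNIV = N" using js by (simp add: m_def sum_count_mset)
      let ?g = "multi_deriv m f"
      have g: "holomorphic_on_ball ?g" by (rule holomorphic_multi_deriv[OF f])
      have sm: "shell_mass p N ?g UNIV \<le> ennreal (?v * E powr p)"
      proof (rule shell_mass_le[OF g])
        show "Lp_norm p invariant_measure (\<lambda>z. of_real ((1 - (norm z)\<^sup>2) ^ N) * ?g z) \<le> ennreal E"
          using besov_norm_le_imp(2)[OF le m] by (simp add: besov_deriv_def[abs_def])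
      qed (use p E in auto)
      have "(\<integral>\<^sup>+t. indicator {0..1} t * ennreal ((1 - t) ^ (N - 1) * cmod (foldr partial_deriv js f (t *\<^sub>R z))) \<partial>lborel) =
        (\<integral>\<^sup>+t. indicator {0..1} t * ennreal ((1 - t) ^ (N - 1) * cmod (?g (t *\<^sub>R z))) \<partial>lborel)"
      proof (rule nn_integral_cong)
        fix t :: real
        have "foldr partial_deriv js f (t *\<^sub>R z) = ?g (t *\<^sub>R z)" if "t \<in> {0..1}"
          unfolding m_def using that z mult_left_le_one_le[of "norm z" t] 
          by (intro foldr_partial_deriv_eq_multi_deriv[OF f]) auto
        thus "indicator {0..1} t * ennreal ((1 - t) ^ (N - 1) * cmod (foldr partial_deriv js f (t *\<^sub>R z))) =
            indicator {0..1} t * ennreal ((1 - t) ^ (N - 1) * cmod (?g (t *\<^sub>R z)))"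
          by (auto split: split_indicator)
      qed
      also have "\<dots> \<le> ennreal (A * lam powr (p - 1)) * (12 * shell_mass p N ?g UNIV) +
          ennreal ((8 / 3) ^ N / lam) * ennreal ((2 + 2 / ln 2) * L)"
        unfolding A_def L_def by (rule radial_integral_bound[OF g z p lam N])
      also have "\<dots> \<le> ennreal (A * lam powr (p - 1)) * (ennreal 12 * ennreal (?v * E powr p)) +
          ennreal ((8 / 3) ^ N / lam) * ennreal ((2 + 2 / ln 2) * L)"
        using sm by (intro add_right_mono mult_left_mono mult_mono) auto
      also have "\<dots> = ennreal (A * lam powr (p - 1) * (12 * (?v * E powr p)) + (8 / 3) ^ N / lam * ((2 + 2 / ln 2) * L))"
      proof -
        define a b c d where "a = A * lam powr (p - 1)" and "b = ?v * E powr p"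
          and "c = (8 / 3) ^ N / lam" and "d = (2 + 2 / ln 2) * L"
        have "0 \<le> a" "0 \<le> b" "0 \<le> c" "0 \<le> d"
          using nn v lam L by (auto simp: a_def b_def c_def d_def)
        thus ?thesis unfolding a_def[symmetric] b_def[symmetric] c_def[symmetric] d_def[symmetric]
          by (simp only: ennreal_mult'[symmetric] ennreal_plus[symmetric] mult_nonneg_nonneg zero_le_numeral)
      qed
      also have "A * lam powr (p - 1) * (12 * (?v * E powr p)) + (8 / 3) ^ N / lam * ((2 + 2 / ln 2) * L) =
         A * (12 * ?v) * (lam powr (p - 1) * E powr p) + (8 / 3) ^ N * (2 + 2 / ln 2) * (L / lam)"
        by simp
      also have "\<dots> = (A * (12 * ?v) + (8 / 3) ^ N * (2 + 2 / ln 2)) * (E * P)"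
        unfolding lam1 lam2 by (simp add: algebra_simps)
      finally show ?thesis .
    qed
    define Q where "Q = (A * (12 * ?v) + (8 / 3) ^ N * (2 + 2 / ln 2)) * (E * P)"
    have Q: "0 \<le> Q" unfolding Q_def using nn v E P by (auto simp: P_def)
    have "ennreal (cmod (f z)) \<le> (\<Sum>i<N. \<Sum>js\<in>(words i :: 'n list set). ennreal E) + (\<Sum>js\<in>(words N :: 'n list set). ennreal Q)"
      by (rule order.trans[OF taylor_ray_bound[OF f z N]])
         (intro add_mono sum_mono low high[folded Q_def], auto simp: words_def)
    also have "\<dots> = ennreal (K * E + M * Q)"
    proof -
      have const: "(\<Sum>js\<in>W. ennreal c) = ennreal (real (card W) * c)" if "0 \<le> c" for W :: "'n list set" and c
        using that by (simp add: ennreal_mult ennreal_of_nat_eq_real_of_nat)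
      have "(\<Sum>i<N. ennreal (real (card (words i :: 'n list set)) * E)) = ennreal (\<Sum>i<N. real (card (words i :: 'n list set)) * E)"
        using E by (intro sum_ennreal) simp
      also have "(\<Sum>i<N. real (card (words i :: 'n list set)) * E) = K * E"
        unfolding K_def of_nat_sum sum_distrib_right ..
      finally show ?thesis
        unfolding const[OF less_imp_le[OF E]] const[OF Q] M_def[symmetric]
        using E Q nn by (simp only: ennreal_plus mult_nonneg_nonneg less_imp_le)
    qed
    finally have fz: "cmod (f z) \<le> K * E + M * Q" using nn E Q by (subst (asm) ennreal_le_iff) auto
    have "K * E \<le> K / ln 2 * (E * P)"
    proof -
      have "K * E * ln 2 \<le> K * E * P" using P nn E by (intro mult_left_mono) auto
      thus ?thesis by (simp add: field_simps)
    qed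
    hence "cmod (f z) \<le> K / ln 2 * (E * P) + M * Q" using fz by linarith
    also have "K / ln 2 * (E * P) + M * Q = (C - 1) * (E * P)" by (simp add: C_def Q_def algebra_simps)
    also have "\<dots> \<le> C * (E * P)" using E by (intro mult_right_mono) (auto simp: P_def)
    finally show ?thesis unfolding P_def L_def by (simp add: mult.assoc)
  qed
  ultimately show thesis using that by blast
qed

section \<open>The Forelli--Rudin estimate\<close>

text \<open>The nonisotropic Carleson tent: for \<open>a\<close> near the sphere it has size about
  \<open>h\<close> in the complex direction of \<open>a\<close> and sqrt(h) across.\<close>

definition carleson_box :: "complex ^ 'n \<Rightarrow> real \<Rightarrow> (complex ^ 'n) set" where
  "carleson_box a h = {z \<in> unit_ball. cmod (1 - hermitian z a) \<le> h}"

lemma carleson_box_measurable [measurable]: "carleson_box a h \<in> sets borel"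
proof -
  have "carleson_box a h = unit_ball \<inter> {z. cmod (1 - hermitian z a) \<le> h}" by (auto simp: carleson_box_def)
  also have "\<dots> \<in> sets borel"
    by (intro sets.Int borel_open borel_closed open_ball closed_Collect_le continuous_intros)
  finally show ?thesis .
qed

text \<open>The point u/r lies on the hyperplane <z, a> = 1. With it as origin, 1 - <z, a> is a
  multiple of the coordinate of \<open>y\<close> along \<open>u\<close> and bounds it by 1. Since
  |<z, u>| \<ge> 1 - h, the condition |z| < 1 leaves at most 2 h for the square of the transverse
  part.\<close>

lemma carleson_box_pullback:
  fixes a u y :: "complex ^ 'n"
  assumes u: "norm u = 1" "a = of_real r *s u" and r: "1 / 2 \<le> r" "r < 1" and h: "0 < h" "h < 1 / 4"
    and y: "of_real (1 / r) *s u + nonisotropic u (2 * h) (sqrt (2 * h)) y \<in> carleson_box a h"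
  shows "norm y < 2"
proof -
  define c where "c = hermitian y u"
  define z where "z = of_real (1 / r) *s u + nonisotropic u (2 * h) (sqrt (2 * h)) y"
  have uu: "hermitian u u = 1" using u by (simp add: hermitian_self)
  have z1: "norm z < 1" and za: "cmod (1 - hermitian z a) \<le> h" using y by (auto simp: z_def carleson_box_def)
  have z: "z = (of_real (1 / r) + of_real (2 * h) * c) *s u + of_real (sqrt (2 * h)) *s (y - hermitian y u *s u)"
    unfolding z_def nonisotropic_def c_def[symmetric] by (simp add: scaleR_eq_cmult vec_eq_iff algebra_simps)
  have zu: "hermitian z u = of_real (1 / r) + of_real (2 * h) * c"
    unfolding z_def nonisotropic_def hermitian_simps by (simp add: uu c_def algebra_simps)
  have "hermitian z a = of_real r * hermitian z u" by (simp add: u(2) hermitian_simps)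
  hence "1 - hermitian z a = - (of_real (2 * h * r) * c)" using r by (simp add: zu algebra_simps)
  hence "2 * h * r * cmod c \<le> h" using za h r by (simp add: norm_mult)
  hence "2 * r * cmod c \<le> 1" using h by simp
  moreover have "1 * cmod c \<le> 2 * r * cmod c" using r by (intro mult_right_mono) auto
  ultimately have c: "cmod c \<le> 1" by linarith
  have "1 - h \<le> cmod (hermitian z a)" using norm_triangle_ineq3[of 1 "hermitian z a"] za by simp
  also have "\<dots> \<le> cmod (hermitian z u)"
    using r by (simp add: u(2) hermitian_simps norm_mult mult_left_le_one_le)
  finally have "(1 - h)\<^sup>2 \<le> (cmod (hermitian z u))\<^sup>2" using h by (intro power_mono) auto
  moreover have "(norm z)\<^sup>2 = (cmod (hermitian z u))\<^sup>2 + 2 * h * ((norm y)\<^sup>2 - (cmod c)\<^sup>2)"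
    unfolding zu using norm_sq_unit_decomposition[OF u(1), of "of_real (1 / r) + of_real (2 * h) * c" "of_real (sqrt (2 * h))" y] h
    unfolding z[symmetric] by (simp add: c_def)
  moreover have "(norm z)\<^sup>2 \<le> 1" using z1 by (simp add: power_le_one)
  moreover have "(1 - h)\<^sup>2 = 1 - 2 * h + h\<^sup>2" by (simp add: power2_eq_square algebra_simps)
  ultimately have "2 * h * ((norm y)\<^sup>2 - (cmod c)\<^sup>2) \<le> 2 * h * 1" using zero_le_power2[of h] by linarith
  hence "(norm y)\<^sup>2 - (cmod c)\<^sup>2 \<le> 1" using h by (subst (asm) mult_le_cancel_left_pos) auto
  moreover have "(cmod c)\<^sup>2 \<le> 1" using c by (simp add: power_le_one)
  ultimately have "(norm y)\<^sup>2 < 2\<^sup>2" by simp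
  thus ?thesis by (rule power_less_imp_less_base) simp
qed

text \<open>For h \<ge> 1/4 the volume of the ball suffices, and for smaller \<open>h\<close> with
  |a| < 1/2 the box is empty. Otherwise an affine map with Jacobian (2h)^(n+1) pulls the box back
  into the ball of radius 2.\<close>

lemma emeasure_carleson_box:
  obtains C where "0 < C" "\<And>a h. norm (a :: complex ^ 'n) < 1 \<Longrightarrow> 0 < h \<Longrightarrow>
    emeasure lborel (carleson_box a h) \<le> ennreal (C * h ^ (CARD('n) + 1))"
proof -
  let ?n = "CARD('n)"
  define v where "v = measure lborel (unit_ball :: (complex ^ 'n) set)"
  define w where "w = measure lborel (ball (0 :: complex ^ 'n) 2)"
  have v: "0 < v" "emeasure lborel (unit_ball :: (complex ^ 'n) set) = ennreal v"
    unfolding v_def by (rule unit_ball_volume)+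
  have w: "0 \<le> w" "emeasure lborel (ball (0 :: complex ^ 'n) 2) = ennreal w"
  proof -
    show "emeasure lborel (ball (0 :: complex ^ 'n) 2) = ennreal w" unfolding w_def
      by (rule emeasure_eq_ennreal_measure) (use emeasure_lborel_ball_finite[of "0 :: complex ^ 'n" 2] in simp)
  qed (simp add: w_def)
  define C where "C = v * 4 ^ (?n + 1) + w * 2 ^ (?n + 1)"
  have "emeasure lborel (carleson_box a h) \<le> ennreal (C * h ^ (?n + 1))" if a: "norm a < 1" and h: "0 < h"
    for a :: "complex ^ 'n" and h
  proof (cases "h < 1 / 4")
    case False
    have "emeasure lborel (carleson_box a h) \<le> emeasure lborel (unit_ball :: (complex ^ 'n) set)"
      by (rule emeasure_mono) (auto simp: carleson_box_def)
    also have "\<dots> = ennreal v" by (rule v)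
    also have "v * 1 \<le> v * (4 * h) ^ (?n + 1)" using v False by (intro mult_left_mono one_le_power) auto
    hence "ennreal v \<le> ennreal (v * (4 * h) ^ (?n + 1))" by (intro ennreal_leI) simp
    also have "v * (4 * h) ^ (?n + 1) = v * 4 ^ (?n + 1) * h ^ (?n + 1)" by (simp only: power_mult_distrib mult.assoc)
    also have "\<dots> \<le> C * h ^ (?n + 1)" unfolding C_def using w h by (intro mult_right_mono) auto
    finally show ?thesis by (simp add: ennreal_leI)
  next
    case True
    show ?thesis
    proof (cases "norm a < 1 / 2")
      case small: True
      have "carleson_box a h = {}"
      proof -
        have "\<not> cmod (1 - hermitian z a) \<le> h" if "norm z < 1" for z
          using one_minus_hermitian_bounds(2)[OF that a] small True by linarith
        thus ?thesis by (auto simp: carleson_box_def)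
      qed
      thus ?thesis by simp
    next
      case large: False
      define u where "u = of_real (1 / norm a) *s a"
      have a0: "norm a \<noteq> 0" using large by auto
      have u: "norm u = 1" "a = of_real (norm a) *s u"
        using a0 by (auto simp: u_def norm_cmult norm_divide vec_eq_iff)
      let ?c = "of_real (1 / norm a) *s u" and ?T = "nonisotropic u (2 * h) (sqrt (2 * h))"
      let ?I = "indicator (carleson_box a h) :: complex ^ 'n \<Rightarrow> ennreal"
      have "emeasure lborel (carleson_box a h) = (\<integral>\<^sup>+z. ?I z \<partial>lborel)" by simp
      also have "\<dots> = (\<integral>\<^sup>+z. ?I (?c + z) \<partial>lborel)"
        by (rule nn_integral_lborel_shift[symmetric]) measurable
      also have "\<dots> = ennreal ((2 * h)\<^sup>2 * ((sqrt (2 * h))\<^sup>2) ^ (?n - 1)) * (\<integral>\<^sup>+y. ?I (?c + ?T y) \<partial>lborel)"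
        by (rule nn_integral_nonisotropic) (use h u in auto)
      also have "(2 * h)\<^sup>2 * ((sqrt (2 * h))\<^sup>2) ^ (?n - 1) = (2 * h) ^ (?n + 1)"
      proof -
        obtain m where m: "?n = Suc m" using zero_less_card_finite[where 'a = 'n] gr0_conv_Suc by blast
        show ?thesis using h unfolding m by (simp add: power2_eq_square)
      qed
      also have "(\<integral>\<^sup>+y. ?I (?c + ?T y) \<partial>lborel) \<le> (\<integral>\<^sup>+y. indicator (ball 0 2) y \<partial>(lborel :: (complex ^ 'n) measure))"
      proof (rule nn_integral_mono)
        fix y :: "complex ^ 'n"
        have "norm y < 2" if "?c + ?T y \<in> carleson_box a h"
          by (rule carleson_box_pullback[OF u _ a h True that]) (use large in simp)
        thus "?I (?c + ?T y) \<le> indicator (ball 0 2) y" by (auto split: split_indicator)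
      qed
      hence "ennreal ((2 * h) ^ (?n + 1)) * (\<integral>\<^sup>+y. ?I (?c + ?T y) \<partial>lborel) \<le> ennreal ((2 * h) ^ (?n + 1)) * ennreal w"
        using w by (intro mult_left_mono) auto
      also have "\<dots> = ennreal (w * 2 ^ (?n + 1) * h ^ (?n + 1))"
        using h w(1) by (simp add: ennreal_mult'[symmetric] power_mult_distrib mult_ac)
      also have "\<dots> \<le> ennreal (C * h ^ (?n + 1))" unfolding C_def using v h by (intro ennreal_leI mult_right_mono) auto
      finally show ?thesis .
    qed
  qed
  moreover have "0 < C" unfolding C_def using v w by (intro add_pos_nonneg) auto
  ultimately show thesis using that by blast
qed

section \<open>Boundary weights on Carleson boxes\<close>

lemma nn_integral_powr_from_0:
  fixes \<alpha> D :: real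
  assumes \<alpha>: "-1 < \<alpha>" and D: "0 \<le> D"
  shows "(\<integral>\<^sup>+t. indicator {0..D} t * ennreal ((D - t) powr \<alpha>) \<partial>lborel) = ennreal (D powr (\<alpha> + 1) / (\<alpha> + 1))"
proof -
  have "(\<integral>\<^sup>+t. indicator {0..D} t * ennreal ((D - t) powr \<alpha>) \<partial>lborel) =
      ennreal \<bar>- 1\<bar> * (\<integral>\<^sup>+t. indicator {0..D} (D + (-1) * t) * ennreal ((D - (D + (-1) * t)) powr \<alpha>) \<partial>lborel)"
    by (rule nn_integral_real_affine) auto
  also have "\<dots> = (\<integral>\<^sup>+t. ennreal (indicator {0..D} t * t powr \<alpha>) \<partial>lborel)"
    by (auto intro!: nn_integral_cong split: split_indicator)
  also have "\<dots> = ennreal (D powr (\<alpha> + 1) / (\<alpha> + 1))"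
  proof (rule nn_integral_has_integral_lborel)
    have "((\<lambda>t. t powr \<alpha>) has_integral D powr (\<alpha> + 1) / (\<alpha> + 1)) {0..D}"
      by (rule has_integral_powr_from_0[OF \<alpha> D])
    hence "((\<lambda>t. if t \<in> {0..D} then t powr \<alpha> else 0) has_integral D powr (\<alpha> + 1) / (\<alpha> + 1)) UNIV"
      by (simp only: has_integral_restrict_UNIV)
    thus "((\<lambda>t. indicator {0..D} t * t powr \<alpha>) has_integral D powr (\<alpha> + 1) / (\<alpha> + 1)) UNIV"
      by (rule has_integral_eq[rotated]) auto
  qed auto
  finally show ?thesis .
qed

text \<open>Two-sided comparability handles exponents of either sign, as arbitrary real
  \<open>s\<close> and \<open>t\<close> demand.\<close>

lemma powr_compare:
  fixes x y K s :: real
  assumes "0 < x" "0 < y" "1 \<le> K" "x \<le> K * y" "y \<le> K * x"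
  shows "x powr s \<le> K powr \<bar>s\<bar> * y powr s"
proof (cases "0 \<le> s")
  case True
  have "x powr s \<le> (K * y) powr s" using assms True by (intro powr_mono2) auto
  thus ?thesis using assms True by (simp add: powr_mult)
next
  case False
  have "x powr s \<le> (y / K) powr s" using assms False by (intro powr_mono2') (auto simp: field_simps)
  also have "\<dots> = K powr \<bar>s\<bar> * y powr s" using assms False by (simp add: powr_divide powr_minus field_simps)
  finally show ?thesis .
qed

text \<open>Averaging over the dilations \<open>z \<mapsto> (1 - t) z\<close> smears out the boundary weight \<open>(1 - |z|)\<^sup>\<alpha>\<close>
  and reduces the weighted integral to plain volume.\<close>

lemma weighted_integral_dilation:
  fixes S S' :: "(complex ^ 'n) set" and \<alpha> \<eta> \<delta> :: real
  assumes \<alpha>: "-1 < \<alpha>" and \<eta>: "0 < \<eta>" "\<eta> \<le> 1 / 2" and [measurable]: "S \<in> sets borel" "S' \<in> sets borel"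
    and S: "\<And>z. z \<in> S \<Longrightarrow> norm z < 1" and dil: "\<And>z t. z \<in> S \<Longrightarrow> 0 \<le> t \<Longrightarrow> t \<le> \<eta> \<Longrightarrow> (1 - t) *\<^sub>R z \<in> S'"
    and \<delta>: "\<And>x. x \<in> S' \<Longrightarrow> 1 - norm x \<le> \<delta>"
  shows "ennreal \<eta> * (\<integral>\<^sup>+z. indicator S z * ennreal ((1 - norm z) powr \<alpha>) \<partial>lborel) \<le>
    ennreal (4 ^ CARD('n) * 2 powr \<bar>\<alpha>\<bar> * (\<delta> powr (\<alpha> + 1) / (\<alpha> + 1))) * emeasure lborel S'"
proof -
  let ?n = "CARD('n)"
  let ?c = "2 powr \<bar>\<alpha>\<bar> * (\<delta> powr (\<alpha> + 1) / (\<alpha> + 1))"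
  define F where "F z = indicator S z * ennreal ((1 - norm z) powr \<alpha>)" for z
  have [measurable]: "F \<in> borel_measurable borel" unfolding F_def by measurable
  let ?I = "\<integral>\<^sup>+z. F z \<partial>lborel"
  let ?J = "indicator {0..\<eta>} :: real \<Rightarrow> ennreal"
  let ?w = "\<lambda>t x. indicator S' x * (indicator {t. 0 \<le> t \<and> t \<le> 1 - norm x} t * ennreal (2 powr \<bar>\<alpha>\<bar> * ((1 - norm x) - t) powr \<alpha>))"
  have "ennreal \<eta> * ?I = (\<integral>\<^sup>+t. ?J t * ?I \<partial>lborel)"
    using \<eta> by (subst nn_integral_multc) auto
  also have "\<dots> \<le> (\<integral>\<^sup>+t. ennreal (4 ^ ?n) * (\<integral>\<^sup>+x. ?w t x \<partial>lborel) \<partial>lborel)"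
  proof (rule nn_integral_mono)
    fix t :: real
    show "?J t * ?I \<le> ennreal (4 ^ ?n) * (\<integral>\<^sup>+x. ?w t x \<partial>lborel)"
    proof (cases "t \<in> {0..\<eta>}")
      case True
      \<comment> \<open>Substituting z = c x with c at most 2 costs the Jacobian factor 2^(2n) =
        4^n.\<close>
      define c where "c = 1 / (1 - t)"
      have c: "1 \<le> c" "c \<le> 2" using True \<eta> by (auto simp: c_def field_simps)
      have "?I = ennreal (\<bar>c\<bar> ^ DIM(complex ^ 'n)) * (\<integral>\<^sup>+x. F (c *\<^sub>R x) \<partial>lborel)"
        by (rule nn_integral_lborel_scale) (use c in auto)
      also have "\<dots> \<le> ennreal (4 ^ ?n) * (\<integral>\<^sup>+x. ?w t x \<partial>lborel)"
      proof (intro mult_mono nn_integral_mono)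
        have "\<bar>c\<bar> ^ DIM(complex ^ 'n) \<le> 2 ^ DIM(complex ^ 'n)" using c by (intro power_mono) auto
        also have "(2 :: real) ^ DIM(complex ^ 'n) = (2 ^ 2) ^ ?n"
          by (simp only: power_mult[symmetric] DIM_cart DIM_complex mult.commute)
        finally show "ennreal (\<bar>c\<bar> ^ DIM(complex ^ 'n)) \<le> ennreal (4 ^ ?n)" by (intro ennreal_leI) simp
        fix x :: "complex ^ 'n"
        show "F (c *\<^sub>R x) \<le> ?w t x"
        proof (cases "c *\<^sub>R x \<in> S")
          case in_S: True
          have "(1 - t) *\<^sub>R (c *\<^sub>R x) = x" using True \<eta> by (simp add: c_def)
          hence xS: "x \<in> S'" using dil[OF in_S, of t] True by auto
          have "c * norm x < 1" using S[OF in_S] c by simp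
          hence xt: "norm x < 1 - t" using True \<eta> by (simp add: c_def field_simps)
          \<comment> \<open>In the new variable the weight is comparable to a power of (1 - |x|) -
            t. For fixed \<open>x\<close> it is integrable in \<open>t\<close>, which is where
            \<alpha> > -1 enters.\<close>
          have eq: "1 - norm (c *\<^sub>R x) = c * ((1 - norm x) - t)"
            using True \<eta> by (simp add: c_def field_simps)
          have "(1 - norm (c *\<^sub>R x)) powr \<alpha> \<le> 2 powr \<bar>\<alpha>\<bar> * ((1 - norm x) - t) powr \<alpha>"
          proof (rule powr_compare)
            have d: "0 < (1 - norm x) - t" using xt by simp
            show "0 < 1 - norm (c *\<^sub>R x)" unfolding eq using d c by (intro mult_pos_pos) auto
            show "1 - norm (c *\<^sub>R x) \<le> 2 * ((1 - norm x) - t)" unfolding eq using d c by (intro mult_right_mono) auto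
            have "1 * ((1 - norm x) - t) \<le> (2 * c) * ((1 - norm x) - t)" using d c by (intro mult_right_mono) auto
            thus "(1 - norm x) - t \<le> 2 * (1 - norm (c *\<^sub>R x))" unfolding eq by simp
            show "0 < (1 - norm x) - t" by (rule d)
          qed simp
          thus ?thesis using in_S xS xt True by (simp add: F_def ennreal_leI)
        qed (simp add: F_def)
      qed auto
      finally show ?thesis using True by simp
    qed simp
  qed
  also have "\<dots> = ennreal (4 ^ ?n) * (\<integral>\<^sup>+t. (\<integral>\<^sup>+x. ?w t x \<partial>lborel) \<partial>lborel)"
    by (rule nn_integral_cmult) measurable
  also have "(\<integral>\<^sup>+t. (\<integral>\<^sup>+x. ?w t x \<partial>lborel) \<partial>lborel) = (\<integral>\<^sup>+x. (\<integral>\<^sup>+t. ?w t x \<partial>lborel) \<partial>lborel)"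
    by (rule lborel_pair.Fubini') measurable
  also have "(\<integral>\<^sup>+x. (\<integral>\<^sup>+t. ?w t x \<partial>lborel) \<partial>lborel) \<le>
      (\<integral>\<^sup>+x. ennreal (?c) * indicator S' x \<partial>lborel)"
  proof (rule nn_integral_mono)
    fix x :: "complex ^ 'n"
    show "(\<integral>\<^sup>+t. ?w t x \<partial>lborel) \<le> ennreal (?c) * indicator S' x"
    proof (cases "x \<in> S' \<and> norm x \<le> 1")
      case True
      hence D: "0 \<le> 1 - norm x" "1 - norm x \<le> \<delta>" using \<delta> by auto
      have "(\<integral>\<^sup>+t. ?w t x \<partial>lborel) =
          (\<integral>\<^sup>+t. ennreal (2 powr \<bar>\<alpha>\<bar>) * (indicator {0..1 - norm x} t * ennreal ((1 - norm x - t) powr \<alpha>)) \<partial>lborel)"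
        using True by (intro nn_integral_cong) (auto simp: ennreal_mult split: split_indicator)
      also have "\<dots> = ennreal (2 powr \<bar>\<alpha>\<bar>) * ennreal ((1 - norm x) powr (\<alpha> + 1) / (\<alpha> + 1))"
        by (subst nn_integral_cmult) (simp_all add: nn_integral_powr_from_0[OF \<alpha> D(1)])
      also have "\<dots> \<le> ennreal (2 powr \<bar>\<alpha>\<bar>) * ennreal (\<delta> powr (\<alpha> + 1) / (\<alpha> + 1))"
        using D \<alpha> by (intro mult_left_mono ennreal_leI divide_right_mono powr_mono2) auto
      also have "\<dots> = ennreal (?c)"
        by (rule ennreal_mult'[symmetric]) simp
      also have "\<dots> = ennreal (?c) * indicator S' x"
        using True by simp
      finally show ?thesis .
    next
      case False
      have "(\<integral>\<^sup>+t. ?w t x \<partial>lborel) = (\<integral>\<^sup>+t. 0 \<partial>(lborel :: real measure))"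
        by (rule nn_integral_cong) (use False in \<open>auto split: split_indicator\<close>)
      also have "\<dots> = 0" by simp
      finally have "(\<integral>\<^sup>+t. ?w t x \<partial>lborel) = 0" .
      show ?thesis unfolding \<open>(\<integral>\<^sup>+t. ?w t x \<partial>lborel) = 0\<close> by simp
    qed
  qed
  also have "\<dots> = ennreal (?c) * emeasure lborel S'"
    by (rule nn_integral_cmult_indicator) simp
  finally have fin: "ennreal \<eta> * ?I \<le> ennreal (4 ^ ?n) *
      (ennreal (?c) * emeasure lborel S')"
    by (simp add: mult_left_mono)
  have split: "ennreal (4 ^ ?n * 2 powr \<bar>\<alpha>\<bar> * Y) = ennreal (4 ^ ?n) * ennreal (2 powr \<bar>\<alpha>\<bar> * Y)" for Y
    by (subst ennreal_mult'[symmetric]) (simp_all add: mult.assoc)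
  show ?thesis unfolding split using fin unfolding F_def mult.assoc .
qed

text \<open>Dilation by 1 - t moves 1 - <z, a> by at most t, so t \<le> h/4 stays in the doubled
  box, where 1 - |x| \<le> 2 h. Dividing h^(\<alpha>+1) h^(n+1) by \<eta> = h/4 leaves the claimed
  power, and h \<le> 2 gives \<eta> \<le> 1/2.\<close>

lemma weighted_carleson_box:
  fixes \<alpha> :: real
  assumes \<alpha>: "-1 < \<alpha>"
  obtains C where "0 < C" "\<And>a h. norm (a :: complex ^ 'n) < 1 \<Longrightarrow> 0 < h \<Longrightarrow> h \<le> 2 \<Longrightarrow>
    (\<integral>\<^sup>+z. indicator (carleson_box a h) z * ennreal ((1 - (norm z)\<^sup>2) powr \<alpha>) \<partial>lborel) \<le>
      ennreal (C * h powr (\<alpha> + real CARD('n) + 1))"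
proof -
  let ?n = "CARD('n)"
  obtain V where V: "0 < V" "\<And>a h. norm (a :: complex ^ 'n) < 1 \<Longrightarrow> 0 < h \<Longrightarrow>
    emeasure lborel (carleson_box a h) \<le> ennreal (V * h ^ (?n + 1))"
    using emeasure_carleson_box[where 'n = 'n] by blast
  define A where "A = 4 ^ ?n * 2 powr \<bar>\<alpha>\<bar> * (2 powr (\<alpha> + 1) / (\<alpha> + 1)) * V * 2 ^ (?n + 1)"
  have A: "0 < A" unfolding A_def using \<alpha> V by simp
  define C where "C = 2 powr \<bar>\<alpha>\<bar> * (4 * A)"
  have "(\<integral>\<^sup>+z. indicator (carleson_box a h) z * ennreal ((1 - (norm z)\<^sup>2) powr \<alpha>) \<partial>lborel) \<le>
      ennreal (C * h powr (\<alpha> + real ?n + 1))" if a: "norm a < 1" and h: "0 < h" "h \<le> 2" for a :: "complex ^ 'n" and h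
  proof -
    define \<eta> where "\<eta> = h / 4"
    have \<eta>: "0 < \<eta>" "\<eta> \<le> 1 / 2" "\<eta> \<le> h" using h by (auto simp: \<eta>_def)
    let ?S = "carleson_box a h" and ?S' = "carleson_box a (2 * h)"
  let ?c = "4 ^ ?n * 2 powr \<bar>\<alpha>\<bar> * ((2 * h) powr (\<alpha> + 1) / (\<alpha> + 1))"
    let ?I = "\<integral>\<^sup>+z. indicator ?S z * ennreal ((1 - norm z) powr \<alpha>) \<partial>lborel"
    have "ennreal \<eta> * ?I \<le> ennreal (?c) * emeasure lborel ?S'"
    proof (rule weighted_integral_dilation[OF \<alpha> \<eta>(1,2)])
      show "?S \<in> sets borel" "?S' \<in> sets borel" by measurable
      show "norm z < 1" if "z \<in> ?S" for z using that by (simp add: carleson_box_def)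
      show "1 - norm x \<le> 2 * h" if "x \<in> ?S'" for x
        using that one_minus_hermitian_bounds(1)[of x a] a by (auto simp: carleson_box_def)
      fix z t assume z: "z \<in> ?S" and t: "0 \<le> t" "t \<le> \<eta>"
      have z1: "norm z < 1" and zh: "cmod (1 - hermitian z a) \<le> h" using z by (auto simp: carleson_box_def)
      have t1: "0 \<le> 1 - t" "1 - t \<le> 1" using t \<eta> by auto
      have "norm ((1 - t) *\<^sub>R z) < 1" using z1 t1 mult_left_le_one_le[of "norm z" "1 - t"] by auto
      moreover have "cmod (1 - hermitian ((1 - t) *\<^sub>R z) a) \<le> 2 * h"
      proof -
        have eq: "1 - hermitian ((1 - t) *\<^sub>R z) a = (1 - hermitian z a) + of_real t * hermitian z a"
          by (simp add: hermitian_simps algebra_simps)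
        have "cmod (1 - hermitian ((1 - t) *\<^sub>R z) a) \<le> h + t * cmod (hermitian z a)"
          unfolding eq using norm_triangle_ineq[of "1 - hermitian z a" "of_real t * hermitian z a"] zh t by (simp add: norm_mult)
        moreover have "cmod (hermitian z a) \<le> 1"
          using cmod_hermitian_le[of z a] mult_le_one[of "norm z" "norm a"] z1 a by simp
        hence "t * cmod (hermitian z a) \<le> h * 1" using t \<eta> by (intro mult_mono) auto
        ultimately show ?thesis by linarith
      qed
      ultimately show "(1 - t) *\<^sub>R z \<in> ?S'" by (simp add: carleson_box_def)
    qed
    also have "\<dots> \<le> ennreal (?c) * ennreal (V * (2 * h) ^ (?n + 1))"
      using V(2)[OF a, of "2 * h"] h by (intro mult_left_mono) auto
    also have "\<dots> = ennreal (?c * (V * (2 * h) ^ (?n + 1)))"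
      using \<alpha> by (subst ennreal_mult') auto
    also have "?c * (V * (2 * h) ^ (?n + 1)) =
        A * (h powr (\<alpha> + 1) * h ^ (?n + 1))"
      using h by (simp add: A_def powr_mult power_mult_distrib)
    also have "h powr (\<alpha> + 1) * h ^ (?n + 1) = h * h powr (\<alpha> + real ?n + 1)"
    proof -
      have "h powr (\<alpha> + 1) * h ^ (?n + 1) = h powr (\<alpha> + 1) * h powr real (?n + 1)"
        using h by (subst powr_realpow) auto
      also have "\<dots> = h powr (1 + (\<alpha> + real ?n + 1))" by (simp add: powr_add[symmetric] algebra_simps)
      also have "\<dots> = h powr 1 * h powr (\<alpha> + real ?n + 1)" by (rule powr_add)
      finally show ?thesis using h by simp
    qed
    finally have "ennreal (1 / \<eta>) * (ennreal \<eta> * ?I) \<le> ennreal (1 / \<eta>) * ennreal (A * (h * h powr (\<alpha> + real ?n + 1)))"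
      by (rule mult_left_mono) simp
    also have "ennreal (1 / \<eta>) * (ennreal \<eta> * ?I) = ?I"
      using \<eta> by (subst mult.assoc[symmetric], subst ennreal_mult'[symmetric]) auto
    also have "ennreal (1 / \<eta>) * ennreal (A * (h * h powr (\<alpha> + real ?n + 1))) = ennreal (4 * A * h powr (\<alpha> + real ?n + 1))"
      using \<eta> h by (subst ennreal_mult'[symmetric]) (auto simp: \<eta>_def mult.assoc)
    finally have I: "?I \<le> ennreal (4 * A * h powr (\<alpha> + real ?n + 1))" .
    have "(\<integral>\<^sup>+z. indicator ?S z * ennreal ((1 - (norm z)\<^sup>2) powr \<alpha>) \<partial>lborel) \<le>
        (\<integral>\<^sup>+z. ennreal (2 powr \<bar>\<alpha>\<bar>) * (indicator ?S z * ennreal ((1 - norm z) powr \<alpha>)) \<partial>lborel)"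
    proof (rule nn_integral_mono)
      fix z :: "complex ^ 'n"
      have "(1 - (norm z)\<^sup>2) powr \<alpha> \<le> 2 powr \<bar>\<alpha>\<bar> * (1 - norm z) powr \<alpha>" if "z \<in> ?S"
        using one_minus_sq_bounds[of "norm z"] that by (intro powr_compare) (auto simp: carleson_box_def)
      thus "indicator ?S z * ennreal ((1 - (norm z)\<^sup>2) powr \<alpha>) \<le> ennreal (2 powr \<bar>\<alpha>\<bar>) * (indicator ?S z * ennreal ((1 - norm z) powr \<alpha>))"
        by (auto simp: ennreal_mult[symmetric] ennreal_leI split: split_indicator)
    qed
    also have "\<dots> = ennreal (2 powr \<bar>\<alpha>\<bar>) * ?I" by (rule nn_integral_cmult) measurable
    also have "\<dots> \<le> ennreal (2 powr \<bar>\<alpha>\<bar>) * ennreal (4 * A * h powr (\<alpha> + real ?n + 1))"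
      by (intro mult_left_mono I) simp
    also have "\<dots> = ennreal (C * h powr (\<alpha> + real ?n + 1))"
      by (subst ennreal_mult'[symmetric]) (simp_all add: C_def mult.assoc)
    finally show ?thesis .
  qed
  moreover have "0 < C" using A by (simp add: C_def)
  ultimately show thesis using that by blast
qed

section \<open>Dyadic decomposition in the critical case\<close>

lemma dyadic_level:
  fixes m e :: real
  assumes "e \<le> m" "m \<le> 2" "(1 / 2) ^ K < e"
  obtains k where "k \<le> K" "(1 / 2) ^ k < m" "m \<le> 2 * (1 / 2) ^ k"
proof -
  \<comment> \<open>Minimality gives the upper bound through the level before \<open>k\<close>; at k
    = 0 the assumption m \<le> 2 takes its place.\<close>
  define k where "k = (LEAST k. (1 / 2) ^ k < m)"
  have K: "(1 / 2) ^ K < m" using assms by linarith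
  have k: "(1 / 2) ^ k < m" unfolding k_def by (rule LeastI[of "\<lambda>k. (1 / 2) ^ k < m", OF K])
  have "k \<le> K" unfolding k_def by (rule Least_le[of "\<lambda>k. (1 / 2) ^ k < m", OF K])
  moreover have "m \<le> 2 * (1 / 2) ^ k"
  proof (cases k)
    case (Suc j)
    have "\<not> (1 / 2) ^ j < m" using not_less_Least[of j "\<lambda>k. (1 / 2) ^ k < m"] Suc by (simp add: k_def)
    thus ?thesis using Suc by simp
  qed (use assms in simp)
  ultimately show thesis using that k by blast
qed

text \<open>In the critical case all dyadic levels contribute alike: a box of size h has weighted
  mass at most a constant times h^\<gamma>, and the kernel at that level is of order h^(-\<gamma>).
  Levels below 1 - |a| do not occur, so the logarithm counts the levels.\<close>

lemma forelli_rudin: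
  fixes \<gamma> :: real
  assumes \<gamma>: "real CARD('n) < \<gamma>"
  obtains C where "0 < C" "\<And>a. norm (a :: complex ^ 'n) < 1 \<Longrightarrow>
    (\<integral>\<^sup>+z. indicator unit_ball z * ennreal ((1 - (norm z)\<^sup>2) powr (\<gamma> - real CARD('n) - 1) *
       cmod (1 - hermitian z a) powr (- \<gamma>)) \<partial>lborel) \<le> ennreal (C * ln (2 / (1 - (norm a)\<^sup>2)))"
proof -
  let ?n = "CARD('n)"
  define \<alpha> where "\<alpha> = \<gamma> - real ?n - 1"
  have \<alpha>: "-1 < \<alpha>" using \<gamma> by (simp add: \<alpha>_def)
  have \<gamma>0: "0 < \<gamma>" using \<gamma> by linarith
  obtain C where C: "0 < C" "\<And>a h. norm (a :: complex ^ 'n) < 1 \<Longrightarrow> 0 < h \<Longrightarrow> h \<le> 2 \<Longrightarrow>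
    (\<integral>\<^sup>+z. indicator (carleson_box a h) z * ennreal ((1 - (norm z)\<^sup>2) powr \<alpha>) \<partial>lborel) \<le>
      ennreal (C * h powr (\<alpha> + real ?n + 1))"
    using weighted_carleson_box[OF \<alpha>, where 'n = 'n] by blast
  have exp: "\<alpha> + real ?n + 1 = \<gamma>" by (simp add: \<alpha>_def)
  define B where "B = C * 2 powr \<gamma> * (4 / ln 2)"
  have "(\<integral>\<^sup>+z. indicator unit_ball z * ennreal ((1 - (norm z)\<^sup>2) powr \<alpha> * cmod (1 - hermitian z a) powr (- \<gamma>)) \<partial>lborel)
      \<le> ennreal (B * ln (2 / (1 - (norm a)\<^sup>2)))" if a: "norm a < 1" for a :: "complex ^ 'n"
  proof -
    let ?e = "1 - norm a" and ?L = "ln (2 / (1 - (norm a)\<^sup>2))"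
  let ?w = "\<lambda>z. ennreal ((1 - (norm z)\<^sup>2) powr \<alpha> * cmod (1 - hermitian z a) powr (- \<gamma>))"
    and ?b = "\<lambda>k z. indicator (carleson_box a (2 * (1 / 2) ^ k)) z * ennreal ((1 - (norm z)\<^sup>2) powr \<alpha>)"
    and ?d = "\<lambda>k. ennreal (((1 / 2) ^ k) powr (- \<gamma>))"
    note sq = one_minus_sq_bounds[of "norm a"]
    have L: "ln 2 \<le> ?L" using log_weight_ge_ln2[of "norm a"] a by simp
    \<comment> \<open>The additional 1 makes 2^(-K) strictly smaller than 1 - |a|.\<close>
    define K where "K = nat \<lceil>log 2 (1 / ?e)\<rceil> + 1"
    have e: "0 < ?e" "?e \<le> 1" using a by auto
    have lg: "0 \<le> log 2 (1 / ?e)" using e by simp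
    have "log 2 (1 / ?e) < real K" unfolding K_def using lg by linarith
    hence "1 / ?e < 2 powr real K" using e by (simp add: log_less_iff)
    hence K: "(1 / 2) ^ K < ?e" using e by (simp add: powr_realpow power_divide field_simps)
    have "real (K + 1) \<le> 3 + log 2 (1 / ?e)" unfolding K_def using lg by linarith
    also have "log 2 (1 / ?e) \<le> ?L / ln 2"
    proof -
      have "1 / ?e \<le> 2 / (1 - (norm a)\<^sup>2)" using sq e by (simp add: field_simps)
      hence "ln (1 / ?e) \<le> ?L" using e sq a by (subst ln_le_cancel_iff) auto
      thus ?thesis unfolding log_def by (intro divide_right_mono) auto
    qed
    \<comment> \<open>Since L \<ge> ln 2, the constant 3 is at most 3 L / ln 2.\<close>
    also have "3 + ?L / ln 2 \<le> 4 / ln 2 * ?L" using L by (simp add: field_simps)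
    finally have K1: "real (K + 1) \<le> 4 / ln 2 * ?L" by simp
    have "(\<integral>\<^sup>+z. indicator unit_ball z * ?w z \<partial>lborel) \<le>
       (\<integral>\<^sup>+z. (\<Sum>k\<le>K. ?d k *
           (?b k z)) \<partial>lborel)"
    proof (rule nn_integral_mono)
      fix z :: "complex ^ 'n"
      let ?f = "\<lambda>k. ?d k *
           (?b k z)"
      show "indicator unit_ball z * ?w z \<le> (\<Sum>k\<le>K. ?f k)"
      proof (cases "norm z < 1")
        case True
        let ?m = "cmod (1 - hermitian z a)"
        have m: "?e \<le> ?m" "?m \<le> 2" using one_minus_hermitian_bounds[OF True a] by auto
        obtain k where k: "k \<le> K" "(1 / 2) ^ k < ?m" "?m \<le> 2 * (1 / 2) ^ k"
          by (rule dyadic_level[OF m K])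
        have "?m powr (- \<gamma>) \<le> ((1 / 2) ^ k) powr (- \<gamma>)"
          using k(2) \<gamma>0 by (intro powr_mono2') auto
        hence "(1 - (norm z)\<^sup>2) powr \<alpha> * ?m powr (- \<gamma>) \<le> (1 - (norm z)\<^sup>2) powr \<alpha> * ((1 / 2) ^ k) powr (- \<gamma>)"
          by (intro mult_left_mono) auto
        hence "ennreal ((1 - (norm z)\<^sup>2) powr \<alpha> * ?m powr (- \<gamma>)) \<le>
            ?d k * ennreal ((1 - (norm z)\<^sup>2) powr \<alpha>)"
          by (subst ennreal_mult'[symmetric]) (auto intro!: ennreal_leI simp: mult.commute)
        also have "\<dots> = ?f k" using k True by (simp add: carleson_box_def)
        also have "\<dots> \<le> (\<Sum>k\<le>K. ?f k)" using k(1) by (intro member_le_sum) auto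
        finally show ?thesis using True by simp
      qed simp
    qed
    also have "\<dots> = (\<Sum>k\<le>K. \<integral>\<^sup>+z. ?d k *
           (?b k z) \<partial>lborel)"
      by (rule nn_integral_sum) measurable
    also have "\<dots> = (\<Sum>k\<le>K. ?d k *
         (\<integral>\<^sup>+z. ?b k z \<partial>lborel))"
      by (intro sum.cong refl nn_integral_cmult) measurable
    also have "\<dots> \<le> (\<Sum>k\<le>K. ennreal (C * 2 powr \<gamma>))"
    proof (rule sum_mono)
      fix k
      have d: "0 < 2 * (1 / 2 :: real) ^ k" "2 * (1 / 2 :: real) ^ k \<le> 2" by (auto simp: power_le_one)
      have "?d k *
         (\<integral>\<^sup>+z. ?b k z \<partial>lborel) \<le>
         ?d k * ennreal (C * (2 * (1 / 2) ^ k) powr \<gamma>)"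
        using C(2)[OF a d] unfolding exp by (rule mult_left_mono) simp
      also have "\<dots> = ennreal (((1 / 2) ^ k) powr (- \<gamma>) * (C * (2 * (1 / 2) ^ k) powr \<gamma>))"
        by (rule ennreal_mult'[symmetric]) simp
      also have "((1 / 2) ^ k) powr (- \<gamma>) * (C * (2 * (1 / 2) ^ k) powr \<gamma>) = C * 2 powr \<gamma>"
        by (subst powr_mult) (simp_all add: powr_minus)
      finally show "?d k *
         (\<integral>\<^sup>+z. ?b k z \<partial>lborel) \<le>
         ennreal (C * 2 powr \<gamma>)" .
    qed
    also have "\<dots> = ennreal (real (K + 1)) * ennreal (C * 2 powr \<gamma>)"
      by (simp add: ennreal_of_nat_eq_real_of_nat del: of_nat_Suc)
    also have "\<dots> = ennreal (real (K + 1) * (C * 2 powr \<gamma>))" by (rule ennreal_mult'[symmetric]) simp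
    also have "\<dots> \<le> ennreal (4 / ln 2 * ?L * (C * 2 powr \<gamma>))"
      using K1 C by (intro ennreal_leI mult_right_mono) auto
    finally show ?thesis by (simp add: B_def mult_ac)
  qed
  moreover have "0 < B" using C by (simp add: B_def)
  ultimately show thesis using that unfolding \<alpha>_def by blast
qed

section \<open>Logarithmic test functions\<close>

lemma ennreal_powr_ennreal: "0 \<le> x \<Longrightarrow> ennreal_powr (ennreal x) a = ennreal (x powr a)"
  by (simp add: ennreal_powr_def)

lemma ennreal_powr_mono:
  assumes "0 \<le> a" "x \<le> y" shows "ennreal_powr x a \<le> ennreal_powr y a"
proof (cases "y = top")
  case False
  hence "x < top" "y < top" using assms by (auto simp: less_top top_unique order.strict_trans1)
  thus ?thesis using assms unfolding ennreal_powr_def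
    by (auto intro!: ennreal_leI powr_mono2 enn2real_mono)
qed (simp add: ennreal_powr_def)

lemma ennreal_powr_inverse:
  assumes "0 < a" shows "ennreal_powr (ennreal_powr x a) (1 / a) = x"
proof (cases "x = top")
  case False
  thus ?thesis using assms unfolding ennreal_powr_def by (simp add: powr_powr less_top)
qed (simp add: ennreal_powr_def)

section \<open>Derivatives of the logarithmic kernel\<close>

lemma hermitian_has_derivative:
  "((\<lambda>z. hermitian z a) has_derivative (\<lambda>v. hermitian v a)) (at z)"
proof -
  have "bounded_linear (\<lambda>z. hermitian z a)"
  proof (rule bounded_linear_intro[of _ "norm a"])
    show "hermitian (r *\<^sub>R x) a = r *\<^sub>R hermitian x a" for r x
      unfolding hermitian_scaleR_left by (simp add: scaleR_conv_of_real)
  qed (simp_all add: hermitian_add_left cmod_hermitian_le)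
  thus ?thesis by (rule bounded_linear_imp_has_derivative)
qed

lemma one_minus_hermitian_compose_has_derivative:
  assumes "(\<phi> has_field_derivative d) (at (1 - hermitian z a))"
  shows "((\<lambda>z. \<phi> (1 - hermitian z a)) has_derivative (\<lambda>v. - d * hermitian v a)) (at z)"
proof -
  have "((\<lambda>z. 1 - hermitian z a) has_derivative (\<lambda>v. 0 - hermitian v a)) (at z)"
    by (intro has_derivative_diff has_derivative_const hermitian_has_derivative)
  from has_derivative_compose[OF this, of \<phi> "(*) d"] assms
  show ?thesis by (simp add: has_field_derivative_def)
qed

lemma partial_deriv_one_minus_hermitian_compose:
  assumes "(\<phi> has_field_derivative d) (at (1 - hermitian z a))"
  shows "partial_deriv j (\<lambda>z. \<phi> (1 - hermitian z a)) z = - d * cnj (a $ j)"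
proof -
  have "hermitian (axis j 1) a = cnj (a $ j)"
    unfolding hermitian_def by (rule gradient_axis)
  thus ?thesis
    using partial_deriv_eq[OF one_minus_hermitian_compose_has_derivative[OF assms], of j]
    by (simp add: hermitian_simps)
qed

text \<open>The logarithm of 4 / (1 - <z, a>). Since |1 - <z, a>| < 2, the constant 4 keeps the real
  part above ln 2, which later absorbs an additive error.\<close>

definition log_kernel :: "complex ^ 'n \<Rightarrow> complex ^ 'n \<Rightarrow> complex" where
  "log_kernel a z = of_real (ln 4) - Ln (1 - hermitian z a)"

lemma Re_one_minus_hermitian_pos:
  assumes "norm z < 1" "norm a < 1" shows "0 < Re (1 - hermitian z a)"
proof -
  have "Re (hermitian z a) \<le> cmod (hermitian z a)" by (rule complex_Re_le_cmod)
  also have "\<dots> \<le> norm z * norm a" by (rule cmod_hermitian_le)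
  also have "\<dots> \<le> norm z" using assms by (intro mult_left_le) auto
  finally show ?thesis using assms by simp
qed

lemma log_kernel_field_derivative:
  assumes "norm z < 1" "norm a < 1"
  shows "((\<lambda>u. of_real (ln 4) - Ln u) has_field_derivative - (1 / (1 - hermitian z a))) (at (1 - hermitian z a))"
  using Re_one_minus_hermitian_pos[OF assms]
  by (auto intro!: derivative_eq_intros simp: complex_nonpos_Reals_iff field_simps)

lemma holomorphic_log_kernel:
  assumes a: "norm a < 1" shows "holomorphic_on_ball (log_kernel a)"
  unfolding holomorphic_on_ball_def
proof
  fix z :: "complex ^ 'a" assume "z \<in> unit_ball"
  hence z: "norm z < 1" by simp
  show "\<exists>D. (log_kernel a has_derivative D) (at z) \<and> (\<forall>c v. D (c *s v) = c * D v)"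
    unfolding log_kernel_def[abs_def]
    by (intro exI conjI, rule one_minus_hermitian_compose_has_derivative[OF log_kernel_field_derivative[OF z a]])
       (simp add: hermitian_simps)
qed

text \<open>Each further derivative raises the power of the denominator and multiplies by a
  conjugate coordinate of \<open>a\<close>. The constant obtained is (k - 1)! times k such
  coordinates; k! is a convenient bound.\<close>

lemma foldr_partial_deriv_log_kernel:
  fixes a :: "complex ^ 'n"
  assumes a: "norm a < 1" and js: "js \<noteq> []"
  shows "\<exists>c. cmod c \<le> fact (length js) \<and> (\<forall>z. norm z < 1 \<longrightarrow>
    foldr partial_deriv js (log_kernel a) z = c / (1 - hermitian z a) ^ length js)"
  using js
proof (induction js)
  case (Cons j js)
  have aj: "cmod (a $ j) \<le> 1" by (rule order.trans[OF Finite_Cartesian_Product.norm_nth_le less_imp_le[OF a]])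
  show ?case
  proof (cases "js = []")
    case True
    have "partial_deriv j (log_kernel a) z = cnj (a $ j) / (1 - hermitian z a)" if "norm z < 1" for z
      unfolding log_kernel_def[abs_def]
      using partial_deriv_one_minus_hermitian_compose[OF log_kernel_field_derivative[OF that a], of j] by simp
    thus ?thesis using True aj by (intro exI[of _ "cnj (a $ j)"]) simp
  next
    case False
    let ?k = "length js"
    obtain c where c: "cmod c \<le> fact ?k" "\<And>z. norm z < 1 \<Longrightarrow>
        foldr partial_deriv js (log_kernel a) z = c / (1 - hermitian z a) ^ ?k"
      using Cons.IH[OF False] by blast
    have "foldr partial_deriv (j # js) (log_kernel a) z = (of_nat ?k * c * cnj (a $ j)) / (1 - hermitian z a) ^ Suc ?k"
      if z: "norm z < 1" for z
    proof -
      have nz: "1 - hermitian z a \<noteq> 0" using one_minus_hermitian_bounds(3)[OF z a] by auto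
      have "foldr partial_deriv (j # js) (log_kernel a) z = partial_deriv j (\<lambda>z. c / (1 - hermitian z a) ^ ?k) z"
        using partial_deriv_cong[OF c(2) z] by simp
      also have "\<dots> = - (- (of_nat ?k * c / (1 - hermitian z a) ^ Suc ?k)) * cnj (a $ j)"
      proof (rule partial_deriv_one_minus_hermitian_compose)
        obtain i where i: "?k = Suc i" using False by (cases js) auto
        show "((\<lambda>u. c / u ^ ?k) has_field_derivative - (of_nat ?k * c / (1 - hermitian z a) ^ Suc ?k)) (at (1 - hermitian z a))"
        proof -
          let ?w = "1 - hermitian z a"
          have "((\<lambda>u. c / u ^ Suc i) has_field_derivative
              (0 * ?w ^ Suc i - c * (of_nat (Suc i) * ?w ^ i)) / (?w ^ Suc i * ?w ^ Suc i)) (at ?w)"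
          proof (rule DERIV_divide)
            show "((\<lambda>u. u ^ Suc i) has_field_derivative of_nat (Suc i) * ?w ^ i) (at ?w)"
              by (rule derivative_eq_intros refl)+ simp
          qed (use nz in simp_all)
          moreover have "(0 * w ^ Suc i - c * (of_nat (Suc i) * w ^ i)) / (w ^ Suc i * w ^ Suc i) =
              - (of_nat (Suc i) * c / w ^ Suc (Suc i))" if "w \<noteq> 0" for w :: complex
            using that by (simp add: field_simps)
          ultimately show ?thesis unfolding i using nz by (simp add: mult_ac)
        qed
      qed
      finally show ?thesis by simp
    qed
    moreover have "cmod (of_nat ?k * c * cnj (a $ j)) \<le> fact (length (j # js))"
    proof -
      have "cmod (of_nat ?k * c * cnj (a $ j)) \<le> real ?k * fact ?k * 1"
        unfolding norm_mult using c(1) aj by (intro mult_mono) auto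
      also have "\<dots> \<le> fact (length (j # js))" by (simp add: algebra_simps)
      finally show ?thesis .
    qed
    ultimately show ?thesis by (metis length_Cons)
  qed
qed simp

lemma multi_deriv_log_kernel:
  fixes a :: "complex ^ 'n"
  assumes a: "norm a < 1" and m: "sum m UNIV = k" "0 < k"
  shows "\<exists>c. cmod c \<le> fact k \<and> (\<forall>z. norm z < 1 \<longrightarrow> multi_deriv m (log_kernel a) z = c / (1 - hermitian z a) ^ k)"
proof -
  let ?js = "concat (map (\<lambda>j. replicate (m j) j) coordinate_list) :: 'n list"
  have "length ?js = sum_list (map m coordinate_list)" by (simp add: length_concat o_def)
  also have "\<dots> = k" using coordinate_list[where 'n = 'n] m by (simp add: sum_list_distinct_conv_sum_set)
  finally have "length ?js = k" .
  moreover from this m have "?js \<noteq> []" by fastforce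
  ultimately show ?thesis using foldr_partial_deriv_log_kernel[OF a, of ?js] unfolding multi_deriv_eq_foldr by simp
qed

lemma multi_deriv_zero:
  assumes "sum m UNIV = 0" shows "multi_deriv m f = f"
proof -
  have "m j = 0" for j using assms by (simp add: sum_eq_0_iff)
  hence "concat (map (\<lambda>j. replicate (m j) j) coordinate_list) = []" by simp
  hence "multi_deriv m f = foldr partial_deriv [] f" unfolding multi_deriv_eq_foldr by (rule arg_cong)
  thus ?thesis by simp
qed

lemma besov_deriv_measurable:
  fixes f :: "complex ^ 'n \<Rightarrow> complex"
  assumes "holomorphic_on_ball f"
  shows "besov_deriv N m f \<in> borel_measurable invariant_measure"
proof -
  have "continuous_on unit_ball (besov_deriv N m f)"
    unfolding besov_deriv_def[abs_def]
    by (intro continuous_intros holomorphic_on_ball_imp_continuous_on holomorphic_multi_deriv assms)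
  hence "besov_deriv N m f \<in> borel_measurable (restrict_space borel unit_ball)"
    by (rule borel_measurable_continuous_on_restrict)
  also have "borel_measurable (restrict_space borel unit_ball) =
      (borel_measurable invariant_measure :: (complex ^ 'n \<Rightarrow> complex) set)"
    by (rule measurable_cong_sets) (simp_all add: invariant_measure_def ball_volume_def sets_restrict_space)
  finally show ?thesis .
qed

text \<open>The condition N > n/p says that \<gamma> = p N exceeds n. The power p N of the defect,
  the invariant density and the kernel then form the critical Forelli-Rudin integrand. Derivatives
  of lower order at 0 are bounded and absorbed by \<open>ln2_le_log_powr\<close>.\<close>

lemma log_kernel_besov:
  fixes p :: real and N :: nat
  assumes p: "1 \<le> p" and N: "0 < N" "real CARD('n) / p < real N"
  obtains C where "0 < C" "\<And>a :: complex ^ 'n. norm a < 1 \<Longrightarrow> log_kernel a \<in> besov_space p"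
    "\<And>a :: complex ^ 'n. norm a < 1 \<Longrightarrow>
      besov_norm N p (log_kernel a) \<le> ennreal (C * ln (2 / (1 - (norm a)\<^sup>2)) powr (1 / p))"
proof -
  define \<gamma> where "\<gamma> = p * real N"
  have \<gamma>: "real CARD('n) < \<gamma>" using p N by (simp add: \<gamma>_def field_simps)
  obtain F where F: "0 < F" "\<And>a. norm (a :: complex ^ 'n) < 1 \<Longrightarrow>
    (\<integral>\<^sup>+z. indicator unit_ball z * ennreal ((1 - (norm z)\<^sup>2) powr (\<gamma> - real CARD('n) - 1) *
       cmod (1 - hermitian z a) powr (- \<gamma>)) \<partial>lborel) \<le> ennreal (F * ln (2 / (1 - (norm a)\<^sup>2)))"
    using forelli_rudin[OF \<gamma>] by blast
  let ?v = "measure lborel (unit_ball :: (complex ^ 'n) set)"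
  have v: "0 < ?v" by (rule unit_ball_volume)
  define B where "B = fact N * (F / ?v) powr (1 / p)"
  have B: "0 \<le> B" by (simp add: B_def)
  have Lp: "Lp_norm p invariant_measure (besov_deriv N m (log_kernel a)) \<le>
      ennreal (B * ln (2 / (1 - (norm a)\<^sup>2)) powr (1 / p))"
    if a: "norm a < 1" and m: "sum m UNIV = N" for a :: "complex ^ 'n" and m
  proof -
    let ?L = "ln (2 / (1 - (norm a)\<^sup>2))"
    have L: "0 < ?L" by (rule less_le_trans[OF _ log_weight_ge_ln2[OF norm_ge_zero a]]) simp
    obtain c where c: "cmod c \<le> fact N" "\<And>z. norm z < 1 \<Longrightarrow> multi_deriv m (log_kernel a) z = c / (1 - hermitian z a) ^ N"
      using multi_deriv_log_kernel[OF a m N(1)] by blast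
    let ?g = "multi_deriv m (log_kernel a)"
  let ?k = "\<lambda>z. indicator unit_ball z * ennreal ((1 - (norm z)\<^sup>2) powr (\<gamma> - real CARD('n) - 1) * cmod (1 - hermitian z a) powr (- \<gamma>))"
    and ?u = "\<lambda>z. cmod (besov_deriv N m (log_kernel a) z)"
    have g: "holomorphic_on_ball ?g" by (intro holomorphic_multi_deriv holomorphic_log_kernel a)
    let ?I = "\<integral>\<^sup>+z. ennreal (?u z powr p) \<partial>invariant_measure"
    have eq: "indicator unit_ball z * ennreal (?u z powr p) =
        indicator unit_ball z * ennreal (((1 - (norm z)\<^sup>2) ^ N * cmod (?g z)) powr p * 1)" for z
      unfolding besov_deriv_def by (rule indicator_weighted_power)
    have "?I = ennreal (1 / ?v) * (\<integral>\<^sup>+z. indicator unit_ball z * ennreal (?u z powr p) *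
        ennreal (invariant_density z) \<partial>lborel)"
      by (rule nn_integral_invariant_measure, unfold eq, rule weighted_power_measurable[OF g]) simp
    also have "\<dots> \<le> ennreal (1 / ?v) * (\<integral>\<^sup>+z. ennreal (fact N powr p) * (?k z) \<partial>lborel)"
    proof (intro mult_left_mono nn_integral_mono)
      fix z :: "complex ^ 'n"
      show "indicator unit_ball z * ennreal (?u z powr p) * ennreal (invariant_density z) \<le>
        ennreal (fact N powr p) * (?k z)"
      proof (cases "norm z < 1")
        case True
        let ?x = "1 - (norm z)\<^sup>2" and ?m = "cmod (1 - hermitian z a)"
        have x: "0 < ?x" using one_minus_sq_bounds(3)[of "norm z"] True by simp
        have m: "0 < ?m" by (rule one_minus_hermitian_bounds(3)[OF True a])
        have "?u z = ?x ^ N * (cmod c / ?m ^ N)"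
          unfolding besov_deriv_def norm_mult norm_of_real c(2)[OF True] norm_divide norm_power
          using x by (simp del: of_real_power)
        also have "\<dots> \<le> ?x ^ N * (fact N / ?m ^ N)"
          using x c(1) by (intro mult_left_mono divide_right_mono) auto
        finally have "?u z powr p \<le> (?x ^ N * (fact N / ?m ^ N)) powr p"
          using p by (intro powr_mono2) auto
        also have "\<dots> = fact N powr p * (?x powr \<gamma> * ?m powr (- \<gamma>))"
          using x m unfolding powr_realpow[OF x, symmetric] powr_realpow[OF m, symmetric] \<gamma>_def
          by (simp add: powr_mult powr_divide powr_powr powr_minus field_simps)
        finally have "?u z powr p * invariant_density z \<le>
            fact N powr p * (?x powr \<gamma> * ?m powr (- \<gamma>)) * ?x powr (- real CARD('n) - 1)"
          unfolding invariant_density_def by (rule mult_right_mono) simp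
        also have "\<dots> = fact N powr p * (?x powr (\<gamma> - real CARD('n) - 1) * ?m powr (- \<gamma>))"
          using powr_add[of ?x \<gamma> "- real CARD('n) - 1"] by (simp add: algebra_simps)
        finally have "ennreal (?u z powr p * invariant_density z) \<le>
            ennreal (fact N powr p * (?x powr (\<gamma> - real CARD('n) - 1) * ?m powr (- \<gamma>)))" by (rule ennreal_leI)
        thus ?thesis using True by (simp add: ennreal_mult' mult.assoc)
      qed simp
    qed simp
    also have "\<dots> = ennreal (1 / ?v) * (ennreal (fact N powr p) * (\<integral>\<^sup>+z. ?k z \<partial>lborel))"
    proof (intro arg_cong[where f = "\<lambda>x. ennreal (1 / ?v) * x"] nn_integral_cmult)
      have [measurable]: "unit_ball \<in> sets (borel :: (complex ^ 'n) measure)" by simp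
      have [measurable]: "(\<lambda>z. hermitian z a) \<in> borel_measurable borel"
        by (intro borel_measurable_continuous_onI continuous_intros)
      show "(\<lambda>z. ?k z) \<in> borel_measurable lborel" by measurable
    qed
    also have "\<dots> \<le> ennreal (1 / ?v) * (ennreal (fact N powr p) * ennreal (F * ?L))"
      by (intro mult_left_mono F(2) a) auto
    also have "\<dots> = ennreal (fact N powr p * (F / ?v * ?L))"
      using v F(1) L by (simp add: ennreal_mult'[symmetric] mult_ac)
    finally have "Lp_norm p invariant_measure (besov_deriv N m (log_kernel a)) \<le> ennreal_powr (ennreal (fact N powr p * (F / ?v * ?L))) (1 / p)"
      unfolding Lp_norm_def using p by (intro ennreal_powr_mono) auto
    also have "\<dots> = ennreal ((fact N powr p * (F / ?v * ?L)) powr (1 / p))"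
      using v F(1) L by (intro ennreal_powr_ennreal) auto
    also have "(fact N powr p * (F / ?v * ?L)) powr (1 / p) = B * ?L powr (1 / p)"
    proof -
      define X where "X = F / ?v"
      have X: "0 < X" unfolding X_def using v F(1) by simp
      have "(fact N powr p * (X * ?L)) powr (1 / p) = (fact N powr p) powr (1 / p) * (X powr (1 / p) * ?L powr (1 / p))"
        using X L by (simp only: powr_mult)
      also have "((fact N :: real) powr p) powr (1 / p) = fact N" using p by (simp add: powr_powr)
      finally show ?thesis unfolding B_def X_def[symmetric] by (simp only: mult.assoc)
    qed
    finally show ?thesis .
  qed
  have low: "cmod (multi_deriv m (log_kernel a) 0) \<le> ln 4 + fact N" if a: "norm a < 1" and m: "sum m UNIV \<le> N - 1"
    for a :: "complex ^ 'n" and m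
  proof (cases "sum m UNIV = 0")
    case True
    thus ?thesis by (simp add: multi_deriv_zero log_kernel_def)
  next
    case False
    then obtain c where c: "cmod c \<le> fact (sum m UNIV)" "multi_deriv m (log_kernel a) 0 = c / (1 - hermitian 0 a) ^ sum m UNIV"
      using multi_deriv_log_kernel[OF a refl, of m] by fastforce
    have "(fact (sum m UNIV) :: real) \<le> fact N" using m by (intro fact_mono) simp
    thus ?thesis using c by (simp add: add_increasing)
  qed
  define M1 where "M1 = real (card {m :: 'n \<Rightarrow> nat. sum m UNIV \<le> N - 1})"
  define M2 where "M2 = real (card {m :: 'n \<Rightarrow> nat. sum m UNIV = N})"
  have M: "0 \<le> M1" "0 \<le> M2" by (simp_all add: M1_def M2_def)
  define C where "C = M1 * (ln 4 + fact N) / ln 2 + M2 * B + 1"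
  have bound: "besov_norm N p (log_kernel a) \<le> ennreal (C * ln (2 / (1 - (norm a)\<^sup>2)) powr (1 / p))"
    if a: "norm a < 1" for a :: "complex ^ 'n"
  proof -
    define P where "P = ln (2 / (1 - (norm a)\<^sup>2)) powr (1 / p)"
    have P: "ln 2 \<le> P" unfolding P_def
      using log_weight_ge_ln2[OF norm_ge_zero a] p by (intro ln2_le_log_powr) (auto simp: field_simps)
    have P0: "0 \<le> P" by (simp add: P_def)
    have "besov_norm N p (log_kernel a) \<le> (\<Sum>m\<in>{m :: 'n \<Rightarrow> nat. sum m UNIV \<le> N - 1}. ennreal (ln 4 + fact N)) +
        (\<Sum>m\<in>{m :: 'n \<Rightarrow> nat. sum m UNIV = N}. ennreal (B * P))"
      unfolding besov_norm_def P_def by (intro add_mono sum_mono ennreal_leI low Lp a) auto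
    also have "\<dots> = ennreal M1 * ennreal (ln 4 + fact N) + ennreal M2 * ennreal (B * P)"
      by (simp only: sum_constant M1_def M2_def ennreal_of_nat_eq_real_of_nat)
    also have "\<dots> = ennreal (M1 * (ln 4 + fact N) + M2 * (B * P))"
      using M B P0 by (simp add: ennreal_mult'[symmetric] ennreal_plus[symmetric] del: ennreal_plus)
    also have "\<dots> \<le> ennreal (C * P)"
    proof (rule ennreal_leI)
      have "M1 * (ln 4 + fact N) * ln 2 \<le> M1 * (ln 4 + fact N) * P"
        using P M by (intro mult_left_mono) auto
      hence "M1 * (ln 4 + fact N) \<le> M1 * (ln 4 + fact N) / ln 2 * P" by (simp add: field_simps)
      thus "M1 * (ln 4 + fact N) + M2 * (B * P) \<le> C * P" using P0 by (simp add: C_def algebra_simps)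
    qed
    finally show ?thesis unfolding P_def .
  qed
  have space: "log_kernel a \<in> besov_space p" if a: "norm a < 1" for a :: "complex ^ 'n"
  proof -
    have "besov_deriv N m (log_kernel a) \<in> Lp_space p invariant_measure" if "sum m UNIV = N" for m
      unfolding Lp_space_def using Lp[OF a that] besov_deriv_measurable[OF holomorphic_log_kernel[OF a], of N m]
      by (auto intro: le_less_trans)
    thus ?thesis unfolding besov_space_def using N holomorphic_log_kernel[OF a] by blast
  qed
  have "0 \<le> M1 * (ln 4 + fact N) / ln 2" using M by simp
  hence "0 < C" unfolding C_def using M B by (intro add_nonneg_pos add_nonneg_nonneg) auto
  thus thesis using that space bound by blast
qed

text \<open>On the ball |1 - <z, a>| is at most a multiple of 1 - |a|^2, so log(4 / |1 - <z, a>|)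
  falls short of L(a) by at most the constant \<open>D\<close>. Being at least ln 2, it absorbs
  \<open>D\<close> into a factor.\<close>

lemma log_kernel_lower_bound:
  fixes R :: real
  assumes R: "0 < R"
  obtains c where "0 < c" "\<And>(a :: complex ^ 'n) z. norm a < 1 \<Longrightarrow> z \<in> bergman_ball a R \<Longrightarrow>
     c * ln (2 / (1 - (norm a)\<^sup>2)) \<le> cmod (log_kernel a z)"
proof -
  define D where "D = ln (1 / ball_const R)"
  have \<delta>: "0 < ball_const R" "ball_const R < 1" by (rule ball_const_bounds[OF R])+
  have D: "0 < D" unfolding D_def using \<delta> by (intro ln_gt_zero) auto
  define c where "c = 1 / (1 + D / ln 2)"
  have c: "0 < 1 + D / ln 2" using D by (simp add: add_pos_nonneg)
  have "c * ln (2 / (1 - (norm a)\<^sup>2)) \<le> cmod (log_kernel a z)"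
    if a: "norm a < 1" and z: "z \<in> bergman_ball a R" for a z :: "complex ^ 'n"
  proof -
    let ?m = "cmod (1 - hermitian z a)" and ?y = "1 - (norm a)\<^sup>2"
    have z1: "norm z < 1" using z by (simp add: bergman_ball_def)
    have y: "0 < ?y" using one_minus_sq_bounds(3)[of "norm a"] a by simp
    note m = one_minus_hermitian_bounds[OF z1 a]
    define x where "x = ln (4 / ?m)"
    have "1 - hermitian z a \<noteq> 0" using m(3) by auto
    hence "Re (log_kernel a z) = x" using m by (simp add: log_kernel_def x_def ln_div)
    hence x: "x \<le> cmod (log_kernel a z)" using complex_Re_le_cmod by metis
    have x2: "ln 2 \<le> x" unfolding x_def using m by (subst ln_le_cancel_iff) (auto simp: field_simps)
    have "?m \<le> 2 / ball_const R * ?y" by (rule bergman_ball_comparison(1)[OF a R z])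
    hence "2 / ?y \<le> 1 / ball_const R * (4 / ?m)" using m(3) y \<delta> by (simp add: field_simps)
    hence "ln (2 / ?y) \<le> ln (1 / ball_const R * (4 / ?m))"
      using m(3) y \<delta> by (subst ln_le_cancel_iff) auto
    also have "\<dots> = D + x" unfolding D_def x_def using m(3) \<delta> by (intro ln_mult_pos) auto
    also have "D \<le> D / ln 2 * x" using x2 D by (simp add: field_simps)
    hence "D + x \<le> (1 + D / ln 2) * x" by (simp add: algebra_simps)
    finally have "ln (2 / ?y) \<le> (1 + D / ln 2) * x" .
    hence "c * ln (2 / ?y) \<le> x" unfolding c_def using c by (simp add: field_simps)
    thus ?thesis using x by linarith
  qed
  thus thesis using that[of c] c unfolding c_def by simp
qed

section \<open>Carleson and tent norms\<close>

text \<open>A factor K in the argument costs an additive ln K, which ln(2/y) \<ge> ln 2 turns into a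
  multiplicative constant.\<close>

lemma log_compare:
  fixes x y K :: real
  assumes "0 < x" "0 < y" "1 \<le> K" "x \<le> 1" "y \<le> 1" "y \<le> K * x"
  shows "ln (2 / x) \<le> (1 + ln K / ln 2) * ln (2 / y)"
proof -
  have K: "0 \<le> ln K" using assms by simp
  have y: "ln 2 \<le> ln (2 / y)" using assms by (subst ln_le_cancel_iff) (auto simp: field_simps)
  have "2 / x \<le> K * (2 / y)" using assms by (simp add: field_simps)
  hence "ln (2 / x) \<le> ln (K * (2 / y))" using assms by (subst ln_le_cancel_iff) auto
  also have "\<dots> = ln K + ln (2 / y)" using assms by (intro ln_mult_pos) auto
  also have "\<dots> \<le> ln K / ln 2 * ln (2 / y) + ln (2 / y)"
    using mult_left_mono[OF y, of "ln K / ln 2"] K by simp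
  finally show ?thesis by (simp add: algebra_simps)
qed

lemma log_powr_compare:
  fixes x y K e :: real
  assumes "0 < x" "0 < y" "1 \<le> K" "x \<le> 1" "y \<le> 1" "x \<le> K * y" "y \<le> K * x"
  shows "ln (2 / x) powr e \<le> (1 + ln K / ln 2) powr \<bar>e\<bar> * ln (2 / y) powr e"
proof (rule powr_compare)
  have l: "0 < ln (2 / x)" "0 < ln (2 / y)" using assms by auto
  show "0 < ln (2 / x)" "0 < ln (2 / y)" by fact+
  show "1 \<le> 1 + ln K / ln 2" using assms by simp
  show "ln (2 / x) \<le> (1 + ln K / ln 2) * ln (2 / y)" "ln (2 / y) \<le> (1 + ln K / ln 2) * ln (2 / x)"
    using assms by (auto intro!: log_compare)
qed

definition log_weight :: "complex ^ 'n \<Rightarrow> real" where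
  "log_weight a = ln (2 / (1 - (norm a)\<^sup>2))"

lemma log_weight_pos: "norm a < 1 \<Longrightarrow> 0 < log_weight a"
  unfolding log_weight_def by (rule less_le_trans[OF _ log_weight_ge_ln2]) auto

lemma ball_defect_bounds:
  assumes "norm a < 1" shows "0 < 1 - (norm a)\<^sup>2" "1 - (norm a)\<^sup>2 \<le> 1"
  using one_minus_sq_bounds[of "norm a"] assms by auto

text \<open>Under the logarithm the tent norm has 1 - |a| and the Carleson norm 1 - |a|^2; these
  differ by at most a factor 2.\<close>

lemma log_weight_one_minus_norm:
  assumes a: "norm a < 1"
  shows "0 < ln (2 / (1 - norm a))"
    "log_weight a powr t \<le> 2 powr \<bar>t\<bar> * ln (2 / (1 - norm a)) powr t"
    "ln (2 / (1 - norm a)) powr t \<le> 2 powr \<bar>t\<bar> * log_weight a powr t"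
proof -
  have b: "0 < 1 - norm a" "1 - norm a \<le> 1" using a by auto
  note s = one_minus_sq_bounds[OF norm_ge_zero a]
  have two: "1 + ln 2 / ln 2 = (2 :: real)" by simp
  have "1 < 2 / (1 - norm a)" using b by (simp add: less_divide_eq) (use norm_ge_zero[of a] in linarith)
  thus "0 < ln (2 / (1 - norm a))" by (rule ln_gt_zero)
  show "log_weight a powr t \<le> 2 powr \<bar>t\<bar> * ln (2 / (1 - norm a)) powr t"
    using log_powr_compare[of "1 - (norm a)\<^sup>2" "1 - norm a" 2 t] s b unfolding two log_weight_def by simp
  show "ln (2 / (1 - norm a)) powr t \<le> 2 powr \<bar>t\<bar> * log_weight a powr t"
    using log_powr_compare[of "1 - norm a" "1 - (norm a)\<^sup>2" 2 t] s b unfolding two log_weight_def by simp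
qed

definition carleson_weight :: "real \<Rightarrow> real \<Rightarrow> complex ^ 'n \<Rightarrow> real" where
  "carleson_weight s e a = (1 - (norm a)\<^sup>2) powr s * log_weight a powr e"

lemma carleson_weight_pos: "norm a < 1 \<Longrightarrow> 0 < carleson_weight s e a"
  using log_weight_pos[of a] ball_defect_bounds[of a] by (simp add: carleson_weight_def)

lemma carleson_norm_le_iff:
  "carleson_norm s t p q R \<mu> \<le> ennreal k \<longleftrightarrow>
    (\<forall>a\<in>unit_ball. emeasure \<mu> (bergman_ball a R) / ennreal (carleson_weight s (t - q + q / p) a) \<le> ennreal k)"
  unfolding carleson_norm_def carleson_weight_def log_weight_def by (simp add: SUP_le_iff)

lemma ennreal_divide_le_iff:
  assumes "0 < w" "0 \<le> k" shows "x / ennreal w \<le> ennreal k \<longleftrightarrow> x \<le> ennreal (k * w)"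
proof (cases "x = top")
  case True
  thus ?thesis using assms by (simp add: ennreal_top_divide top_unique)
next
  case False
  then obtain r where r: "x = ennreal r" "0 \<le> r" by (cases x) auto
  show ?thesis using assms r by (simp add: divide_ennreal divide_le_eq)
qed

lemma bergman_ball_measurable:
  assumes \<mu>: "\<mu> \<in> borel_measures_on_ball" and a: "norm a < 1" and R: "0 < R"
  shows "bergman_ball a R \<in> sets \<mu>"
proof -
  have "bergman_ball a R \<in> sets borel" using open_bergman_ball[OF a R] by simp
  moreover have "bergman_ball a R \<subseteq> unit_ball" by (auto simp: bergman_ball_def)
  ultimately show ?thesis using \<mu> unfolding borel_measures_on_ball_def
    by (auto simp: sets_restrict_space_iff)
qed

lemma holomorphic_measurable_on:
  assumes \<mu>: "\<mu> \<in> borel_measures_on_ball" and f: "holomorphic_on_ball f"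
  shows "f \<in> borel_measurable \<mu>"
proof -
  have "f \<in> borel_measurable (restrict_space borel unit_ball)"
    by (rule borel_measurable_continuous_on_restrict[OF holomorphic_on_ball_imp_continuous_on[OF f]])
  also have "borel_measurable (restrict_space borel unit_ball) = borel_measurable \<mu>"
    using \<mu> by (intro measurable_cong_sets) (auto simp: borel_measures_on_ball_def)
  finally show ?thesis .
qed

text \<open>Every ball of radius \<open>r\<close> is covered by finitely many balls of radius
  \<open>R\<close>, and the weight at \<open>ball_involution a c\<close> is comparable to that at
  \<open>a\<close> with a constant that depends on \<open>c\<close> only. Summing over the fixed
  finite set gives \<open>K\<close> independent of the measure.\<close>

lemma carleson_norm_radius:
  fixes s t p q r R :: real
  assumes r: "0 < r" and R: "0 < R"
  obtains K where "0 < K" "\<And>\<mu> :: (complex ^ 'n) measure. \<And>k. \<mu> \<in> borel_measures_on_ball \<Longrightarrow> 0 \<le> k \<Longrightarrow>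
    carleson_norm s t p q R \<mu> \<le> ennreal k \<Longrightarrow> carleson_norm s t p q r \<mu> \<le> ennreal (K * k)"
proof -
  obtain C :: "(complex ^ 'n) set" where C: "finite C" "C \<subseteq> unit_ball"
    "\<And>a. norm a < 1 \<Longrightarrow> bergman_ball a r \<subseteq> (\<Union>c\<in>C. bergman_ball (ball_involution a c) R)"
    using finite_bergman_cover[OF R r] by blast
  define e where "e = t - q + q / p"
  \<comment> \<open>The defect of \<open>ball_involution a c\<close> is that of \<open>a\<close>
    times (1 - |c|^2) / |1 - <c, a>|^2, and |1 - <c, a>| lies between 1 - |c| and 2; this number
    bounds the ratio in both directions.\<close>
  define \<kappa> where "\<kappa> c = 4 / (1 - norm c)\<^sup>2" for c :: "complex ^ 'n"
  define \<theta> where "\<theta> c = \<kappa> c powr \<bar>s\<bar> * (1 + ln (\<kappa> c) / ln 2) powr \<bar>e\<bar>" for c :: "complex ^ 'n"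
  have weight: "carleson_weight s e (ball_involution a c) \<le> \<theta> c * carleson_weight s e a"
    if a: "norm a < 1" and c: "c \<in> C" for a c
  proof -
    let ?b = "ball_involution a c"
    have c1: "norm c < 1" using c C by auto
    have b1: "norm ?b < 1" by (rule norm_ball_involution_less_1[OF a c1])
    note m = one_minus_hermitian_bounds[OF c1 a]
    let ?m = "cmod (1 - hermitian c a)"
    let ?x = "1 - (norm ?b)\<^sup>2" and ?y = "1 - (norm a)\<^sup>2" and ?z = "1 - (norm c)\<^sup>2"
    have eq: "?x = ?y * ?z / ?m\<^sup>2"
      using norm_ball_involution[OF a c1] by simp
    note x = ball_defect_bounds[OF b1] and y = ball_defect_bounds[OF a] and z = ball_defect_bounds[OF c1]
    have d: "0 < 1 - norm c" "1 - norm c \<le> 1" using c1 by auto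
    have d2: "0 < (1 - norm c)\<^sup>2" "(1 - norm c)\<^sup>2 \<le> 1" using d by (auto simp: power_le_one)
    have k1: "1 \<le> \<kappa> c" using d2 by (simp add: \<kappa>_def field_simps)
    have "?x \<le> \<kappa> c * ?y"
    proof -
      have "(1 - norm c)\<^sup>2 \<le> ?m\<^sup>2" using m d by (intro power_mono) auto
      hence "?y * ?z / ?m\<^sup>2 \<le> ?y * 1 / (1 - norm c)\<^sup>2"
        using y z d2 by (intro frac_le mult_left_mono) auto
      also have "\<dots> \<le> \<kappa> c * ?y" using y d2 by (simp add: \<kappa>_def field_simps)
      finally show ?thesis unfolding eq .
    qed
    moreover have "?y \<le> \<kappa> c * ?x"
    proof -
      have "(1 - norm c)\<^sup>2 \<le> (1 - norm c) * 1" unfolding power2_eq_square using d by (intro mult_left_mono) auto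
      also have "\<dots> \<le> ?z" using one_minus_sq_bounds(1)[of "norm c"] c1 by simp
      finally have "?m\<^sup>2 * (1 - norm c)\<^sup>2 \<le> 2\<^sup>2 * ?z"
        using m by (intro mult_mono power_mono) auto
      hence "?m\<^sup>2 * (1 - norm c)\<^sup>2 \<le> 4 * ?z" by simp
      hence "?y * (?m\<^sup>2 * (1 - norm c)\<^sup>2) \<le> ?y * (4 * ?z)" using y by (intro mult_left_mono) auto
      thus ?thesis unfolding eq \<kappa>_def using d2 m(3) by (simp add: field_simps)
    qed
    ultimately have "?x powr s \<le> \<kappa> c powr \<bar>s\<bar> * ?y powr s"
      and "log_weight ?b powr e \<le> (1 + ln (\<kappa> c) / ln 2) powr \<bar>e\<bar> * log_weight a powr e"
      unfolding log_weight_def using x y k1 by (blast intro: powr_compare log_powr_compare)+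
    hence "?x powr s * log_weight ?b powr e \<le> (\<kappa> c powr \<bar>s\<bar> * ?y powr s) * ((1 + ln (\<kappa> c) / ln 2) powr \<bar>e\<bar> * log_weight a powr e)"
      by (intro mult_mono) auto
    thus ?thesis unfolding carleson_weight_def \<theta>_def by (simp add: mult_ac)
  qed
  define K where "K = (\<Sum>c\<in>C. \<theta> c) + 1"
  have \<theta>: "0 \<le> \<theta> c" for c by (simp add: \<theta>_def)
  have "0 < K" unfolding K_def using \<theta> by (intro add_nonneg_pos sum_nonneg) auto
  moreover have "carleson_norm s t p q r \<mu> \<le> ennreal (K * k)"
    if \<mu>: "\<mu> \<in> borel_measures_on_ball" and k: "0 \<le> k" and le: "carleson_norm s t p q R \<mu> \<le> ennreal k"
    for \<mu> :: "(complex ^ 'n) measure" and k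
    unfolding carleson_norm_le_iff e_def[symmetric]
  proof
    fix a :: "complex ^ 'n" assume "a \<in> unit_ball"
    hence a: "norm a < 1" by simp
    have b: "norm (ball_involution a c) < 1" if "c \<in> C" for c
      using that C by (intro norm_ball_involution_less_1 a) auto
    have "emeasure \<mu> (bergman_ball a r) \<le> emeasure \<mu> (\<Union>c\<in>C. bergman_ball (ball_involution a c) R)"
      using C bergman_ball_measurable[OF \<mu> b R] a by (intro emeasure_mono sets.finite_UN) auto
    also have "\<dots> \<le> (\<Sum>c\<in>C. emeasure \<mu> (bergman_ball (ball_involution a c) R))"
      using C bergman_ball_measurable[OF \<mu> b R] by (intro emeasure_subadditive_finite) auto
    also have "\<dots> \<le> (\<Sum>c\<in>C. ennreal (k * (\<theta> c * carleson_weight s e a)))"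
    proof (rule sum_mono)
      fix c assume c: "c \<in> C"
      have "emeasure \<mu> (bergman_ball (ball_involution a c) R) / ennreal (carleson_weight s e (ball_involution a c)) \<le> ennreal k"
        using le b[OF c] unfolding carleson_norm_le_iff e_def[symmetric] by auto
      hence "emeasure \<mu> (bergman_ball (ball_involution a c) R) \<le> ennreal (k * carleson_weight s e (ball_involution a c))"
        by (subst (asm) ennreal_divide_le_iff[OF carleson_weight_pos[OF b[OF c]] k])
      also have "\<dots> \<le> ennreal (k * (\<theta> c * carleson_weight s e a))"
        by (intro ennreal_leI mult_left_mono weight a c k)
      finally show "emeasure \<mu> (bergman_ball (ball_involution a c) R) \<le> ennreal (k * (\<theta> c * carleson_weight s e a))" .
    qed
    also have "\<dots> = ennreal (\<Sum>c\<in>C. k * (\<theta> c * carleson_weight s e a))"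
      using k \<theta> less_imp_le[OF carleson_weight_pos[OF a]] by (intro sum_ennreal mult_nonneg_nonneg) auto
    also have "(\<Sum>c\<in>C. k * (\<theta> c * carleson_weight s e a)) = (\<Sum>c\<in>C. \<theta> c) * k * carleson_weight s e a"
      by (simp add: sum_distrib_left sum_distrib_right mult_ac)
    also have "\<dots> \<le> K * k * carleson_weight s e a"
      using k less_imp_le[OF carleson_weight_pos[OF a]] by (intro mult_right_mono) (auto simp: K_def)
    finally have "emeasure \<mu> (bergman_ball a r) \<le> ennreal (K * k * carleson_weight s e a)" by (simp add: ennreal_leI)
    thus "emeasure \<mu> (bergman_ball a r) / ennreal (carleson_weight s e a) \<le> ennreal (K * k)"
      using \<open>0 < K\<close> k by (subst ennreal_divide_le_iff[OF carleson_weight_pos[OF a]]) auto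
  qed
  ultimately show thesis using that by blast
qed

text \<open>On a Bergman ball the logarithmic weight is constant up to a factor, so the growth bound
  for \<open>f\<close> may be evaluated at the centre.\<close>

lemma tent_norm_le:
  fixes f :: "complex ^ 'n \<Rightarrow> complex" and p q s t r :: real
  assumes p: "1 \<le> p" and q: "0 < q" and r: "0 < r"
  obtains K where "0 < K" "\<And>\<mu> :: (complex ^ 'n) measure. \<And>f M k. \<mu> \<in> borel_measures_on_ball \<Longrightarrow> 0 \<le> k \<Longrightarrow> 0 \<le> M \<Longrightarrow>
    (\<And>z. norm z < 1 \<Longrightarrow> cmod (f z) \<le> M * log_weight z powr (1 - 1 / p)) \<Longrightarrow>
    carleson_norm s t p q r \<mu> \<le> ennreal k \<Longrightarrow> tent_norm q s t r \<mu> f \<le> ennreal ((K * k) powr (1 / q) * M)"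
proof -
  define B where "B = 4 / ball_const r"
  have B: "1 \<le> B" using ball_const_bounds[OF r] by (simp add: B_def field_simps)
  define \<beta> where "\<beta> = q * (1 - 1 / p)"
  define A where "A = (1 + ln B / ln 2) powr \<bar>\<beta>\<bar>"
  define K where "K = A * 2 powr \<bar>t\<bar>"
  have lnB: "0 \<le> ln B / ln 2" using B by simp
  have A: "0 < A" unfolding A_def using lnB by simp
  hence K: "0 < K" by (simp add: K_def)
  \<comment> \<open>The growth bound to the power q, times the Carleson weight, restores the
    exponent \<open>t\<close> of the tent norm.\<close>
  have exp: "\<beta> + (t - q + q / p) = t" using p by (simp add: \<beta>_def field_simps)
  have "tent_norm q s t r \<mu> f \<le> ennreal ((K * k) powr (1 / q) * M)"
    if \<mu>: "\<mu> \<in> borel_measures_on_ball" and k: "0 \<le> k" and M: "0 \<le> M"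
      and f: "\<And>z. norm z < 1 \<Longrightarrow> cmod (f z) \<le> M * log_weight z powr (1 - 1 / p)"
      and c: "carleson_norm s t p q r \<mu> \<le> ennreal k" for \<mu> :: "(complex ^ 'n) measure" and f k M
  proof -
    have "(\<integral>\<^sup>+z\<in>bergman_ball a r. ennreal (cmod (f z) powr q) \<partial>\<mu>) /
        ennreal ((1 - (norm a)\<^sup>2) powr s * ln (2 / (1 - norm a)) powr t) \<le> ennreal (M powr q * (K * k))"
      if "a \<in> unit_ball" for a
    proof -
      have a: "norm a < 1" using that by simp
      let ?D = "bergman_ball a r"
      note y = ball_defect_bounds[OF a]
      have D: "?D \<in> sets \<mu>" by (rule bergman_ball_measurable[OF \<mu> a r])
  let ?b = "M powr q * A * log_weight a powr \<beta>" and ?I = "\<integral>\<^sup>+z\<in>?D. ennreal (cmod (f z) powr q) \<partial>\<mu>"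
      have fz: "cmod (f z) powr q \<le> ?b" if z: "z \<in> ?D" for z
      proof -
        have z1: "norm z < 1" using z by (simp add: bergman_ball_def)
        note x = ball_defect_bounds[OF z1]
        have "cmod (f z) powr q \<le> (M * log_weight z powr (1 - 1 / p)) powr q"
          using f[OF z1] q by (intro powr_mono2) auto
        also have "\<dots> = M powr q * log_weight z powr \<beta>"
          using M by (simp add: powr_mult powr_powr \<beta>_def mult.commute)
        also have "log_weight z powr \<beta> \<le> A * log_weight a powr \<beta>"
          unfolding log_weight_def A_def
          using x y B bergman_ball_comparison[OF a r z] by (intro log_powr_compare) (auto simp: B_def)
        hence "M powr q * log_weight z powr \<beta> \<le> M powr q * (A * log_weight a powr \<beta>)" by (intro mult_left_mono) auto
        finally show ?thesis by (simp add: mult.assoc)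
      qed
      have "?I \<le> (\<integral>\<^sup>+z. ennreal (?b) * indicator ?D z \<partial>\<mu>)"
        by (intro nn_integral_mono) (auto split: split_indicator intro!: ennreal_leI fz)
      also have "\<dots> = ennreal (?b) * emeasure \<mu> ?D"
        by (rule nn_integral_cmult_indicator[OF D])
      also have "\<dots> \<le> ennreal (?b) * ennreal (k * carleson_weight s (t - q + q / p) a)"
      proof (rule mult_left_mono)
        have "emeasure \<mu> ?D / ennreal (carleson_weight s (t - q + q / p) a) \<le> ennreal k"
          using c a unfolding carleson_norm_le_iff by auto
        thus "emeasure \<mu> ?D \<le> ennreal (k * carleson_weight s (t - q + q / p) a)"
          by (subst (asm) ennreal_divide_le_iff[OF carleson_weight_pos[OF a] k])
      qed simp
      also have "\<dots> = ennreal (?b * (k * carleson_weight s (t - q + q / p) a))"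
        using A by (intro ennreal_mult'[symmetric]) auto
      also have "?b * (k * carleson_weight s (t - q + q / p) a) =
          M powr q * A * k * ((1 - (norm a)\<^sup>2) powr s * (log_weight a powr \<beta> * log_weight a powr (t - q + q / p)))"
        by (simp add: carleson_weight_def mult_ac)
      also have "log_weight a powr \<beta> * log_weight a powr (t - q + q / p) = log_weight a powr t"
        unfolding powr_add[symmetric] exp ..
      also have "M powr q * A * k * ((1 - (norm a)\<^sup>2) powr s * log_weight a powr t) \<le>
          M powr q * A * k * ((1 - (norm a)\<^sup>2) powr s * (2 powr \<bar>t\<bar> * ln (2 / (1 - norm a)) powr t))"
        using A k by (intro mult_left_mono log_weight_one_minus_norm a) auto
      also have "\<dots> = M powr q * (K * k) * ((1 - (norm a)\<^sup>2) powr s * ln (2 / (1 - norm a)) powr t)"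
        by (simp add: K_def mult_ac)
      finally have "?I \<le>
          ennreal (M powr q * (K * k) * ((1 - (norm a)\<^sup>2) powr s * ln (2 / (1 - norm a)) powr t))"
        by (simp add: ennreal_leI)
      thus ?thesis
        using y log_weight_one_minus_norm(1)[OF a] K k by (subst ennreal_divide_le_iff) auto
    qed
    hence "tent_norm q s t r \<mu> f \<le> ennreal_powr (ennreal (M powr q * (K * k))) (1 / q)"
      unfolding tent_norm_def using q by (intro ennreal_powr_mono SUP_least) auto
    also have "\<dots> = ennreal ((M powr q * (K * k)) powr (1 / q))" using K k by (intro ennreal_powr_ennreal) auto
    also have "(M powr q * (K * k)) powr (1 / q) = (M powr q) powr (1 / q) * (K * k) powr (1 / q)"
      by (rule powr_mult)
    also have "(M powr q) powr (1 / q) = M" using M q by (simp add: powr_powr)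
    finally show ?thesis by (simp add: mult.commute)
  qed
  thus thesis using that K by blast
qed

text \<open>The value E = 0 is reached by applying the growth estimate to E + d; for d = e / (C P)
  the excess is exactly e.\<close>

lemma besov_growth_nonneg:
  fixes p :: real and N :: nat
  assumes p: "1 \<le> p" and N: "0 < N"
  obtains C where "0 < C" "\<And>f :: complex ^ 'n \<Rightarrow> complex. \<And>E z. holomorphic_on_ball f \<Longrightarrow> 0 \<le> E \<Longrightarrow>
    besov_norm N p f \<le> ennreal E \<Longrightarrow> norm z < 1 \<Longrightarrow> cmod (f z) \<le> C * E * log_weight z powr (1 - 1 / p)"
proof -
  obtain C where C: "0 < C" "\<And>f :: complex ^ 'n \<Rightarrow> complex. \<And>E z. holomorphic_on_ball f \<Longrightarrow> 0 < E \<Longrightarrow>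
    besov_norm N p f \<le> ennreal E \<Longrightarrow> norm z < 1 \<Longrightarrow> cmod (f z) \<le> C * E * log_weight z powr (1 - 1 / p)"
    unfolding log_weight_def using besov_growth[OF p N, where 'n = 'n] by blast
  have "cmod (f z) \<le> C * E * log_weight z powr (1 - 1 / p)"
    if f: "holomorphic_on_ball f" and E: "0 \<le> E" and le: "besov_norm N p f \<le> ennreal E" and z: "norm z < 1"
    for f :: "complex ^ 'n \<Rightarrow> complex" and E z
  proof (rule field_le_epsilon)
    fix e :: real assume e: "0 < e"
    define P where "P = log_weight z powr (1 - 1 / p)"
    have P: "0 < P" unfolding P_def using log_weight_pos[OF z] by simp
    define d where "d = e / (C * P)"
    have d: "0 < d" using e C P by (simp add: d_def)
    have "besov_norm N p f \<le> ennreal (E + d)" by (rule order.trans[OF le ennreal_leI]) (use d in simp)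
    hence "cmod (f z) \<le> C * (E + d) * P" unfolding P_def using C(2)[OF f _ _ z, of "E + d"] E d by simp
    also have "\<dots> = C * E * P + e" using C P by (simp add: d_def field_simps)
    finally show "cmod (f z) \<le> C * E * log_weight z powr (1 - 1 / p) + e" unfolding P_def .
  qed
  thus thesis using that C(1) by blast
qed

section \<open>Two-sided bounds for the operator norm\<close>

lemma besov_norm_finite:
  fixes f :: "complex ^ 'n \<Rightarrow> complex"
  assumes "\<And>m. sum m UNIV = N \<Longrightarrow> besov_deriv N m f \<in> Lp_space p invariant_measure"
  shows "besov_norm N p f < top"
proof -
  have "(\<Sum>m | sum m UNIV = N. Lp_norm p invariant_measure (besov_deriv N m f)) < top"
    using assms by (subst ennreal_sum_less_top[OF finite_multi_index]) (simp add: Lp_space_def)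
  moreover have "(\<Sum>m | sum m UNIV \<le> N - 1. ennreal (cmod (multi_deriv m f 0))) < top"
    by (subst ennreal_sum_less_top[OF finite_multi_index_le]) simp
  ultimately show ?thesis unfolding besov_norm_def by (simp only: ennreal_add_less_top)
qed

text \<open>\<open>k\<close> is positive so that the constant \<open>C0\<close> is. When the norm of
  order \<open>N\<close> is infinite, the bound is then \<open>top\<close>, whereas 0 times
  \<open>top\<close> would be 0.\<close>

lemma embedding_norm_upper:
  fixes p q s t r :: real and N :: nat
  assumes p: "1 \<le> p" and q: "0 < q" and r: "0 < r" and N: "0 < N"
  obtains K where "0 < K" "\<And>\<mu> :: (complex ^ 'n) measure. \<And>k. \<mu> \<in> borel_measures_on_ball \<Longrightarrow> 0 < k \<Longrightarrow>
    carleson_norm s t p q r \<mu> \<le> ennreal k \<Longrightarrow> ennreal_powr (embedding_norm N p q s t r \<mu>) q \<le> ennreal (K * k)"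
proof -
  obtain K where K: "0 < K" "\<And>\<mu> :: (complex ^ 'n) measure. \<And>f M k. \<mu> \<in> borel_measures_on_ball \<Longrightarrow> 0 \<le> k \<Longrightarrow> 0 \<le> M \<Longrightarrow>
    (\<And>z. norm z < 1 \<Longrightarrow> cmod (f z) \<le> M * log_weight z powr (1 - 1 / p)) \<Longrightarrow>
    carleson_norm s t p q r \<mu> \<le> ennreal k \<Longrightarrow> tent_norm q s t r \<mu> f \<le> ennreal ((K * k) powr (1 / q) * M)"
    using tent_norm_le[OF p q r, where 'n = 'n] by blast
  obtain C where C: "0 < C" "\<And>f :: complex ^ 'n \<Rightarrow> complex. \<And>E z. holomorphic_on_ball f \<Longrightarrow> 0 \<le> E \<Longrightarrow>
    besov_norm N p f \<le> ennreal E \<Longrightarrow> norm z < 1 \<Longrightarrow> cmod (f z) \<le> C * E * log_weight z powr (1 - 1 / p)"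
    using besov_growth_nonneg[OF p N, where 'n = 'n] by blast
  have "ennreal_powr (embedding_norm N p q s t r \<mu>) q \<le> ennreal (K * C powr q * k)"
    if \<mu>: "\<mu> \<in> borel_measures_on_ball" and k: "0 < k" and c: "carleson_norm s t p q r \<mu> \<le> ennreal k"
    for \<mu> :: "(complex ^ 'n) measure" and k
  proof -
    define C0 where "C0 = (K * k) powr (1 / q) * C"
    have C0: "0 < C0" using K k C by (simp add: C0_def)
    have "embedding_bound N p q s t r \<mu> C0"
      unfolding embedding_bound_def
    proof (intro conjI ballI)
      fix f :: "complex ^ 'n \<Rightarrow> complex" assume "f \<in> besov_space p"
      then obtain N' where f: "holomorphic_on_ball f" and N': "0 < N'"
        "\<And>m. sum m UNIV = N' \<Longrightarrow> besov_deriv N' m f \<in> Lp_space p invariant_measure"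
        unfolding besov_space_def by blast
      \<comment> \<open>Membership in the space is witnessed by an order \<open>N'\<close> that may
        differ from \<open>N\<close>, and the norm of order \<open>N\<close> is not known to be
        finite here. Finiteness of the tent norm therefore comes from the growth estimate of order
        \<open>N'\<close>.\<close>
      obtain C' where C': "0 < C'" "\<And>f :: complex ^ 'n \<Rightarrow> complex. \<And>E z. holomorphic_on_ball f \<Longrightarrow> 0 \<le> E \<Longrightarrow>
          besov_norm N' p f \<le> ennreal E \<Longrightarrow> norm z < 1 \<Longrightarrow> cmod (f z) \<le> C' * E * log_weight z powr (1 - 1 / p)"
        using besov_growth_nonneg[OF p N'(1), where 'n = 'n] by blast
      have fin: "besov_norm N' p f < top" by (rule besov_norm_finite[OF N'(2)])
      define E where "E = enn2real (besov_norm N' p f)"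
      have E: "0 \<le> E" "besov_norm N' p f \<le> ennreal E" using fin by (simp_all add: E_def)
      have "tent_norm q s t r \<mu> f \<le> ennreal ((K * k) powr (1 / q) * (C' * E))"
        using C' E f k by (intro K(2)[OF \<mu> _ _ _ c]) auto
      hence "tent_norm q s t r \<mu> f < top" by (rule le_less_trans) simp
      thus "f \<in> tent_space q s t r \<mu>"
        unfolding tent_space_def using holomorphic_measurable_on[OF \<mu> f] by simp
      show "tent_norm q s t r \<mu> f \<le> ennreal C0 * besov_norm N p f"
      proof (cases "besov_norm N p f = top")
        case True
        thus ?thesis using C0 by (simp add: ennreal_mult_top)
      next
        case False
        define E where "E = enn2real (besov_norm N p f)"
        have E: "0 \<le> E" "besov_norm N p f = ennreal E" using False by (simp_all add: E_def less_top)
        have "tent_norm q s t r \<mu> f \<le> ennreal ((K * k) powr (1 / q) * (C * E))"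
          using C E f k by (intro K(2)[OF \<mu> _ _ _ c]) auto
        also have "\<dots> = ennreal C0 * besov_norm N p f"
          unfolding E(2) using C0 by (subst ennreal_mult'[symmetric]) (auto simp: C0_def mult.assoc)
        finally show ?thesis .
      qed
    qed (use C0 in simp)
    hence "embedding_norm N p q s t r \<mu> \<le> ennreal C0"
      unfolding embedding_norm_def by (intro Inf_lower) blast
    hence "ennreal_powr (embedding_norm N p q s t r \<mu>) q \<le> ennreal_powr (ennreal C0) q"
      using q by (intro ennreal_powr_mono) auto
    also have "\<dots> = ennreal (C0 powr q)" using C0 by (intro ennreal_powr_ennreal) auto
    also have "C0 powr q = K * C powr q * k"
    proof -
      have "C0 powr q = ((K * k) powr (1 / q)) powr q * C powr q" unfolding C0_def by (rule powr_mult)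
      also have "((K * k) powr (1 / q)) powr q = K * k" using K k q by (simp add: powr_powr)
      finally show ?thesis by simp
    qed
    finally show ?thesis .
  qed
  moreover have "0 < K * C powr q" using K C by simp
  ultimately show thesis using that by blast
qed

text \<open>The test function at \<open>a\<close> is at least c L on the ball about \<open>a\<close>
  and has norm at most B L^(1/p). Comparing q-th powers sets L^q times the measure of the ball
  against L^(q/p + t), hence the exponent.\<close>

lemma carleson_norm_upper:
  fixes p q s t r :: real and N :: nat
  assumes p: "1 \<le> p" and q: "0 < q" and r: "0 < r" and N: "0 < N" "real CARD('n) / p < real N"
  obtains K where "0 < K" "\<And>\<mu> :: (complex ^ 'n) measure. \<And>C. \<mu> \<in> borel_measures_on_ball \<Longrightarrow>
    embedding_bound N p q s t r \<mu> C \<Longrightarrow> carleson_norm s t p q r \<mu> \<le> ennreal (K * C powr q)"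
proof -
  obtain B where B: "0 < B" "\<And>a :: complex ^ 'n. norm a < 1 \<Longrightarrow> log_kernel a \<in> besov_space p"
    "\<And>a :: complex ^ 'n. norm a < 1 \<Longrightarrow> besov_norm N p (log_kernel a) \<le> ennreal (B * log_weight a powr (1 / p))"
    unfolding log_weight_def using log_kernel_besov[OF p N] by blast
  obtain c where c: "0 < c" "\<And>(a :: complex ^ 'n) z. norm a < 1 \<Longrightarrow> z \<in> bergman_ball a r \<Longrightarrow>
     c * log_weight a \<le> cmod (log_kernel a z)"
    unfolding log_weight_def using log_kernel_lower_bound[OF r, where 'n = 'n] by blast
  define K where "K = 2 powr \<bar>t\<bar> * (B / c) powr q"
  have K: "0 < K" using B c by (simp add: K_def)
  have "carleson_norm s t p q r \<mu> \<le> ennreal (K * C powr q)"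
    if \<mu>: "\<mu> \<in> borel_measures_on_ball" and bound: "embedding_bound N p q s t r \<mu> C" for \<mu> :: "(complex ^ 'n) measure" and C
    unfolding carleson_norm_le_iff
  proof
    fix a :: "complex ^ 'n" assume "a \<in> unit_ball"
    hence a: "norm a < 1" by simp
    let ?L = "log_weight a" and ?D = "bergman_ball a r"
    let ?w = "(1 - (norm a)\<^sup>2) powr s * ln (2 / (1 - norm a)) powr t"
  let ?N = "\<integral>\<^sup>+z\<in>?D. ennreal (cmod (log_kernel a z) powr q) \<partial>\<mu>"
    have C: "0 \<le> C" and tent: "tent_norm q s t r \<mu> (log_kernel a) \<le> ennreal C * besov_norm N p (log_kernel a)"
      using bound B(2)[OF a] unfolding embedding_bound_def by auto
    have L: "0 < ?L" by (rule log_weight_pos[OF a])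
    note y = ball_defect_bounds[OF a]
    have w: "0 < ?w" using y log_weight_one_minus_norm(1)[OF a] by simp
    define X where "X = C * (B * ?L powr (1 / p))"
    have X: "0 \<le> X" using C B by (simp add: X_def)
    have "tent_norm q s t r \<mu> (log_kernel a) \<le> ennreal C * ennreal (B * ?L powr (1 / p))"
      using tent B(3)[OF a] by (meson mult_left_mono order.trans zero_le)
    also have "\<dots> = ennreal X" unfolding X_def using C by (intro ennreal_mult'[symmetric])
    finally have "ennreal_powr (tent_norm q s t r \<mu> (log_kernel a)) q \<le> ennreal_powr (ennreal X) q"
      using q by (intro ennreal_powr_mono) auto
    also have "\<dots> = ennreal (X powr q)" by (rule ennreal_powr_ennreal[OF X])
    \<comment> \<open>The power q removes the outer root in \<open>tent_norm\<close>, so that the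
      centre \<open>a\<close> can be singled out of the supremum.\<close>
    also have "ennreal_powr (tent_norm q s t r \<mu> (log_kernel a)) q =
        (SUP a'\<in>unit_ball. (\<integral>\<^sup>+z\<in>bergman_ball a' r. ennreal (cmod (log_kernel a z) powr q) \<partial>\<mu>) /
          ennreal ((1 - (norm a')\<^sup>2) powr s * ln (2 / (1 - norm a')) powr t))"
      unfolding tent_norm_def using ennreal_powr_inverse[of "1 / q"] q by simp
    finally have "?N / ennreal ?w \<le> ennreal (X powr q)"
      using a by (simp add: SUP_le_iff)
    hence I: "?N \<le> ennreal (X powr q * ?w)"
      by (subst (asm) ennreal_divide_le_iff[OF w]) simp_all
    have cL: "0 < (c * ?L) powr q" using c L by simp
    have "ennreal ((c * ?L) powr q) * emeasure \<mu> ?D = (\<integral>\<^sup>+z. ennreal ((c * ?L) powr q) * indicator ?D z \<partial>\<mu>)"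
      by (rule nn_integral_cmult_indicator[symmetric, OF bergman_ball_measurable[OF \<mu> a r]])
    also have "\<dots> \<le> ?N"
    proof (rule nn_integral_mono)
      fix z
      have "(c * ?L) powr q \<le> cmod (log_kernel a z) powr q" if "z \<in> ?D"
        using c(2)[OF a that] c(1) L q by (intro powr_mono2) auto
      thus "ennreal ((c * ?L) powr q) * indicator ?D z \<le> ennreal (cmod (log_kernel a z) powr q) * indicator ?D z"
        by (auto split: split_indicator intro!: ennreal_leI)
    qed
    also note I
    finally have "ennreal (1 / (c * ?L) powr q) * (ennreal ((c * ?L) powr q) * emeasure \<mu> ?D) \<le>
        ennreal (1 / (c * ?L) powr q) * ennreal (X powr q * ?w)"
      by (rule mult_left_mono) simp
    also have "ennreal (1 / (c * ?L) powr q) * (ennreal ((c * ?L) powr q) * emeasure \<mu> ?D) = emeasure \<mu> ?D"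
      using cL by (subst mult.assoc[symmetric], subst ennreal_mult'[symmetric]) auto
    also have "ennreal (1 / (c * ?L) powr q) * ennreal (X powr q * ?w) = ennreal (1 / (c * ?L) powr q * (X powr q * ?w))"
      by (rule ennreal_mult'[symmetric]) simp
    also have "1 / (c * ?L) powr q * (X powr q * ?w) \<le> K * C powr q * carleson_weight s (t - q + q / p) a"
    proof -
      have "X powr q = C powr q * B powr q * ?L powr (q / p)"
        unfolding X_def using C B L by (simp add: powr_mult powr_powr)
      moreover have "(c * ?L) powr q = c powr q * ?L powr q" using c L by (simp add: powr_mult)
      ultimately have "1 / (c * ?L) powr q * (X powr q * ?w) =
          (B / c) powr q * C powr q * (1 - (norm a)\<^sup>2) powr s * (?L powr (q / p) / ?L powr q) * ln (2 / (1 - norm a)) powr t"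
        using B c by (simp add: powr_divide)
      also have "\<dots> \<le> (B / c) powr q * C powr q * (1 - (norm a)\<^sup>2) powr s * (?L powr (q / p) / ?L powr q) * (2 powr \<bar>t\<bar> * ?L powr t)"
        by (intro mult_left_mono log_weight_one_minus_norm a) auto
      also have "\<dots> = K * C powr q * ((1 - (norm a)\<^sup>2) powr s * (?L powr t / ?L powr q * ?L powr (q / p)))"
        by (simp add: K_def mult_ac)
      also have "?L powr t / ?L powr q * ?L powr (q / p) = ?L powr (t - q + q / p)"
        by (simp add: powr_add powr_diff)
      finally show ?thesis by (simp add: carleson_weight_def)
    qed
    finally have "emeasure \<mu> ?D \<le> ennreal (K * C powr q * carleson_weight s (t - q + q / p) a)"
      by (simp add: ennreal_leI)
    thus "emeasure \<mu> ?D / ennreal (carleson_weight s (t - q + q / p) a) \<le> ennreal (K * C powr q)"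
      using K by (subst ennreal_divide_le_iff[OF carleson_weight_pos[OF a]]) auto
  qed
  thus thesis using that K by blast
qed

text \<open>The radius \<open>r\<close> belongs to the tent space and \<open>R\<close> to the
  Carleson norm; \<open>carleson_norm_radius\<close> mediates between them.\<close>

lemma embedding_norm_le_carleson_norm:
  fixes p q s t r R :: real and N :: nat
  assumes p: "1 \<le> p" and q: "0 < q" and r: "0 < r" and R: "0 < R" and N: "0 < N"
  obtains K where "0 < K" "\<And>\<mu> :: (complex ^ 'n) measure. \<mu> \<in> borel_measures_on_ball \<Longrightarrow>
    ennreal_powr (embedding_norm N p q s t r \<mu>) q \<le> ennreal K * carleson_norm s t p q R \<mu>"
proof -
  let ?e = "\<lambda>\<mu> :: (complex ^ 'n) measure. ennreal_powr (embedding_norm N p q s t r \<mu>) q" and ?c = "\<lambda>R \<mu> :: (complex ^ 'n) measure. carleson_norm s t p q R \<mu>"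
  obtain K1 where K1: "0 < K1" "\<And>\<mu> :: (complex ^ 'n) measure. \<And>k. \<mu> \<in> borel_measures_on_ball \<Longrightarrow> 0 < k \<Longrightarrow>
    ?c r \<mu> \<le> ennreal k \<Longrightarrow> ?e \<mu> \<le> ennreal (K1 * k)"
    using embedding_norm_upper[OF p q r N, where 'n = 'n] by blast
  obtain K2 where K2: "0 < K2" "\<And>\<mu> :: (complex ^ 'n) measure. \<And>k. \<mu> \<in> borel_measures_on_ball \<Longrightarrow> 0 \<le> k \<Longrightarrow>
    ?c R \<mu> \<le> ennreal k \<Longrightarrow> ?c r \<mu> \<le> ennreal (K2 * k)"
    using carleson_norm_radius[OF r R, where 'n = 'n] by blast
  define K where "K = K1 * K2"
  have K: "0 < K" using K1 K2 by (simp add: K_def)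
  have "?e \<mu> \<le> ennreal K * ?c R \<mu>"
    if \<mu>: "\<mu> \<in> borel_measures_on_ball" for \<mu> :: "(complex ^ 'n) measure"
  proof (cases "?c R \<mu> = top")
    case True
    thus ?thesis using K by (simp add: ennreal_mult_top)
  next
    case False
    define k where "k = enn2real (?c R \<mu>)"
    have k: "0 \<le> k" "?c R \<mu> = ennreal k" using False by (simp_all add: k_def less_top)
    show ?thesis
    proof (rule ennreal_le_epsilon)
      fix e :: real assume e: "0 < e"
      \<comment> \<open>The available bound demands a positive number, so e / K is added to cover a
        vanishing Carleson norm; it amounts to exactly e at the end.\<close>
      have "?c R \<mu> \<le> ennreal (k + e / K)"
        unfolding k(2) using e K by (intro ennreal_leI) simp
      hence "?c r \<mu> \<le> ennreal (K2 * (k + e / K))"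
        using k e K by (intro K2(2)[OF \<mu>]) auto
      hence "?e \<mu> \<le> ennreal (K1 * (K2 * (k + e / K)))"
        using k e K K2(1) by (intro K1(2)[OF \<mu>] mult_pos_pos add_nonneg_pos) auto
      also have "K1 * (K2 * (k + e / K)) = K * k + e"
        using K K1(1) K2(1) by (simp add: K_def field_simps)
      also have "ennreal \<dots> = ennreal K * ?c R \<mu> + ennreal e"
        unfolding k(2) using k K e by (simp add: ennreal_mult)
      finally show "?e \<mu> \<le> ennreal K * ?c R \<mu> + ennreal e" .
    qed
  qed
  thus thesis using that K by blast
qed

text \<open>The operator norm is an infimum, so the estimate is put as a q-th root bounded by each
  admissible constant, and the power q is taken after passing to the infimum. An empty set of
  constants gives \<open>top\<close> and needs no separate case.\<close>

lemma carleson_norm_le_embedding_norm: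
  fixes p q s t r R :: real and N :: nat
  assumes p: "1 \<le> p" and q: "0 < q" and r: "0 < r" and R: "0 < R" and N: "0 < N" "real CARD('n) / p < real N"
  obtains K where "0 < K" "\<And>\<mu> :: (complex ^ 'n) measure. \<mu> \<in> borel_measures_on_ball \<Longrightarrow>
    carleson_norm s t p q R \<mu> \<le> ennreal K * ennreal_powr (embedding_norm N p q s t r \<mu>) q"
proof -
  let ?e = "\<lambda>\<mu> :: (complex ^ 'n) measure. ennreal_powr (embedding_norm N p q s t r \<mu>) q" and ?c = "\<lambda>R \<mu> :: (complex ^ 'n) measure. carleson_norm s t p q R \<mu>"
  obtain K1 where K1: "0 < K1" "\<And>\<mu> :: (complex ^ 'n) measure. \<And>C. \<mu> \<in> borel_measures_on_ball \<Longrightarrow>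
    embedding_bound N p q s t r \<mu> C \<Longrightarrow> ?c r \<mu> \<le> ennreal (K1 * C powr q)"
    using carleson_norm_upper[OF p q r N] by blast
  obtain K2 where K2: "0 < K2" "\<And>\<mu> :: (complex ^ 'n) measure. \<And>k. \<mu> \<in> borel_measures_on_ball \<Longrightarrow> 0 \<le> k \<Longrightarrow>
    ?c r \<mu> \<le> ennreal k \<Longrightarrow> ?c R \<mu> \<le> ennreal (K2 * k)"
    using carleson_norm_radius[OF R r, where 'n = 'n] by blast
  define K where "K = K2 * K1"
  have K: "0 < K" using K1 K2 by (simp add: K_def)
  have "?c R \<mu> \<le> ennreal K * ?e \<mu>"
    if \<mu>: "\<mu> \<in> borel_measures_on_ball" for \<mu> :: "(complex ^ 'n) measure"
  proof -
    let ?x = "?c R \<mu>"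
    have bound: "ennreal_powr (ennreal (1 / K) * ?x) (1 / q) \<le> ennreal C" if C: "embedding_bound N p q s t r \<mu> C" for C
    proof -
      have C0: "0 \<le> C" using C by (simp add: embedding_bound_def)
      have "?x \<le> ennreal (K2 * (K1 * C powr q))"
        using K1 by (intro K2(2)[OF \<mu>] K1(2)[OF \<mu> C]) auto
      hence "ennreal (1 / K) * ?x \<le> ennreal (1 / K) * ennreal (K * C powr q)"
        by (intro mult_left_mono) (simp_all add: K_def mult.assoc)
      also have "\<dots> = ennreal (C powr q)" using K by (subst ennreal_mult'[symmetric]) auto
      finally have "ennreal_powr (ennreal (1 / K) * ?x) (1 / q) \<le> ennreal_powr (ennreal (C powr q)) (1 / q)"
        using q by (intro ennreal_powr_mono) auto
      also have "\<dots> = ennreal C" using C0 q by (simp add: ennreal_powr_ennreal powr_powr)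
      finally show ?thesis .
    qed
    have "ennreal_powr (ennreal (1 / K) * ?x) (1 / q) \<le> embedding_norm N p q s t r \<mu>"
      unfolding embedding_norm_def by (rule Inf_greatest) (use bound in auto)
    hence "ennreal_powr (ennreal_powr (ennreal (1 / K) * ?x) (1 / q)) q \<le> ?e \<mu>"
      using q by (intro ennreal_powr_mono) auto
    also have "ennreal_powr (ennreal_powr (ennreal (1 / K) * ?x) (1 / q)) q = ennreal (1 / K) * ?x"
      using ennreal_powr_inverse[of "1 / q"] q by simp
    finally have "ennreal K * (ennreal (1 / K) * ?x) \<le> ennreal K * ?e \<mu>"
      by (rule mult_left_mono) simp
    moreover have "ennreal K * (ennreal (1 / K) * ?x) = ?x"
      using K by (subst mult.assoc[symmetric], subst ennreal_mult'[symmetric]) auto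
    ultimately show ?thesis by simp
  qed
  thus thesis using that K by blast
qed

text \<open>For an unbounded embedding the set of constants is empty and its infimum is
  \<open>top\<close>, so boundedness is finiteness of the norm.\<close>

lemma embedding_bounded_iff:
  "embedding_bounded N p q s t r \<mu> \<longleftrightarrow> ennreal_powr (embedding_norm N p q s t r \<mu>) q < top"
proof -
  have "ennreal_powr (embedding_norm N p q s t r \<mu>) q < top \<longleftrightarrow> embedding_norm N p q s t r \<mu> < top"
    by (simp add: ennreal_powr_def less_top[symmetric])
  also have "\<dots> \<longleftrightarrow> embedding_bounded N p q s t r \<mu>"
    unfolding embedding_norm_def Inf_less_iff embedding_bounded_def by auto
  finally show ?thesis ..
qed

theorem theorem3p1:
  fixes p q s t r :: real and N :: nat
  assumes "1 \<le> p" and "0 < q"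
    and "0 < N" and "real CARD('n::finite) / p < real N"
    and "0 < r"
  shows
    "(\<forall>\<mu> \<in> (borel_measures_on_ball :: (complex ^ 'n) measure set).
        (embedding_bounded N p q s t r \<mu> \<longleftrightarrow> (\<exists>R>0. carleson_norm s t p q R \<mu> < top)) \<and>
        (embedding_bounded N p q s t r \<mu> \<longleftrightarrow> (\<forall>R>0. carleson_norm s t p q R \<mu> < top))) \<and>
     (\<forall>R>0. \<exists>C>0. \<forall>\<mu> \<in> (borel_measures_on_ball :: (complex ^ 'n) measure set).
        ennreal_powr (embedding_norm N p q s t r \<mu>) q \<le> ennreal C * carleson_norm s t p q R \<mu> \<and>
        carleson_norm s t p q R \<mu> \<le> ennreal C * ennreal_powr (embedding_norm N p q s t r \<mu>) q)"
proof -
  let ?e = "\<lambda>\<mu> :: (complex ^ 'n) measure. ennreal_powr (embedding_norm N p q s t r \<mu>) q" and ?c = "\<lambda>R \<mu> :: (complex ^ 'n) measure. carleson_norm s t p q R \<mu>"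
  have equiv: "\<exists>C>0. \<forall>\<mu> \<in> (borel_measures_on_ball :: (complex ^ 'n) measure set).
        ?e \<mu> \<le> ennreal C * ?c R \<mu> \<and>
        ?c R \<mu> \<le> ennreal C * ?e \<mu>"
    if R: "0 < R" for R
  proof -
    obtain K1 where K1: "0 < K1" "\<And>\<mu> :: (complex ^ 'n) measure. \<mu> \<in> borel_measures_on_ball \<Longrightarrow>
      ?e \<mu> \<le> ennreal K1 * ?c R \<mu>"
      using embedding_norm_le_carleson_norm[OF assms(1,2,5) R assms(3), where 'n = 'n] by blast
    obtain K2 where K2: "0 < K2" "\<And>\<mu> :: (complex ^ 'n) measure. \<mu> \<in> borel_measures_on_ball \<Longrightarrow>
      ?c R \<mu> \<le> ennreal K2 * ?e \<mu>"
      using carleson_norm_le_embedding_norm[OF assms(1,2,5) R assms(3,4)] by blast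
    have le: "ennreal K1 * x \<le> ennreal (max K1 K2) * x" "ennreal K2 * x \<le> ennreal (max K1 K2) * x" for x
      by (auto intro!: mult_right_mono ennreal_leI)
    show ?thesis
    proof (intro exI[of _ "max K1 K2"] conjI ballI)
      fix \<mu> :: "(complex ^ 'n) measure" assume \<mu>: "\<mu> \<in> borel_measures_on_ball"
      show "?e \<mu> \<le> ennreal (max K1 K2) * ?c R \<mu>"
        by (rule order.trans[OF K1(2)[OF \<mu>] le(1)])
      show "?c R \<mu> \<le> ennreal (max K1 K2) * ?e \<mu>"
        by (rule order.trans[OF K2(2)[OF \<mu>] le(2)])
    qed (use K1 in simp)
  qed
  \<comment> \<open>The left side does not mention \<open>R\<close>, so this single equivalence
    yields the universal and the existential form; R = 1 shows that a positive radius
    exists.\<close>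
  have "embedding_bounded N p q s t r \<mu> \<longleftrightarrow> ?c R \<mu> < top"
    if \<mu>: "\<mu> \<in> borel_measures_on_ball" and R: "0 < R" for \<mu> :: "(complex ^ 'n) measure" and R
  proof -
    obtain C where "?e \<mu> \<le> ennreal C * ?c R \<mu>"
      "?c R \<mu> \<le> ennreal C * ?e \<mu>"
      using equiv[OF R] \<mu> by blast
    thus ?thesis unfolding embedding_bounded_iff[where q = q]
      by (meson ennreal_less_top ennreal_mult_less_top le_less_trans)
  qed
  thus ?thesis using equiv zero_less_one by blast
qed

end
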